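(* Let $(X,\mathsf d,\mathfrak m)$ be an infinitesimally Hilbertian, complete and separable metric space equipped with a non-negative Borel measure which is finite on bounded sets. Let $K\in\mathbb R$ and assume that the heat flow $(\mathsf h_t)$ of $(X,\mathsf d,\mathfrak m)$ has a heat kernel $\mathsf r_t[x](y)$ (in the sense of the context) and satisfies the dimension-free Harnack inequality: for every $p\in(1,\infty)$, $t>0$, $x,y\in X$ and $f\in L^1\cap L^\infty(X)$, $$|\mathsf h_t f(x)|^p\le (\mathsf h_t|f|^p)(y)\,\exp\Big(\frac{pK\,\mathsf d^2(x,y)}{2(p-1)(e^{2Kt}-1)}\Big).$$ Then, for every $t>0$, $\mathsf h_t$ maps $L^\infty(X)$ into the space $\mathrm{LIP}(X)$ of Lipschitz continuous functions, and for any positive $f\in L^\infty(X)$ and $t>0$ it holds $$\mathrm{lip}(\mathsf h_tf)^2\le\frac{2K}{e^{2Kt}-1}\,\mathsf h_tf\,\big(\mathsf h_t(f\log f)-\mathsf h_tf\log\mathsf h_tf\big)\qquad\text{pointwise on }X.$$ In addition, for any $p\in(1,\infty)$, any positive $f\in L^p(X)$ and any $t>0$ it holds $$|D\mathsf h_tf|^2\le\frac{2K}{e^{2Kt}-1}\,\mathsf h_tf\,\big(\mathsf h_t(f\log f)-\mathsf h_tf\log\mathsf h_tf\big)\qquad\mathfrak m\text{-a.e.}$$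
   Context: When $K=0$, the quotient $\frac{K}{e^{2Kt}-1}$ is understood as its limit $\frac1{2t}$, and $0\log0=0$. For $f:X\to\mathbb R$ the local Lipschitz constant is $\mathrm{lip}(f)(x)=\limsup_{y\to x}\frac{|f(x)-f(y)|}{\mathsf d(x,y)}$ if $x$ is not isolated, and $0$ if $x$ is isolated. Sobolev class: a test plan is a Borel probability measure $\pi$ on $C([0,1],X)$, concentrated on absolutely continuous curves, with $\int\int_0^1|\dot\gamma_t|^2\,dt\,d\pi(\gamma)<\infty$ and such that for some $C>0$ one has $(e_t)_*\pi\le C\mathfrak m$ for all $t\in[0,1]$, where $e_t(\gamma)=\gamma_t$. A Borel function $f$ belongs to $S^2(X)$ if there is a non-negative $G\in L^2(X)$ with $\int|f(\gamma_1)-f(\gamma_0)|\,d\pi\le\int\int_0^1G(\gamma_t)|\dot\gamma_t|\,dt\,d\pi$ for every test plan $\pi$; the $\mathfrak m$-a.e. minimal such $G$ is the minimal weak upper gradient $|Df|$. By locality ($|Df|=|Dg|$ $\mathfrak m$-a.e. on $\{f=g\}$), $|Df|$ is also defined for functions which on every bounded set coincide $\mathfrak m$-a.e. with some element of $S^2(X)$; $|D\mathsf h_tf|$ in the claim is understood in this local sense. $W^{1,2}(X)=L^2(X)\cap S^2(X)$ with norm $\|f\|_{W^{1,2}}^2=\|f\|_{L^2}^2+\||Df|\|_{L^2}^2$. The space is infinitesimally Hilbertian if $W^{1,2}(X)$ is a Hilbert space. The Cheeger energy is $E(f)=\frac12\int|Df|^2\,d\mathfrak m$ for $f\in W^{1,2}(X)$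 and $+\infty$ otherwise on $L^2(X)$; in the infinitesimally Hilbertian case it is a quadratic (Dirichlet) form, with associated bilinear form $\int\langle\nabla f,\nabla g\rangle\,d\mathfrak m$ obtained by polarization. The Laplacian $\Delta$ is defined by $f\in D(\Delta)$, $g=\Delta f\in L^2(X)$ iff $f\in W^{1,2}(X)$ and $\int\phi g\,d\mathfrak m=-\int\langle\nabla\phi,\nabla f\rangle\,d\mathfrak m$ for all $\phi\in W^{1,2}(X)$. The heat flow $(\mathsf h_t)$ on $L^2(X)$ is the semigroup with $\frac{d}{dt}\mathsf h_tf=\Delta\mathsf h_tf$, $\mathsf h_tf\to f$ in $L^2(X)$ as $t\downarrow0$. Heat kernel: a function $(0,\infty)\times X^2\ni(t,x,y)\mapsto\mathsf r_t[x](y)\in(0,\infty)$ such that for every $x\in X$, $t>0$, $\mathsf r_t[x]$ is a probability density with respect to $\mathfrak m$, and $\mathsf h_tf(x)=\int f(y)\,\mathsf r_t[x](y)\,d\mathfrak m(y)$ for all $t>0$, $f\in L^2(X)$. This formula defines $\mathsf h_tf$ pointwise at every $x\in X$ and extends it to $L^\infty(X)$, to $L^p(X)$, and to functions bounded from below such as $f\log f$ (with values possibly $+\infty$); the Harnack inequality is understood for these pointwise values. *)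

theory Defs
  imports "HOL-Analysis.Analysis"
begin

text \<open>
  A complete separable metric space is a type of class \<^class>\<open>polish_space\<close>. Elements of
  function spaces over \<open>m\<close> are Borel functions, not equivalence classes; everything below is
  insensitive to changes on null sets, except \<open>heat\<close> and \<open>lip\<close>, which are pointwise.
\<close>

definition metric_measure_space :: "'a::polish_space measure \<Rightarrow> bool" where
  "metric_measure_space m \<longleftrightarrow>
     sets m = sets borel \<and> (\<forall>B\<in>sets borel. bounded B \<longrightarrow> emeasure m B < \<infinity>)"

definition Lp :: "'a measure \<Rightarrow> real \<Rightarrow> ('a \<Rightarrow> real) set" where
  "Lp m p = {f \<in> borel_measurable m. integrable m (\<lambda>x. \<bar>f x\<bar> powr p)}"

definition Linf :: "'a measure \<Rightarrow> ('a \<Rightarrow> real) set" where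
  "Linf m = {f \<in> borel_measurable m. \<exists>C. AE x in m. \<bar>f x\<bar> \<le> C}"

definition L2_norm :: "'a measure \<Rightarrow> ('a \<Rightarrow> real) \<Rightarrow> real" where
  "L2_norm m f = sqrt (\<integral>x. (f x)\<^sup>2 \<partial>m)"

definition lip :: "('a::metric_space \<Rightarrow> real) \<Rightarrow> 'a \<Rightarrow> ereal" where
  "lip f x = (if x islimpt UNIV
              then Limsup (at x) (\<lambda>y. ereal (\<bar>f x - f y\<bar> / dist x y)) else 0)"


section \<open>Test plans and the Sobolev class\<close>

text \<open>
  \<open>C([0,1],X)\<close> with the supremum distance, its curves being extended by \<open>undefined\<close> outside the
  interval, and its Borel sigma-algebra.
\<close>

definition curve_space :: "(real \<Rightarrow> 'a::polish_space) metric" where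
  "curve_space = cfunspace (top_of_set {0..1}) euclidean_metric"

definition borel_curves :: "(real \<Rightarrow> 'a::polish_space) measure" where
  "borel_curves = sigma (mspace curve_space) {U. openin (mtopology_of curve_space) U}"

definition abs_continuous_curve :: "(real \<Rightarrow> 'a::metric_space) \<Rightarrow> bool" where
  "abs_continuous_curve \<gamma> \<longleftrightarrow>
     (\<exists>g::real \<Rightarrow> real. set_integrable lborel {0..1} g \<and>
        (\<forall>s t. 0 \<le> s \<longrightarrow> s \<le> t \<longrightarrow> t \<le> 1 \<longrightarrow> dist (\<gamma> s) (\<gamma> t) \<le> (\<integral>r\<in>{s..t}. g r \<partial>lborel)))"

text \<open>
  For an absolutely continuous curve the difference quotients converge at almost every time;
  the upper limit makes the metric speed total and equals the limit wherever the latter exists.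
\<close>

definition metric_speed :: "(real \<Rightarrow> 'a::metric_space) \<Rightarrow> real \<Rightarrow> ennreal" where
  "metric_speed \<gamma> t = Limsup (at t within {0..1}) (\<lambda>s. ennreal (dist (\<gamma> s) (\<gamma> t) / \<bar>s - t\<bar>))"

definition test_plan :: "'a::polish_space measure \<Rightarrow> (real \<Rightarrow> 'a) measure \<Rightarrow> bool" where
  "test_plan m \<pi> \<longleftrightarrow>
     sets \<pi> = sets borel_curves \<and> emeasure \<pi> (space \<pi>) = 1 \<and>
     (AE \<gamma> in \<pi>. abs_continuous_curve \<gamma>) \<and>
     (\<integral>\<^sup>+\<gamma>. (\<integral>\<^sup>+t\<in>{0..1}. (metric_speed \<gamma> t)\<^sup>2 \<partial>lborel) \<partial>\<pi>) < \<infinity> \<and>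
     (\<exists>C>0. \<forall>t\<in>{0..1}. \<forall>A\<in>sets borel.
        emeasure (distr \<pi> borel (\<lambda>\<gamma>. \<gamma> t)) A \<le> ennreal C * emeasure m A)"

definition weak_upper_gradient ::
    "'a::polish_space measure \<Rightarrow> ('a \<Rightarrow> real) \<Rightarrow> ('a \<Rightarrow> real) \<Rightarrow> bool" where
  "weak_upper_gradient m f G \<longleftrightarrow>
     G \<in> Lp m 2 \<and> (\<forall>x. 0 \<le> G x) \<and>
     (\<forall>\<pi>. test_plan m \<pi> \<longrightarrow>
        (\<integral>\<^sup>+\<gamma>. ennreal \<bar>f (\<gamma> 1) - f (\<gamma> 0)\<bar> \<partial>\<pi>)
          \<le> (\<integral>\<^sup>+\<gamma>. (\<integral>\<^sup>+t\<in>{0..1}. ennreal (G (\<gamma> t)) * metric_speed \<gamma> t \<partial>lborel) \<partial>\<pi>))"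

definition S2 :: "'a::polish_space measure \<Rightarrow> ('a \<Rightarrow> real) set" where
  "S2 m = {f \<in> borel_measurable m. \<exists>G. weak_upper_gradient m f G}"

text \<open>A representative of the minimal weak upper gradient, for \<open>f \<in> S2 m\<close>.\<close>

definition min_weak_ug :: "'a::polish_space measure \<Rightarrow> ('a \<Rightarrow> real) \<Rightarrow> 'a \<Rightarrow> real" where
  "min_weak_ug m f =
     (SOME G. weak_upper_gradient m f G \<and>
        (\<forall>G'. weak_upper_gradient m f G' \<longrightarrow> (AE x in m. G x \<le> G' x)))"

definition S2_loc :: "'a::polish_space measure \<Rightarrow> ('a \<Rightarrow> real) set" where
  "S2_loc m = {f. \<forall>B. bounded B \<longrightarrow> (\<exists>g\<in>S2 m. AE x in m. x \<in> B \<longrightarrow> f x = g x)}"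

text \<open>The extension by locality of the minimal weak upper gradient to \<open>f \<in> S2_loc m\<close>.\<close>

definition min_weak_ug_loc :: "'a::polish_space measure \<Rightarrow> ('a \<Rightarrow> real) \<Rightarrow> 'a \<Rightarrow> real" where
  "min_weak_ug_loc m f =
     (SOME G. G \<in> borel_measurable m \<and>
        (\<forall>B. \<forall>g\<in>S2 m. bounded B \<longrightarrow> (AE x in m. x \<in> B \<longrightarrow> f x = g x) \<longrightarrow>
           (AE x in m. x \<in> B \<longrightarrow> G x = min_weak_ug m g x)))"

definition W12 :: "'a::polish_space measure \<Rightarrow> ('a \<Rightarrow> real) set" where
  "W12 m = Lp m 2 \<inter> S2 m"

definition W12_norm :: "'a::polish_space measure \<Rightarrow> ('a \<Rightarrow> real) \<Rightarrow> real" where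
  "W12_norm m f = sqrt ((L2_norm m f)\<^sup>2 + (L2_norm m (min_weak_ug m f))\<^sup>2)"

text \<open>\<open>W12\<close> is a Hilbert space: its norm comes from an inner product and is complete.\<close>

definition infinitesimally_Hilbertian :: "'a::polish_space measure \<Rightarrow> bool" where
  "infinitesimally_Hilbertian m \<longleftrightarrow>
     (\<exists>ip :: ('a \<Rightarrow> real) \<Rightarrow> ('a \<Rightarrow> real) \<Rightarrow> real.
        (\<forall>f\<in>W12 m. \<forall>g\<in>W12 m. ip f g = ip g f) \<and>
        (\<forall>f\<in>W12 m. \<forall>g\<in>W12 m. \<forall>k\<in>W12 m. \<forall>a b.
           ip (\<lambda>x. a * f x + b * g x) k = a * ip f k + b * ip g k) \<and>
        (\<forall>f\<in>W12 m. ip f f = (W12_norm m f)\<^sup>2)) \<and>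
     (\<forall>F :: nat \<Rightarrow> 'a \<Rightarrow> real.
        (\<forall>n. F n \<in> W12 m) \<longrightarrow>
        (\<forall>\<epsilon>>0. \<exists>N. \<forall>i\<ge>N. \<forall>j\<ge>N. W12_norm m (\<lambda>x. F i x - F j x) < \<epsilon>) \<longrightarrow>
        (\<exists>f\<in>W12 m. (\<lambda>n. W12_norm m (\<lambda>x. F n x - f x)) \<longlonglongrightarrow> 0))"


section \<open>Cheeger energy, Laplacian and heat flow\<close>

definition cheeger :: "'a::polish_space measure \<Rightarrow> ('a \<Rightarrow> real) \<Rightarrow> ennreal" where
  "cheeger m f =
     (if f \<in> W12 m then ennreal (1/2) * (\<integral>\<^sup>+x. ennreal ((min_weak_ug m f x)\<^sup>2) \<partial>m) else \<infinity>)"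

text \<open>The integral of \<open>\<langle>\<nabla>f, \<nabla>g\<rangle>\<close>, by polarization of \<open>2 * cheeger m\<close>; for \<open>f, g \<in> W12 m\<close>.\<close>

definition dirichlet_form ::
    "'a::polish_space measure \<Rightarrow> ('a \<Rightarrow> real) \<Rightarrow> ('a \<Rightarrow> real) \<Rightarrow> real" where
  "dirichlet_form m f g =
     (enn2real (cheeger m (\<lambda>x. f x + g x)) - enn2real (cheeger m (\<lambda>x. f x - g x))) / 2"

text \<open>\<open>has_laplacian m f g\<close>: \<open>f\<close> is in the domain of the Laplacian and \<open>g\<close> represents it.\<close>

definition has_laplacian ::
    "'a::polish_space measure \<Rightarrow> ('a \<Rightarrow> real) \<Rightarrow> ('a \<Rightarrow> real) \<Rightarrow> bool" where
  "has_laplacian m f g \<longleftrightarrow>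
     f \<in> W12 m \<and> g \<in> Lp m 2 \<and>
     (\<forall>\<phi>\<in>W12 m. (\<integral>x. \<phi> x * g x \<partial>m) = - dirichlet_form m \<phi> f)"

text \<open>
  The heat flow is the family \<open>h\<close>, unique up to null sets, with this property; the derivative in
  time and the limit at \<open>0\<close> are taken in \<open>L\<^sup>2\<close>.
\<close>

definition is_heat_flow ::
    "'a::polish_space measure \<Rightarrow> (real \<Rightarrow> ('a \<Rightarrow> real) \<Rightarrow> 'a \<Rightarrow> real) \<Rightarrow> bool" where
  "is_heat_flow m h \<longleftrightarrow>
     (\<forall>f\<in>Lp m 2.
        (\<forall>t>0. h t f \<in> Lp m 2) \<and>
        (\<forall>s>0. \<forall>t>0. AE x in m. h (s + t) f x = h s (h t f) x) \<and>
        (\<forall>t>0. \<exists>g. has_laplacian m (h t f) g \<and>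
           ((\<lambda>s. L2_norm m (\<lambda>x. (h s f x - h t f x) / (s - t) - g x)) \<longlongrightarrow> 0) (at t)) \<and>
        ((\<lambda>t. L2_norm m (\<lambda>x. h t f x - f x)) \<longlongrightarrow> 0) (at_right 0))"

text \<open>
  Integration against the kernel, \<open>r t x y\<close> being \<open>r\<^sub>t[x](y)\<close>. The second variant is for
  functions bounded from below and takes values in \<open>(-\<infinity>, \<infinity>]\<close>. For \<open>f\<close> in any \<open>L\<^sup>p\<close>, \<open>p > 1\<close>, the
  dimension-free Harnack inequality makes \<open>f * r t x\<close> integrable for every \<open>x\<close>, so the real-valued
  integral is then not the default value of a divergent one.
\<close>

definition heat ::
    "'a measure \<Rightarrow> (real \<Rightarrow> 'a \<Rightarrow> 'a \<Rightarrow> real) \<Rightarrow> real \<Rightarrow> ('a \<Rightarrow> real) \<Rightarrow> 'a \<Rightarrow> real" where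
  "heat m r t f x = (\<integral>y. f y * r t x y \<partial>m)"

definition heat_ext ::
    "'a measure \<Rightarrow> (real \<Rightarrow> 'a \<Rightarrow> 'a \<Rightarrow> real) \<Rightarrow> real \<Rightarrow> ('a \<Rightarrow> real) \<Rightarrow> 'a \<Rightarrow> ereal" where
  "heat_ext m r t f x =
     enn2ereal (\<integral>\<^sup>+y. ennreal (f y * r t x y) \<partial>m) - enn2ereal (\<integral>\<^sup>+y. ennreal (- (f y * r t x y)) \<partial>m)"

text \<open>The heat flow \<open>h\<close> is only determined almost everywhere, hence so is the last identity.\<close>

definition is_heat_kernel ::
    "'a::polish_space measure \<Rightarrow> (real \<Rightarrow> ('a \<Rightarrow> real) \<Rightarrow> 'a \<Rightarrow> real)
       \<Rightarrow> (real \<Rightarrow> 'a \<Rightarrow> 'a \<Rightarrow> real) \<Rightarrow> bool" where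
  "is_heat_kernel m h r \<longleftrightarrow>
     (\<forall>t>0. \<forall>x. r t x \<in> borel_measurable m \<and> (\<forall>y. 0 < r t x y) \<and>
                (\<integral>\<^sup>+y. ennreal (r t x y) \<partial>m) = 1) \<and>
     (\<forall>t>0. \<forall>f\<in>Lp m 2. AE x in m. h t f x = heat m r t f x)"

definition curv_coeff :: "real \<Rightarrow> real \<Rightarrow> real" where
  "curv_coeff K t = (if K = 0 then 1 / (2 * t) else K / (exp (2 * K * t) - 1))"

definition dimension_free_Harnack ::
    "'a::polish_space measure \<Rightarrow> (real \<Rightarrow> 'a \<Rightarrow> 'a \<Rightarrow> real) \<Rightarrow> real \<Rightarrow> bool" where
  "dimension_free_Harnack m r K \<longleftrightarrow>
     (\<forall>p>1. \<forall>t>0. \<forall>x y. \<forall>f \<in> Lp m 1 \<inter> Linf m.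
        \<bar>heat m r t f x\<bar> powr p
          \<le> heat m r t (\<lambda>z. \<bar>f z\<bar> powr p) y
              * exp (p * curv_coeff K t * (dist x y)\<^sup>2 / (2 * (p - 1))))"

text \<open>
  \<open>h\<^sub>tf (h\<^sub>t(f log f) - h\<^sub>tf log h\<^sub>tf)\<close> at \<open>x\<close>, for \<open>f \<ge> 0\<close>. Here \<open>0 * ln 0 = 0\<close> holds by the
  library's conventions, and only the term \<open>h\<^sub>t(f log f)\<close> may be infinite.
\<close>

definition heat_entropy ::
    "'a measure \<Rightarrow> (real \<Rightarrow> 'a \<Rightarrow> 'a \<Rightarrow> real) \<Rightarrow> real \<Rightarrow> ('a \<Rightarrow> real) \<Rightarrow> 'a \<Rightarrow> ereal" where
  "heat_entropy m r t f x =
     ereal (heat m r t f x) *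
       (heat_ext m r t (\<lambda>y. f y * ln (f y)) x - ereal (heat m r t f x * ln (heat m r t f x)))"

end

theory Submission
  imports Defs "HOL-Probability.Probability_Measure"
begin

text \<open>
  Write \<open>P = h\<^sub>t\<close> and \<open>c = K / (exp (2 * K * t) - 1)\<close>. The pointwise estimate is the Harnack inequality
  differentiated at \<open>p = 1\<close>. For \<open>f \<ge> 0\<close>, \<open>u = Pf(x)\<close>, \<open>v = Pf(y)\<close>, \<open>d = dist x y\<close> and \<open>p = 1 + s\<close> it says that
  \<open>u powr (1 + s)\<close> is at most \<open>P(f powr (1 + s))(y) * exp ((1 + s) * c * d\<^sup>2 / (2 * s))\<close>. The power on the
  left lies above its tangent at \<open>v\<close>, so this turns into a bound on the increment,
  \<open>u - v \<le> v * (exp E - 1) + s * exp E * A\<close> with \<open>E = (1 + s) * c * d\<^sup>2 / (2 * s)\<close>, where the quantity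
  \<open>A = P(f * ((f / v) powr s - 1) / s)(y)\<close>, called \<open>excess\<close> below, decreases to the entropy
  \<open>P(f log f) - Pf log Pf\<close> as \<open>s\<close> decreases to \<open>0\<close> (\<open>ave_difference_le\<close>). Taking \<open>s\<close> equal to \<open>d\<close> gives Lipschitz
  bounds; taking \<open>s = a * d\<close> and letting \<open>d\<close> tend to \<open>0\<close> bounds the slope at \<open>y\<close> by
  \<open>c * v / (2 * a) + a * entropy\<close>, and the best \<open>a > 0\<close> yields \<open>sqrt (2 * c * v * entropy)\<close>
  (\<open>ave_gradient_bound\<close>). These arguments use no more than a family of probability measures satisfying
  the Harnack inequality, and they apply to every \<open>f\<close> for which \<open>P(f powr q)\<close> is finite at a single point
  for a single \<open>q > 1\<close>, because the Harnack inequality spreads finiteness to all of \<open>X\<close>, locally uniformly.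

  Bounded functions satisfy this at once. For \<open>f\<close> in \<open>L\<^sup>p\<close> it holds with \<open>q = p\<close>: the heat flow is symmetric on
  \<open>L\<^sup>2\<close>, hence the integral of \<open>P(f powr p)\<close> over a bounded set is at most that of \<open>f powr p\<close> over \<open>X\<close>
  (\<open>heat_of_integrable_finite\<close>). Symmetry holds since the \<open>L\<^sup>2\<close> product of \<open>h\<^sub>sf\<close> and
  \<open>h\<^bsub>t-s\<^esub>g\<close> has zero derivative in \<open>s\<close>, the Dirichlet form being symmetric
  (\<open>heat_flow_self_adjoint\<close>).

  It remains to compare the minimal weak upper gradient with the slope. A Lipschitz function has every
  Borel bound on its slope as an upper gradient along curves of finite energy, and \<open>Pf\<close> is Lipschitz on
  bounded sets, so it can be cut off there (\<open>locally_lipschitz_gradient_bound\<close>). That minimal weak upper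
  gradients exist and are local is one fact about test plans: if \<open>G1\<close>, \<open>G2\<close> are weak upper gradients of
  \<open>f1\<close>, \<open>f2\<close>, then \<open>G1\<close> may be lowered to \<open>min G1 G2\<close> on the set \<open>{f1 = f2}\<close>
  (\<open>weak_upper_gradient_localize\<close>). Along almost every curve it reduces to a statement on functions of one
  real variable (\<open>increment_le_on_coincidence_set\<close>).
\<close>

section \<open>Increments of functions of one real variable\<close>

lemma set_integrable_of_integrable:
  "integrable lborel g \<Longrightarrow> A \<in> sets borel \<Longrightarrow> set_integrable lborel A (g :: real \<Rightarrow> real)"
  unfolding set_integrable_def by (intro integrable_mult_indicator) auto

lemma integrable_indicator_times:
  "integrable lborel g \<Longrightarrow> A \<in> sets borel \<Longrightarrow> integrable lborel (\<lambda>t. indicator A t * g t :: real)"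
  for g :: "real \<Rightarrow> real"
  using integrable_mult_indicator[of A lborel g] by simp

lemma set_integral_split:
  fixes g :: "real \<Rightarrow> real"
  assumes g: "integrable lborel g" and "a \<le> b" "b \<le> c"
  shows "(LINT r:{a..c}|lborel. g r) = (LINT r:{a..b}|lborel. g r) + (LINT r:{b..c}|lborel. g r)"
proof -
  have "(LINT r:{a..b} \<union> {b..c}|lborel. g r) = (LINT r:{a..b}|lborel. g r) + (LINT r:{b..c}|lborel. g r)"
  proof (rule set_integral_Un_AE)
    have "AE r in lborel. r \<noteq> b" by (rule AE_lborel_singleton)
    then show "AE r in lborel. \<not> (r \<in> {a..b} \<and> r \<in> {b..c})" by eventually_elim auto
  qed (use g in \<open>auto intro!: set_integrable_of_integrable\<close>)
  then show ?thesis using assms by (simp add: ivl_disj_un_two_touch)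
qed

text \<open>
  Inner regularity of the finite measure with density \<open>g\<close>, applied to \<open>A\<close> and to the complement of the
  compact set found first.
\<close>

lemma compact_inside_open_outside:
  fixes g :: "real \<Rightarrow> real"
  assumes g: "integrable lborel g" "\<And>t. 0 \<le> g t" and A: "A \<in> sets borel" and e: "0 < e"
  obtains K U where "compact K" "K \<subseteq> A" "open U" "K \<subseteq> U"
    "(LINT r:A - K|lborel. g r) \<le> e" "(LINT r:U - K|lborel. g r) \<le> e"
proof -
  define \<nu> where "\<nu> = density lborel (\<lambda>t. ennreal (g t))"
  have [measurable]: "g \<in> borel_measurable borel" using g(1) by auto
  have sets: "sets \<nu> = sets borel" by (simp add: \<nu>_def)
  have em: "emeasure \<nu> B = ennreal (LINT r:B|lborel. g r)" if "B \<in> sets borel" for B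
  proof -
    have "emeasure \<nu> B = (\<integral>\<^sup>+r. ennreal (indicator B r * g r) \<partial>lborel)"
      unfolding \<nu>_def using that
      by (subst emeasure_density) (auto intro!: nn_integral_cong split: split_indicator)
    also have "\<dots> = ennreal (LINT r:B|lborel. g r)"
      unfolding set_lebesgue_integral_def using set_integrable_of_integrable[OF g(1) that] g(2)
      by (subst nn_integral_eq_integral) (auto simp: set_integrable_def)
    finally show ?thesis .
  qed
  have fin: "emeasure \<nu> (space \<nu>) \<noteq> \<infinity>"
    using em[of UNIV] by (simp add: \<nu>_def)
  interpret finite_measure \<nu> using fin by (intro finite_measureI) auto
  have small: "\<exists>K. compact K \<and> K \<subseteq> B \<and> emeasure \<nu> (B - K) \<le> ennreal e" if B: "B \<in> sets borel" for B
  proof (cases "emeasure \<nu> B = 0")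
    case True
    then show ?thesis by (intro exI[of _ "{}"]) auto
  next
    case False
    then have "emeasure \<nu> B - ennreal e < emeasure \<nu> B"
      using e by (intro ennreal_between) (auto simp: emeasure_finite less_top[symmetric] zero_less_iff_neq_zero)
    then obtain K where K: "compact K" "K \<subseteq> B" "emeasure \<nu> B - ennreal e < emeasure \<nu> K"
      unfolding inner_regular[OF sets fin B] by (auto simp: less_SUP_iff)
    have "emeasure \<nu> (B - K) = emeasure \<nu> B - emeasure \<nu> K"
      using K B by (intro emeasure_Diff) (auto simp: sets compact_imp_closed emeasure_finite)
    also have "\<dots> \<le> ennreal e"
    proof -
      have "emeasure \<nu> B \<le> ennreal e + emeasure \<nu> K"
        using less_imp_le[OF K(3)] by (simp add: ennreal_minus_le_iff)
      then show ?thesis by (simp add: ennreal_minus_le_iff add.commute)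
    qed
    finally show ?thesis using K by blast
  qed
  obtain K where K: "compact K" "K \<subseteq> A" "emeasure \<nu> (A - K) \<le> ennreal e"
    using small[OF A] by blast
  have Kb: "K \<in> sets borel" using K by (simp add: compact_imp_closed)
  obtain C where C: "compact C" "C \<subseteq> - K" "emeasure \<nu> (- K - C) \<le> ennreal e"
    using small[of "- K"] Kb by auto
  have nn: "0 \<le> (LINT r:B|lborel. g r)" for B
    unfolding set_lebesgue_integral_def using g(2) by simp
  show thesis
  proof (rule that[of K "- C"])
    show "open (- C)" using compact_imp_closed[OF C(1)] by (rule open_Compl)
    show "(LINT r:A - K|lborel. g r) \<le> e"
      using K(3) em[of "A - K"] A Kb e by (simp add: ennreal_le_iff)
    have "- C - K = - K - C" by auto
    then show "(LINT r:- C - K|lborel. g r) \<le> e"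
      using C(1,3) em[of "- K - C"] Kb e by (simp add: ennreal_le_iff compact_imp_closed)
  qed (use K C in auto)
qed

text \<open>
  If the increments of \<open>F1\<close>, \<open>F2\<close> are controlled by \<open>g1\<close>, \<open>g2\<close>, then the control of \<open>F2\<close> may be used for \<open>F1\<close>
  on the set \<open>A\<close>, where both functions agree. Replace \<open>A\<close> by a compact subset \<open>K\<close> with an open
  neighbourhood \<open>U\<close>, both close to \<open>A\<close> in measure, and partition the interval so finely that each piece
  meeting \<open>K\<close> lies in \<open>U\<close>. Between the first and the last point of \<open>K\<close> in such a piece the increments of
  \<open>F1\<close> and \<open>F2\<close> coincide; the rest of the piece is disjoint from \<open>K\<close> and keeps the control \<open>g1\<close>. The
  functions are only controlled at the times in \<open>D\<close>, which contains the points of a rational partition.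
\<close>

lemma increment_le_on_coincidence_set:
  fixes F1 F2 g1 g2 :: "real \<Rightarrow> real"
  assumes g1: "integrable lborel g1" "\<And>t. 0 \<le> g1 t"
    and g2: "integrable lborel g2" "\<And>t. 0 \<le> g2 t"
    and D: "\<rat> \<inter> {0..1} \<subseteq> D" "D \<subseteq> {0..1}"
    and F1: "\<And>s t. \<lbrakk>s \<in> D; t \<in> D; s \<le> t\<rbrakk> \<Longrightarrow> \<bar>F1 t - F1 s\<bar> \<le> (LINT r:{s..t}|lborel. g1 r)"
    and F2: "\<And>s t. \<lbrakk>s \<in> D; t \<in> D; s \<le> t\<rbrakk> \<Longrightarrow> \<bar>F2 t - F2 s\<bar> \<le> (LINT r:{s..t}|lborel. g2 r)"
    and A: "A \<in> sets borel" "A \<subseteq> D" "\<And>t. t \<in> A \<Longrightarrow> F1 t = F2 t"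
  shows "\<bar>F1 1 - F1 0\<bar> \<le> (LINT t:{0..1}|lborel. if t \<in> A then g2 t else g1 t)"
proof (rule field_le_epsilon)
  fix e :: real assume e: "0 < e"
  let ?g = "\<lambda>t. g1 t + g2 t"
  obtain K U where K: "compact K" "K \<subseteq> A" and U: "open U" "K \<subseteq> U"
    and sm: "(LINT r:A - K|lborel. ?g r) \<le> e / 2" "(LINT r:U - K|lborel. ?g r) \<le> e / 2"
    using compact_inside_open_outside[of ?g A "e / 2"] g1 g2 A e by (auto simp: add_nonneg_nonneg)
  have [measurable]: "K \<in> sets borel" "U \<in> sets borel" "A \<in> sets borel"
    using K U A by (auto simp: compact_imp_closed)
  obtain \<delta> where \<delta>: "0 < \<delta>" "(\<Union>x\<in>K. ball x \<delta>) \<subseteq> U"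
    using compact_subset_open_imp_ball_epsilon_subset[OF K(1) U] by blast
  \<comment> \<open>On an interval inside \<open>U\<close> both controls are available, on one avoiding \<open>K\<close> only the first.\<close>
  define w where "w t = indicator (- K) t * g1 t + indicator U t * g2 t" for t
  have wi: "integrable lborel w"
    unfolding w_def
    using integrable_mult_indicator[OF _ g1(1), of "- K"] integrable_mult_indicator[OF _ g2(1), of U]
    by (intro Bochner_Integration.integrable_add) auto
  have gi: "integrable lborel ?g" using g1 g2 by auto
  have mixed: "integrable lborel (\<lambda>t. if t \<in> A then g2 t else g1 t)"
  proof -
    have "(\<lambda>t. if t \<in> A then g2 t else g1 t) = (\<lambda>t. indicator A t * g2 t + indicator (- A) t * g1 t)"
      by (auto split: split_indicator)
    then show ?thesis
      by (simp only:) (intro Bochner_Integration.integrable_add integrable_indicator_times g1 g2, auto)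
  qed
  have w0: "0 \<le> w t" for t using g1(2) g2(2) by (simp add: w_def)
  have outside: "\<bar>F1 d - F1 c\<bar> \<le> (LINT r:{c..d}|lborel. w r)"
    if cd: "c \<in> D" "d \<in> D" "c \<le> d" and out: "AE r in lborel. r \<in> {c..d} \<longrightarrow> r \<notin> K" for c d
  proof -
    have "\<bar>F1 d - F1 c\<bar> \<le> (LINT r:{c..d}|lborel. g1 r)" by (rule F1[OF cd])
    also have "\<dots> \<le> (LINT r:{c..d}|lborel. w r)"
    proof (intro set_integral_mono_AE set_integrable_of_integrable g1 wi)
      show "AE r\<in>{c..d} in lborel. g1 r \<le> w r"
        using out by eventually_elim (use g2(2) in \<open>auto simp: w_def\<close>)
    qed auto
    finally show ?thesis .
  qed
  have step: "\<bar>F1 b - F1 a\<bar> \<le> (LINT r:{a..b}|lborel. w r)"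
    if ab: "a \<in> D" "b \<in> D" "a \<le> b" "b - a < \<delta>" for a b
  proof (cases "K \<inter> {a..b} = {}")
    case True
    show ?thesis by (rule outside[OF ab(1-3) AE_I2]) (use True in auto)
  next
    case False
    have cK: "compact (K \<inter> {a..b})" using K(1) by (intro compact_Int) auto
    obtain a' where a': "a' \<in> K \<inter> {a..b}" "\<And>t. t \<in> K \<inter> {a..b} \<Longrightarrow> a' \<le> t"
      using compact_attains_inf[OF cK False] by blast
    obtain b' where b': "b' \<in> K \<inter> {a..b}" "\<And>t. t \<in> K \<inter> {a..b} \<Longrightarrow> t \<le> b'"
      using compact_attains_sup[OF cK False] by blast
    have ord: "a \<le> a'" "a' \<le> b'" "b' \<le> b" using a' b' by auto
    have inD: "a' \<in> D" "b' \<in> D" using a' b' K A by auto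
    have IU: "{a..b} \<subseteq> U"
    proof
      fix t assume "t \<in> {a..b}"
      then have "t \<in> ball a' \<delta>" using a'(1) ab(4) by (auto simp: dist_real_def)
      then show "t \<in> U" using \<delta>(2) a'(1) by blast
    qed
    have 1: "\<bar>F1 a' - F1 a\<bar> \<le> (LINT r:{a..a'}|lborel. w r)"
    proof (rule outside[OF ab(1) inD(1) ord(1)])
      have "AE r in lborel. r \<noteq> a'" by (rule AE_lborel_singleton)
      then show "AE r in lborel. r \<in> {a..a'} \<longrightarrow> r \<notin> K"
        by eventually_elim (use a'(2) ord in fastforce)
    qed
    have 2: "\<bar>F1 b - F1 b'\<bar> \<le> (LINT r:{b'..b}|lborel. w r)"
    proof (rule outside[OF inD(2) ab(2) ord(3)])
      have "AE r in lborel. r \<noteq> b'" by (rule AE_lborel_singleton)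
      then show "AE r in lborel. r \<in> {b'..b} \<longrightarrow> r \<notin> K"
        by eventually_elim (use b'(2) ord in fastforce)
    qed
    have 3: "\<bar>F1 b' - F1 a'\<bar> \<le> (LINT r:{a'..b'}|lborel. w r)"
    proof -
      have "F1 b' = F2 b'" "F1 a' = F2 a'" using A(3) K(2) a' b' by auto
      then have "\<bar>F1 b' - F1 a'\<bar> \<le> (LINT r:{a'..b'}|lborel. g2 r)" using F2[OF inD ord(2)] by simp
      also have "\<dots> \<le> (LINT r:{a'..b'}|lborel. w r)"
      proof (intro set_integral_mono set_integrable_of_integrable g2 wi)
        fix r assume "r \<in> {a'..b'}"
        then have "r \<in> U" using IU ord by auto
        then show "g2 r \<le> w r" using g1(2) by (simp add: w_def)
      qed auto
      finally show ?thesis .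
    qed
    have "(LINT r:{a..b}|lborel. w r)
        = (LINT r:{a..a'}|lborel. w r) + ((LINT r:{a'..b'}|lborel. w r) + (LINT r:{b'..b}|lborel. w r))"
      using ord by (subst set_integral_split[OF wi, of a a' b], simp, simp) (subst set_integral_split[OF wi, of a' b' b], auto)
    then show ?thesis using 1 2 3 by linarith
  qed
  obtain n :: nat where n: "1 / \<delta> < real n" using reals_Archimedean2 by blast
  have "0 < 1 / \<delta>" using \<delta> by simp
  then have n0: "0 < real n" using n by linarith
  have mesh: "1 / n < \<delta>" using n n0 \<delta> by (simp add: field_simps)
  have inD: "k / n \<in> D" if "k \<le> n" for k :: nat
  proof -
    have "k / n \<in> {0..1}" using that n0 by (simp add: field_simps)
    then show ?thesis using D(1) by auto
  qed
  have "k \<le> n \<Longrightarrow> \<bar>F1 (k / n) - F1 0\<bar> \<le> (LINT r:{0..k / n}|lborel. w r)" for k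
  proof (induction k)
    case 0
    have "0 \<le> (LINT r:{0..0::real}|lborel. w r)"
      unfolding set_lebesgue_integral_def using w0 by simp
    then show ?case by simp
  next
    case (Suc k)
    have le: "k / n \<le> Suc k / n" using n0 by (simp add: divide_right_mono)
    have "Suc k / n - k / n = 1 / n" by (simp add: diff_divide_distrib[symmetric])
    then have "\<bar>F1 (Suc k / n) - F1 (k / n)\<bar> \<le> (LINT r:{k / n..Suc k / n}|lborel. w r)"
      using Suc.prems mesh le by (intro step inD) auto
    moreover have "(LINT r:{0..Suc k / n}|lborel. w r)
        = (LINT r:{0..k / n}|lborel. w r) + (LINT r:{k / n..Suc k / n}|lborel. w r)"
      using le n0 by (intro set_integral_split[OF wi]) auto
    ultimately show ?case using Suc by linarith
  qed
  from this[of n] have "\<bar>F1 1 - F1 0\<bar> \<le> (LINT r:{0..1}|lborel. w r)" using n0 by simp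
  also have "\<dots> \<le> (LINT t:{0..1}|lborel. (if t \<in> A then g2 t else g1 t) +
      (indicator (A - K) t * ?g t + indicator (U - K) t * ?g t))"
  proof (intro set_integral_mono set_integrable_of_integrable wi)
    show "integrable lborel (\<lambda>t. (if t \<in> A then g2 t else g1 t) +
      (indicator (A - K) t * ?g t + indicator (U - K) t * ?g t))"
      by (intro Bochner_Integration.integrable_add[of _ _ "\<lambda>t. indicator (A - K) t * ?g t + indicator (U - K) t * ?g t"]
          Bochner_Integration.integrable_add[of _ "\<lambda>t. indicator (A - K) t * ?g t"]
          mixed integrable_indicator_times gi) auto
    fix t show "w t \<le> (if t \<in> A then g2 t else g1 t) +
      (indicator (A - K) t * ?g t + indicator (U - K) t * ?g t)"
      using g1(2)[of t] g2(2)[of t] K(2) by (auto simp: w_def split: split_indicator)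
  qed auto
  also have "\<dots> \<le> (LINT t:{0..1}|lborel. (if t \<in> A then g2 t else g1 t)) + e"
  proof -
    have 1: "set_integrable lborel {0..1} (\<lambda>t. if t \<in> A then g2 t else g1 t)"
      by (intro set_integrable_of_integrable mixed) auto
    have 2: "set_integrable lborel {0..1} (\<lambda>t. indicator B t * ?g t)" if "B \<in> sets borel" for B
      using that by (intro set_integrable_of_integrable integrable_indicator_times gi) auto
    have 3: "(LINT t:{0..1}|lborel. indicator B t * ?g t) \<le> (LINT t:B|lborel. ?g t)" if "B \<in> sets borel" for B
    proof -
      have "(LINT t:UNIV|lborel. indicator {0..1} t * (indicator B t * ?g t)) \<le> (LINT t:UNIV|lborel. indicator B t * ?g t)"
        using 2[OF that] integrable_mult_indicator[OF _ gi, of B] that g1(2) g2(2)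
        by (intro set_integral_mono)
          (auto simp: set_integrable_def add_nonneg_nonneg split: split_indicator)
      then show ?thesis by (simp add: set_lebesgue_integral_def)
    qed
    show ?thesis
      using 3[of "A - K"] 3[of "U - K"] sm 1 2[of "A - K"] 2[of "U - K"]
      by (simp add: set_integral_add)
  qed
  finally show "\<bar>F1 1 - F1 0\<bar> \<le> (LINT t:{0..1}|lborel. if t \<in> A then g2 t else g1 t) + e" .
qed

text \<open>
  A form of the fundamental theorem of calculus for absolutely continuous functions, in which the
  derivative is replaced by a bound \<open>k\<close> on the difference quotients at almost every time. The
  Henstock-Kurzweil integral of \<open>k\<close> gives it directly: in a fine tagged partition the intervals with a good
  tag \<open>t\<close> have increment about \<open>k t\<close> times their length, while those with an exceptional tag lie in an
  open set on which the crude bound \<open>w\<close> has small integral.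
\<close>

lemma increment_le_integral_of_speed_bound:
  fixes F k w :: "real \<Rightarrow> real"
  assumes w: "integrable lborel w" "\<And>t. 0 \<le> w t"
    and k: "integrable lborel k" "\<And>t. 0 \<le> k t"
    and F: "\<And>s t. \<lbrakk>0 \<le> s; s \<le> t; t \<le> 1\<rbrakk> \<Longrightarrow> \<bar>F t - F s\<bar> \<le> (LINT r:{s..t}|lborel. w r)"
    and speed: "AE t in lborel. t \<in> {0..1} \<longrightarrow>
      (\<forall>e>0. \<exists>\<delta>>0. \<forall>s\<in>{0..1}. \<bar>s - t\<bar> < \<delta> \<longrightarrow> \<bar>F s - F t\<bar> \<le> (k t + e) * \<bar>s - t\<bar>)"
  shows "\<bar>F 1 - F 0\<bar> \<le> (LINT t:{0..1}|lborel. k t)"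
proof (rule field_le_epsilon)
  fix e0 :: real assume "0 < e0"
  define e where "e = e0 / 3"
  have e: "0 < e" using \<open>0 < e0\<close> by (simp add: e_def)
  define P where "P t \<longleftrightarrow>
      (\<forall>e>0. \<exists>\<delta>>0. \<forall>s\<in>{0..1}. \<bar>s - t\<bar> < \<delta> \<longrightarrow> \<bar>F s - F t\<bar> \<le> (k t + e) * \<bar>s - t\<bar>)" for t
  have "AE t in lborel. t \<in> {0..1} \<longrightarrow> P t" using speed unfolding P_def .
  then obtain N where N: "{t \<in> space lborel. \<not> (t \<in> {0..1} \<longrightarrow> P t)} \<subseteq> N"
    "emeasure lborel N = 0" "N \<in> sets lborel"
    by (rule AE_E)
  then have P: "P t" if "t \<in> {0..1}" "t \<notin> N" for t using that by auto
  have good: "\<exists>\<delta>>0. \<forall>s\<in>{0..1}. \<bar>s - t\<bar> < \<delta> \<longrightarrow> \<bar>F s - F t\<bar> \<le> (k t + e) * \<bar>s - t\<bar>"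
    if "t \<in> {0..1}" "t \<notin> N" for t
    using P[OF that] e unfolding P_def by simp
  have N: "N \<in> null_sets lborel" using N by auto
  have Nb: "N \<in> sets borel" using N by auto
  \<comment> \<open>an open neighbourhood of the exceptional times that carries little increment\<close>
  obtain C U where CU: "compact C" "C \<subseteq> - N" "open U" "N \<subseteq> U" "(LINT r:U|lborel. w r) \<le> e"
  proof -
    have "- N \<in> sets borel" using Nb by auto
    from compact_inside_open_outside[OF w this e] obtain C V
      where "compact C" "C \<subseteq> - N" "open V" "C \<subseteq> V" "(LINT r:- N - C|lborel. w r) \<le> e"
        "(LINT r:V - C|lborel. w r) \<le> e" .
    note C = this(1,2,5)
    have "(LINT r:- C|lborel. w r) = (LINT r:- N - C|lborel. w r)"
    proof (rule set_integral_cong_set)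
      show "AE x in lborel. (x \<in> - N - C) = (x \<in> - C)"
        using AE_not_in[OF N] by eventually_elim auto
    next
      have [measurable]: "w \<in> borel_measurable borel" "C \<in> sets borel" "N \<in> sets borel"
        using w Nb C by (auto simp: compact_imp_closed)
      show "set_borel_measurable lborel (- C) w" "set_borel_measurable lborel (- N - C) w"
        unfolding set_borel_measurable_def by measurable
    qed
    then show thesis using C by (intro that[of C "- C"]) (auto simp: compact_imp_closed)
  qed
  \<comment> \<open>Writing the exceptional increments as increments of \<open>W\<close> lets them telescope over the partition.\<close>
  define W where "W t = (LINT r:{0..t}|lborel. indicator U r * w r)" for t
  have Ub: "U \<in> sets borel" using CU by auto
  have wUi: "integrable lborel (\<lambda>r. indicator U r * w r)"
    using integrable_mult_indicator[OF _ w(1), of U] Ub by auto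
  have W1: "W 1 - W 0 \<le> e"
  proof -
    have "W 1 \<le> (LINT r:U|lborel. w r)"
    proof -
      have "(LINT r:UNIV|lborel. indicator {0..1} r * (indicator U r * w r)) \<le> (LINT r:UNIV|lborel. indicator U r * w r)"
        using wUi integrable_mult_indicator[OF _ wUi, of "{0..1}"] w(2)
        by (intro set_integral_mono) (auto simp: set_integrable_def split: split_indicator)
      then show ?thesis by (simp add: set_lebesgue_integral_def W_def)
    qed
    moreover have "0 \<le> W 0" using w(2) by (simp add: W_def set_lebesgue_integral_def)
    ultimately show ?thesis using CU(5) by simp
  qed
  have W: "W t - W s = (LINT r:{s..t}|lborel. indicator U r * w r)" if "0 \<le> s" "s \<le> t" for s t
    using set_integral_split[OF wUi that] by (simp add: W_def)
  have W_mono: "W s \<le> W t" if "0 \<le> s" "s \<le> t" for s t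
  proof -
    have "0 \<le> (LINT r:{s..t}|lborel. indicator U r * w r)"
      using w(2) by (simp add: set_lebesgue_integral_def)
    then show ?thesis using W[OF that] by simp
  qed
  have "\<forall>t. \<exists>G. open G \<and> t \<in> G \<and> (t \<in> {0..1} \<longrightarrow>
      (\<forall>a b. 0 \<le> a \<longrightarrow> a \<le> t \<longrightarrow> t \<le> b \<longrightarrow> b \<le> 1 \<longrightarrow> {a..b} \<subseteq> G \<longrightarrow>
        \<bar>F b - F a\<bar> \<le> (k t + e) * (b - a) + (W b - W a)))"
  proof
    fix t
    show "\<exists>G. open G \<and> t \<in> G \<and> (t \<in> {0..1} \<longrightarrow>
      (\<forall>a b. 0 \<le> a \<longrightarrow> a \<le> t \<longrightarrow> t \<le> b \<longrightarrow> b \<le> 1 \<longrightarrow> {a..b} \<subseteq> G \<longrightarrow>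
        \<bar>F b - F a\<bar> \<le> (k t + e) * (b - a) + (W b - W a)))"
    proof (cases "t \<in> N")
      case True
      have "\<bar>F b - F a\<bar> \<le> (k t + e) * (b - a) + (W b - W a)"
        if ab: "0 \<le> a" "a \<le> t" "t \<le> b" "b \<le> 1" "{a..b} \<subseteq> U" for a b
      proof -
        have "\<bar>F b - F a\<bar> \<le> (LINT r:{a..b}|lborel. w r)" using ab by (intro F) auto
        also have "\<dots> = (LINT r:{a..b}|lborel. indicator U r * w r)"
          using ab(5) by (intro set_lebesgue_integral_cong) (auto simp: subset_iff)
        also have "\<dots> = W b - W a" using ab by (subst W) auto
        finally show ?thesis using k(2)[of t] e ab by (smt (verit) mult_nonneg_nonneg)
      qed
      then show ?thesis using True CU by (intro exI[of _ U]) auto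
    next
      case False
      show ?thesis
      proof (cases "t \<in> {0..1}")
        case True
        obtain \<delta> where \<delta>: "0 < \<delta>" "\<And>s. \<lbrakk>s \<in> {0..1}; \<bar>s - t\<bar> < \<delta>\<rbrakk> \<Longrightarrow> \<bar>F s - F t\<bar> \<le> (k t + e) * \<bar>s - t\<bar>"
          using good[OF True False] by blast
        have "\<bar>F b - F a\<bar> \<le> (k t + e) * (b - a) + (W b - W a)"
          if ab: "0 \<le> a" "a \<le> t" "t \<le> b" "b \<le> 1" "{a..b} \<subseteq> ball t \<delta>" for a b
        proof -
          have "a \<in> ball t \<delta>" "b \<in> ball t \<delta>" using ab by (auto simp: subset_iff)
          then have "\<bar>a - t\<bar> < \<delta>" "\<bar>b - t\<bar> < \<delta>" by (auto simp: dist_real_def)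
          then have "\<bar>F a - F t\<bar> \<le> (k t + e) * (t - a)" "\<bar>F b - F t\<bar> \<le> (k t + e) * (b - t)"
            using \<delta>(2)[of a] \<delta>(2)[of b] ab by auto
          moreover have "(k t + e) * (t - a) + (k t + e) * (b - t) = (k t + e) * (b - a)"
            by (simp add: algebra_simps)
          moreover have "W a \<le> W b" using ab by (intro W_mono) auto
          ultimately show ?thesis by linarith
        qed
        then show ?thesis using \<delta>(1) by (intro exI[of _ "ball t \<delta>"]) auto
      qed (auto intro!: exI[of _ UNIV])
    qed
  qed
  then obtain \<gamma> where \<gamma>: "\<And>t. open (\<gamma> t)" "\<And>t. t \<in> \<gamma> t"
    "\<And>t a b. \<lbrakk>t \<in> {0..1}; 0 \<le> a; a \<le> t; t \<le> b; b \<le> 1; {a..b} \<subseteq> \<gamma> t\<rbrakk>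
      \<Longrightarrow> \<bar>F b - F a\<bar> \<le> (k t + e) * (b - a) + (W b - W a)"
    by metis
  have kint: "(k has_integral (LINT t:{0..1}|lborel. k t)) (cbox 0 1)"
    using set_borel_integral_eq_integral[OF set_integrable_of_integrable[OF k(1), of "{0..1}"]]
    by (simp add: has_integral_integral)
  obtain \<gamma>' where "gauge \<gamma>'" "\<And>p. \<lbrakk>p tagged_division_of (cbox 0 1); \<gamma>' fine p\<rbrakk>
      \<Longrightarrow> norm ((\<Sum>(x,K)\<in>p. measure lborel K *\<^sub>R k x) - (LINT t:{0..1}|lborel. k t)) < e"
    using that by (rule has_integralD[OF kint e])
  note \<gamma>' = this[unfolded box_real]
  have "gauge (\<lambda>t. \<gamma> t \<inter> \<gamma>' t)"
    using \<gamma> \<gamma>'(1) by (auto simp: gauge_def)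
  then obtain p where p: "p tagged_division_of {0..1::real}" "(\<lambda>t. \<gamma> t \<inter> \<gamma>' t) fine p"
    using fine_division_exists_real by blast
  then have fine: "\<gamma>' fine p" "\<gamma> fine p" by (auto simp: fine_Int)
  have finp: "finite p" using p(1) by auto
  have sumF: "(\<Sum>(x,K)\<in>p. f (Sup K) - f (Inf K)) = f 1 - f 0" for f :: "real \<Rightarrow> real"
    using additive_tagged_division_1[OF _ p(1), of f] by simp
  have "\<bar>F 1 - F 0\<bar> = \<bar>\<Sum>(x,K)\<in>p. F (Sup K) - F (Inf K)\<bar>" by (simp add: sumF)
  also have "\<dots> \<le> (\<Sum>(x,K)\<in>p. \<bar>F (Sup K) - F (Inf K)\<bar>)"
    by (rule order_trans[OF sum_abs]) (simp add: split_beta)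
  also have "\<dots> \<le> (\<Sum>(x,K)\<in>p. measure lborel K *\<^sub>R k x + (e * Sup K - e * Inf K) + (W (Sup K) - W (Inf K)))"
  proof (rule sum_mono)
    fix z assume z: "z \<in> p"
    obtain x K where zK: "z = (x, K)" by (cases z)
    obtain a b where K: "K = cbox a b" using tagged_division_ofD(4)[OF p(1)] z zK by blast
    have x: "x \<in> K" "K \<subseteq> {0..1}" using tagged_division_ofD(2,3)[OF p(1)] z zK by auto
    have ab: "a \<le> b" using x K by auto
    then have "0 \<le> a" "b \<le> 1" using x(2) K by (auto simp: subset_iff)
    moreover have "{a..b} \<subseteq> \<gamma> x" using fine(2) z zK K by (auto simp: fine_def)
    ultimately have "\<bar>F b - F a\<bar> \<le> (k x + e) * (b - a) + (W b - W a)"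
      using x K by (intro \<gamma>(3)) auto
    then show "(case z of (x, K) \<Rightarrow> \<bar>F (Sup K) - F (Inf K)\<bar>)
        \<le> (case z of (x, K) \<Rightarrow> measure lborel K *\<^sub>R k x + (e * Sup K - e * Inf K) + (W (Sup K) - W (Inf K)))"
      using ab by (simp add: zK K algebra_simps)
  qed
  also have "\<dots> = (\<Sum>(x,K)\<in>p. measure lborel K *\<^sub>R k x) + (\<Sum>(x,K)\<in>p. e * Sup K - e * Inf K)
      + (\<Sum>(x,K)\<in>p. W (Sup K) - W (Inf K))"
    by (simp add: split_beta sum.distrib)
  also have "(\<Sum>(x,K)\<in>p. e * Sup K - e * Inf K) = e"
    using sumF[of "\<lambda>t. e * t"] by simp
  also have "(\<Sum>(x,K)\<in>p. W (Sup K) - W (Inf K)) \<le> e"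
    using sumF[of W] W1 by simp
  also have "(\<Sum>(x,K)\<in>p. measure lborel K *\<^sub>R k x) \<le> (LINT t:{0..1}|lborel. k t) + e"
    using \<gamma>'(2)[OF p(1) fine(1)] by (simp add: real_norm_def)
  finally show "\<bar>F 1 - F 0\<bar> \<le> (LINT t:{0..1}|lborel. k t) + e0" by (simp add: e_def)
qed

section \<open>Measurability of evaluation and of the metric speed\<close>

definition clamp_time :: "real \<Rightarrow> real \<Rightarrow> real \<Rightarrow> real" where
  "clamp_time a b t = max a (min b t)"

lemma clamp_time_in: "a \<le> b \<Longrightarrow> clamp_time a b t \<in> {a..b}"
  by (auto simp: clamp_time_def)

lemma clamp_time_id [simp]: "t \<in> {a..b} \<Longrightarrow> clamp_time a b t = t"
  by (auto simp: clamp_time_def)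

lemma clamp_time_mono: "s \<le> t \<Longrightarrow> clamp_time a b s \<le> clamp_time a b t"
  by (auto simp: clamp_time_def)

lemma continuous_clamp_time: "continuous_on S (clamp_time a b)"
  unfolding clamp_time_def[abs_def] by (intro continuous_intros)

lemma measurable_clamp_time [measurable]: "clamp_time a b \<in> borel_measurable borel"
  by (rule borel_measurable_continuous_onI[OF continuous_clamp_time])

lemma mspace_curve_space:
  "mspace (curve_space :: (real \<Rightarrow> 'a::polish_space) metric) = {\<gamma>. \<gamma> \<in> extensional {0..1} \<and> continuous_on {0..1} \<gamma>}"
  unfolding curve_space_def
  by (subst compactin_mspace_cfunspace) (auto simp: compactin_subtopology)

lemma space_borel_curves:
  "space (borel_curves :: (real \<Rightarrow> 'a::polish_space) measure) = {\<gamma>. \<gamma> \<in> extensional {0..1} \<and> continuous_on {0..1} \<gamma>}"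
  unfolding borel_curves_def mspace_curve_space[symmetric]
  by (simp add: space_measure_of_conv)

lemma curve_opens_subset:
  "{U. openin (mtopology_of curve_space) U} \<subseteq> Pow (mspace curve_space)"
  by (auto dest!: openin_subset)

lemma sets_borel_curves_open:
  "openin (mtopology_of curve_space) U \<Longrightarrow> U \<in> sets borel_curves"
  unfolding borel_curves_def using curve_opens_subset
  by (subst sets_measure_of) (auto intro: sigma_sets.Basic)

lemma dist_eval_le:
  fixes \<gamma> \<sigma> :: "real \<Rightarrow> 'a::polish_space"
  assumes "\<gamma> \<in> mspace curve_space" "\<sigma> \<in> mspace curve_space" "t \<in> {0..1}"
  shows "dist (\<gamma> t) (\<sigma> t) \<le> mdist curve_space \<gamma> \<sigma>"
  using mdist_cfunspace_imp_mdist_le[of \<gamma> "top_of_set {0..1}" euclidean_metric \<sigma> _ t] assms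
  by (simp add: curve_space_def)

lemma measurable_eval:
  assumes t: "t \<in> {0..1}"
  shows "(\<lambda>\<gamma>. \<gamma> t) \<in> borel_curves \<rightarrow>\<^sub>M (borel :: 'a::polish_space measure)"
proof (rule borel_measurableI)
  fix S :: "'a set" assume S: "open S"
  have "Lipschitz_continuous_map curve_space euclidean_metric (\<lambda>\<gamma>. \<gamma> t :: 'a)"
    unfolding Lipschitz_continuous_map_def using dist_eval_le[OF _ _ t]
    by (auto intro!: exI[of _ 1])
  then have "continuous_map (mtopology_of curve_space) euclidean (\<lambda>\<gamma>. \<gamma> t :: 'a)"
    using Lipschitz_continuous_imp_continuous_map by fastforce
  from openin_continuous_map_preimage[OF this, of S] S
  have "{\<gamma> \<in> mspace curve_space. \<gamma> t \<in> S} \<in> sets borel_curves"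
    by (intro sets_borel_curves_open) simp
  then show "(\<lambda>\<gamma>. \<gamma> t) -` S \<inter> space borel_curves \<in> sets borel_curves"
    by (simp add: space_borel_curves mspace_curve_space vimage_def Collect_conj_eq Int_ac)
qed

text \<open>
  Freezing a curve outside \<open>[a, b]\<close> replaces the usual reparametrization of a subinterval: the speed is
  unchanged on \<open>(a, b)\<close> and vanishes elsewhere, so that no change of variables is needed.
\<close>

definition stopped :: "real \<Rightarrow> real \<Rightarrow> (real \<Rightarrow> 'a) \<Rightarrow> real \<Rightarrow> 'a" where
  "stopped a b \<gamma> = restrict (\<lambda>t. \<gamma> (clamp_time a b t)) {0..1}"

lemma stopped_apply: "t \<in> {0..1} \<Longrightarrow> stopped a b \<gamma> t = \<gamma> (clamp_time a b t)"
  by (simp add: stopped_def)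

lemma stopped_in_curves:
  assumes "\<gamma> \<in> mspace (curve_space :: (real \<Rightarrow> 'a::polish_space) metric)" "0 \<le> a" "a \<le> b" "b \<le> 1"
  shows "stopped a b \<gamma> \<in> mspace curve_space"
proof -
  have c: "continuous_on {0..1} \<gamma>" using assms by (simp add: mspace_curve_space)
  have cl: "clamp_time a b t \<in> {0..1}" for t using clamp_time_in[of a b t] assms by auto
  have "continuous_on {0..1} (\<lambda>t. \<gamma> (clamp_time a b t))"
    by (rule continuous_on_compose2[OF c continuous_clamp_time]) (use cl in blast)
  then have "continuous_on {0..1} (stopped a b \<gamma>)"
    by (rule continuous_on_eq) (simp add: stopped_apply)
  then show ?thesis by (simp add: mspace_curve_space stopped_def)
qed

lemma measurable_stopped:
  assumes ab: "0 \<le> a" "a \<le> b" "b \<le> 1"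
  shows "stopped a b \<in> borel_curves \<rightarrow>\<^sub>M (borel_curves :: (real \<Rightarrow> 'a::polish_space) measure)"
proof -
  let ?C = "curve_space :: (real \<Rightarrow> 'a) metric"
  have cl: "clamp_time a b t \<in> {0..1}" for t using clamp_time_in[of a b t] ab by auto
  have "Lipschitz_continuous_map ?C ?C (stopped a b)"
    unfolding Lipschitz_continuous_map_def
  proof (intro conjI exI[of _ 1] ballI)
    show "stopped a b \<in> mspace ?C \<rightarrow> mspace ?C" using stopped_in_curves[OF _ ab] by auto
    fix \<gamma> \<sigma> assume c: "\<gamma> \<in> mspace ?C" "\<sigma> \<in> mspace ?C"
    have "mdist ?C (stopped a b \<gamma>) (stopped a b \<sigma>) \<le> mdist ?C \<gamma> \<sigma>"
      by (subst curve_space_def, rule mdist_cfunspace_le)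
        (use dist_eval_le[OF c cl] in \<open>auto simp: stopped_apply\<close>)
    then show "mdist ?C (stopped a b \<gamma>) (stopped a b \<sigma>) \<le> 1 * mdist ?C \<gamma> \<sigma>" by simp
  qed
  then have cont: "continuous_map (mtopology_of ?C) (mtopology_of ?C) (stopped a b)"
    by (rule Lipschitz_continuous_imp_continuous_map)
  show ?thesis
    unfolding borel_curves_def[where 'a = 'a]
  proof (rule measurable_sigma_sets[where \<Omega> = "mspace ?C" and A = "{U. openin (mtopology_of ?C) U}"])
    show "sets (sigma (mspace ?C) {U. openin (mtopology_of ?C) U}) = sigma_sets (mspace ?C) {U. openin (mtopology_of ?C) U}"
      using curve_opens_subset by (rule sets_measure_of)
    show "stopped a b \<in> space (sigma (mspace ?C) {U. openin (mtopology_of ?C) U}) \<rightarrow> mspace ?C"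
      using stopped_in_curves[OF _ ab] by (auto simp: space_measure_of_conv simp del: mspace_cfunspace)
    fix U assume "U \<in> {U. openin (mtopology_of ?C) U}"
    with openin_continuous_map_preimage[OF cont, of U]
    have "{\<gamma> \<in> mspace ?C. stopped a b \<gamma> \<in> U} \<in> sets borel_curves"
      by (intro sets_borel_curves_open) simp
    then show "stopped a b -` U \<inter> space (sigma (mspace ?C) {U. openin (mtopology_of ?C) U})
        \<in> sets (sigma (mspace ?C) {U. openin (mtopology_of ?C) U})"
      by (simp add: borel_curves_def space_measure_of_conv vimage_def Collect_conj_eq Int_ac)
  qed (rule curve_opens_subset)
qed

text \<open>
  Evaluation at a fixed time is Lipschitz in the curve, and by continuity of the curves evaluation at time
  \<open>t\<close> is the limit of evaluations at \<open>t\<close> rounded down to multiples of \<open>1 / n\<close>, which take countably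
  many values. Times outside the unit interval are moved to its end points, since curves are arbitrary
  there.
\<close>

lemma measurable_eval_pair:
  "(\<lambda>p. (fst p) (clamp_time 0 1 (snd p))) \<in> borel_measurable ((borel_curves :: (real \<Rightarrow> 'a::polish_space) measure) \<Otimes>\<^sub>M (borel :: real measure))"
proof (rule borel_measurable_LIMSEQ_metric
    [where f = "\<lambda>n p. (fst p) (clamp_time 0 1 (real_of_int \<lfloor>real (Suc n) * snd p\<rfloor> / real (Suc n)))"])
  fix n :: nat
  have "(\<lambda>p. (\<lambda>i p. (fst p) (clamp_time 0 1 (real_of_int i / real (Suc n)))) \<lfloor>real (Suc n) * snd p\<rfloor> p)
      \<in> borel_measurable ((borel_curves :: (real \<Rightarrow> 'a) measure) \<Otimes>\<^sub>M (borel :: real measure))"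
  proof (rule measurable_compose_countable
      [where f = "\<lambda>i p. (fst p) (clamp_time 0 1 (real_of_int i / real (Suc n)))"])
    fix i :: int
    have "clamp_time 0 1 (real_of_int i / real (Suc n)) \<in> {0..1}" by (rule clamp_time_in) simp
    from measurable_compose[OF measurable_fst measurable_eval[OF this]]
    show "(\<lambda>p. (fst p) (clamp_time 0 1 (real_of_int i / real (Suc n))))
      \<in> borel_measurable ((borel_curves :: (real \<Rightarrow> 'a) measure) \<Otimes>\<^sub>M (borel :: real measure))" .
  qed measurable
  then show "(\<lambda>p. (fst p) (clamp_time 0 1 (real_of_int \<lfloor>real (Suc n) * snd p\<rfloor> / real (Suc n))))
      \<in> borel_measurable ((borel_curves :: (real \<Rightarrow> 'a) measure) \<Otimes>\<^sub>M (borel :: real measure))" .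
next
  fix p :: "(real \<Rightarrow> 'a) \<times> real" assume "p \<in> space (borel_curves \<Otimes>\<^sub>M borel)"
  then have c: "continuous_on {0..1} (fst p)" by (auto simp: space_pair_measure space_borel_curves)
  have lim: "(\<lambda>n. real_of_int \<lfloor>real (Suc n) * snd p\<rfloor> / real (Suc n)) \<longlonglongrightarrow> snd p"
  proof (rule tendsto_sandwich)
    have "(\<lambda>n. snd p - 1 / real (Suc n)) \<longlonglongrightarrow> snd p - 0"
      by (intro tendsto_intros LIMSEQ_Suc[OF lim_const_over_n])
    then show "(\<lambda>n. snd p - 1 / real (Suc n)) \<longlonglongrightarrow> snd p" by simp
    have "snd p - 1 / real (Suc n) \<le> real_of_int \<lfloor>real (Suc n) * snd p\<rfloor> / real (Suc n)" for n
    proof -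
      have "real (Suc n) * snd p - 1 \<le> real_of_int \<lfloor>real (Suc n) * snd p\<rfloor>" by linarith
      then have "(real (Suc n) * snd p - 1) / real (Suc n) \<le> real_of_int \<lfloor>real (Suc n) * snd p\<rfloor> / real (Suc n)"
        by (intro divide_right_mono) auto
      then show ?thesis by (simp add: diff_divide_distrib del: of_nat_Suc)
    qed
    then show "\<forall>\<^sub>F n in sequentially. snd p - 1 / real (Suc n) \<le> real_of_int \<lfloor>real (Suc n) * snd p\<rfloor> / real (Suc n)"
      by simp
    have "real_of_int \<lfloor>real (Suc n) * snd p\<rfloor> / real (Suc n) \<le> snd p" for n
      by (simp add: divide_le_eq mult.commute del: of_nat_Suc)
    then show "\<forall>\<^sub>F n in sequentially. real_of_int \<lfloor>real (Suc n) * snd p\<rfloor> / real (Suc n) \<le> snd p"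
      by simp
  qed simp
  have "isCont (clamp_time 0 1) (snd p)"
    using continuous_clamp_time[of UNIV] by (simp add: continuous_on_eq_continuous_at)
  then have "(\<lambda>n. clamp_time 0 1 (real_of_int \<lfloor>real (Suc n) * snd p\<rfloor> / real (Suc n))) \<longlonglongrightarrow> clamp_time 0 1 (snd p)"
    by (rule isCont_tendsto_compose[OF _ lim])
  then show "(\<lambda>n. (fst p) (clamp_time 0 1 (real_of_int \<lfloor>real (Suc n) * snd p\<rfloor> / real (Suc n))))
      \<longlonglongrightarrow> (fst p) (clamp_time 0 1 (snd p))"
    by (rule continuous_on_tendsto_compose[OF c]) (use clamp_time_in[of 0 1] in auto)
qed

text \<open>
  By continuity of the curve, countably many difference quotients determine the upper limit, whence its
  measurability.
\<close>

lemma metric_speed_rational: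
  fixes \<gamma> :: "real \<Rightarrow> 'a::metric_space"
  assumes c: "continuous_on {0..1} \<gamma>" and t: "t \<in> {0..1}"
  shows "metric_speed \<gamma> t = (INF n. SUP q\<in>\<rat> \<inter> {0..1}.
    (if q \<noteq> t \<and> \<bar>q - t\<bar> < 1 / real (Suc n) then ennreal (dist (\<gamma> q) (\<gamma> t) / \<bar>q - t\<bar>) else 0))"
    (is "_ = (INF n. ?R n)")
proof -
  let ?f = "\<lambda>s. ennreal (dist (\<gamma> s) (\<gamma> t) / \<bar>s - t\<bar>)"
  have eq: "(SUP s\<in>{0..1} \<inter> ball t (1 / real (Suc n)) - {t}. ?f s) = ?R n" for n
  proof (rule antisym)
    show "?R n \<le> (SUP s\<in>{0..1} \<inter> ball t (1 / real (Suc n)) - {t}. ?f s)"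
    proof (rule SUP_least)
      fix q :: real assume q: "q \<in> \<rat> \<inter> {0..1}"
      show "(if q \<noteq> t \<and> \<bar>q - t\<bar> < 1 / real (Suc n) then ?f q else 0)
          \<le> (SUP s\<in>{0..1} \<inter> ball t (1 / real (Suc n)) - {t}. ?f s)"
        using q by (auto intro!: SUP_upper simp: dist_real_def abs_minus_commute)
    qed
    show "(SUP s\<in>{0..1} \<inter> ball t (1 / real (Suc n)) - {t}. ?f s) \<le> ?R n"
    proof (rule SUP_least)
      fix s assume s: "s \<in> {0..1} \<inter> ball t (1 / real (Suc n)) - {t}"
      have "s \<in> closure (\<rat> \<inter> {0..1} :: real set)"
      proof -
        have "{0<..<1} \<subseteq> closure ({0<..<1} \<inter> \<rat> :: real set)"
          using open_Int_closure_subset[of "{0<..<1::real}" "\<rat>"] by (simp add: Rats_closure_real)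
        also have "\<dots> \<subseteq> closure (\<rat> \<inter> {0..1} :: real set)" by (rule closure_mono) auto
        finally have "closure {0<..<1} \<subseteq> closure (\<rat> \<inter> {0..1} :: real set)"
          by (rule closure_minimal) simp
        then show ?thesis using s by auto
      qed
      then obtain q where q: "\<And>k. q k \<in> \<rat> \<inter> {0..1}" "q \<longlonglongrightarrow> s"
        unfolding closure_sequential by blast
      have "(\<lambda>k. dist (\<gamma> (q k)) (\<gamma> t) / \<bar>q k - t\<bar>) \<longlonglongrightarrow> dist (\<gamma> s) (\<gamma> t) / \<bar>s - t\<bar>"
        using s q by (intro tendsto_intros continuous_on_tendsto_compose[OF c]) auto
      then have lim: "(\<lambda>k. ?f (q k)) \<longlonglongrightarrow> ?f s" by (rule tendsto_ennrealI)
      have ev: "\<forall>\<^sub>F k in sequentially. ?f (q k) \<le> ?R n"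
      proof -
        have "open (ball t (1 / real (Suc n)) - {t})" by auto
        then have "\<forall>\<^sub>F k in sequentially. q k \<in> ball t (1 / real (Suc n)) - {t}"
          using q(2) s by (intro topological_tendstoD) auto
        then show ?thesis
        proof eventually_elim
          case (elim k)
          then show ?case using q(1)[of k]
            by (intro SUP_upper2[of "q k"]) (auto simp: dist_real_def abs_minus_commute)
        qed
      qed
      show "?f s \<le> ?R n" by (rule tendsto_upperbound[OF lim ev]) simp
    qed
  qed
  have "metric_speed \<gamma> t = (INF e\<in>{0<..}. SUP s\<in>{0..1} \<inter> ball t e - {t}. ?f s)"
    unfolding metric_speed_def by (rule Limsup_within)
  also have "\<dots> = (INF n. SUP s\<in>{0..1} \<inter> ball t (1 / real (Suc n)) - {t}. ?f s)"
  proof (rule antisym)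
    show "(INF n. SUP s\<in>{0..1} \<inter> ball t (1 / real (Suc n)) - {t}. ?f s)
        \<le> (INF e\<in>{0<..}. SUP s\<in>{0..1} \<inter> ball t e - {t}. ?f s)"
    proof (rule INF_greatest)
      fix e :: real assume "e \<in> {0<..}"
      then obtain n where "1 / real (Suc n) < e" using nat_approx_posE[of e] by auto
      then have "(SUP s\<in>{0..1} \<inter> ball t (1 / real (Suc n)) - {t}. ?f s) \<le> (SUP s\<in>{0..1} \<inter> ball t e - {t}. ?f s)"
        by (intro SUP_subset_mono) auto
      then show "(INF n. SUP s\<in>{0..1} \<inter> ball t (1 / real (Suc n)) - {t}. ?f s) \<le> (SUP s\<in>{0..1} \<inter> ball t e - {t}. ?f s)"
        by (rule INF_lower2[OF UNIV_I])
    qed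
    show "(INF e\<in>{0<..}. SUP s\<in>{0..1} \<inter> ball t e - {t}. ?f s)
        \<le> (INF n. SUP s\<in>{0..1} \<inter> ball t (1 / real (Suc n)) - {t}. ?f s)"
      by (rule INF_greatest, rule INF_lower) simp
  qed
  also have "\<dots> = (INF n. ?R n)" by (simp only: eq)
  finally show ?thesis .
qed

text \<open>
  The factor makes it vanish outside the unit interval, so that integrals of the speed extend over the
  whole line and the arbitrary values of curves there do not matter.
\<close>

definition speed_pair :: "(real \<Rightarrow> 'a::polish_space) \<times> real \<Rightarrow> ennreal" where
  "speed_pair p = indicator {0..1} (snd p) * metric_speed (fst p) (snd p)"

lemma measurable_speed_pair [measurable]:
  "speed_pair \<in> borel_measurable ((borel_curves :: (real \<Rightarrow> 'a::polish_space) measure) \<Otimes>\<^sub>M (borel :: real measure))"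
proof -
  let ?M = "(borel_curves :: (real \<Rightarrow> 'a) measure) \<Otimes>\<^sub>M (borel :: real measure)"
  have [measurable]: "(\<lambda>p. (fst p) (clamp_time 0 1 (snd p))) \<in> borel_measurable ?M"
    by (rule measurable_eval_pair)
  have ev [measurable]: "(\<lambda>p. (fst p) q) \<in> borel_measurable ?M" if "q \<in> \<rat> \<inter> {0..1}" for q :: real
    using measurable_compose[OF measurable_fst measurable_eval] that by auto
  have "(\<lambda>p. indicator {0..1} (snd p) * (INF n. SUP q\<in>\<rat> \<inter> {0..1}.
    (if q \<noteq> snd p \<and> \<bar>q - snd p\<bar> < 1 / real (Suc n)
     then ennreal (dist ((fst p) q) ((fst p) (clamp_time 0 1 (snd p))) / \<bar>q - snd p\<bar>) else 0))) \<in> borel_measurable ?M"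
  proof (intro borel_measurable_times_ennreal borel_measurable_INF borel_measurable_SUP)
    show "countable (\<rat> \<inter> {0..1} :: real set)" by (intro countable_Int1 countable_rat)
    fix n and q :: real assume "q \<in> \<rat> \<inter> {0..1}"
    note ev[OF this, measurable]
    show "(\<lambda>p. if q \<noteq> snd p \<and> \<bar>q - snd p\<bar> < 1 / real (Suc n)
     then ennreal (dist ((fst p) q) ((fst p) (clamp_time 0 1 (snd p))) / \<bar>q - snd p\<bar>) else 0) \<in> borel_measurable ?M"
      by measurable
  qed (auto intro: countable_rat)
  then show ?thesis
  proof (rule measurable_cong[THEN iffD1, rotated])
    fix p assume "p \<in> space ?M"
    then have c: "continuous_on {0..1} (fst p)" by (auto simp: space_pair_measure space_borel_curves)
    show "indicator {0..1} (snd p) * (INF n. SUP q\<in>\<rat> \<inter> {0..1}.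
    (if q \<noteq> snd p \<and> \<bar>q - snd p\<bar> < 1 / real (Suc n)
     then ennreal (dist ((fst p) q) ((fst p) (clamp_time 0 1 (snd p))) / \<bar>q - snd p\<bar>) else 0)) = speed_pair p"
      using metric_speed_rational[OF c, of "snd p"]
      by (cases "snd p \<in> {0..1}") (simp_all add: speed_pair_def)
  qed
qed

section \<open>Absolutely continuous curves of finite energy\<close>

lemma space_curvesD:
  assumes "\<gamma> \<in> space (borel_curves :: (real \<Rightarrow> 'a::polish_space) measure)"
  shows "continuous_on {0..1} \<gamma>" and "\<gamma> \<in> mspace curve_space"
  using assms by (auto simp: space_borel_curves mspace_curve_space)

text \<open>
  The end points are excluded because the speed of the stopped curve is one-sided there.
\<close>

lemma metric_speed_stopped:
  fixes \<gamma> :: "real \<Rightarrow> 'a::metric_space"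
  assumes t: "t \<in> {0..1}" "t \<noteq> a" "t \<noteq> b" and ab: "a \<le> b"
  shows "metric_speed (stopped a b \<gamma>) t = indicator {a<..<b} t * metric_speed \<gamma> t"
proof -
  let ?F = "at t within {0..1}"
  have near: "\<forall>\<^sub>F s in ?F. s \<in> {0..1}" by (simp add: eventually_at_filter)
  show ?thesis
  proof (cases "t \<in> {a<..<b}")
    case True
    have "\<forall>\<^sub>F s in nhds t. s \<in> {a<..<b}"
      using True by (intro eventually_nhds_in_open) auto
    then have "\<forall>\<^sub>F s in ?F. s \<in> {a<..<b}"
      by (simp add: eventually_at_filter eventually_mono)
    with near have "\<forall>\<^sub>F s in ?F. ennreal (dist (stopped a b \<gamma> s) (stopped a b \<gamma> t) / \<bar>s - t\<bar>)
        = ennreal (dist (\<gamma> s) (\<gamma> t) / \<bar>s - t\<bar>)"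
      by eventually_elim (use True t in \<open>auto simp: stopped_apply\<close>)
    then show ?thesis unfolding metric_speed_def using True by (simp add: Limsup_eq)
  next
    case False
    have "\<forall>\<^sub>F s in nhds t. clamp_time a b s = clamp_time a b t"
    proof (cases "t < a")
      case True
      then have "\<forall>\<^sub>F s in nhds t. s \<in> {..<a}" by (intro eventually_nhds_in_open) auto
      then show ?thesis by eventually_elim (use True ab in \<open>auto simp: clamp_time_def\<close>)
    next
      case False
      with \<open>t \<notin> {a<..<b}\<close> t have "b < t" by auto
      then have "\<forall>\<^sub>F s in nhds t. s \<in> {b<..}" by (intro eventually_nhds_in_open) auto
      then show ?thesis by eventually_elim (use \<open>b < t\<close> ab in \<open>auto simp: clamp_time_def\<close>)
    qed
    then have "\<forall>\<^sub>F s in ?F. clamp_time a b s = clamp_time a b t"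
      by (simp add: eventually_at_filter eventually_mono)
    with near have "\<forall>\<^sub>F s in ?F. ennreal (dist (stopped a b \<gamma> s) (stopped a b \<gamma> t) / \<bar>s - t\<bar>) \<le> 0"
      by eventually_elim (use t in \<open>auto simp: stopped_apply\<close>)
    then have "metric_speed (stopped a b \<gamma>) t \<le> 0"
      unfolding metric_speed_def by (rule Limsup_bounded)
    then show ?thesis using False by simp
  qed
qed

lemma speed_pair_stopped:
  assumes "t \<noteq> a" "t \<noteq> b" "a \<le> b"
  shows "speed_pair (stopped a b \<gamma>, t) = indicator {a<..<b} t * speed_pair (\<gamma>, t)"
  using metric_speed_stopped[of t a b \<gamma>] assms
  by (cases "t \<in> {0..1}") (auto simp: speed_pair_def)

lemma abs_continuous_stopped:
  fixes \<gamma> :: "real \<Rightarrow> 'a::metric_space"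
  assumes ac: "abs_continuous_curve \<gamma>" and ab: "0 \<le> a" "a \<le> b" "b \<le> 1"
  shows "abs_continuous_curve (stopped a b \<gamma>)"
proof -
  obtain g where g: "set_integrable lborel {0..1} g"
    "\<And>s t. \<lbrakk>0 \<le> s; s \<le> t; t \<le> 1\<rbrakk> \<Longrightarrow> dist (\<gamma> s) (\<gamma> t) \<le> (LINT r:{s..t}|lborel. g r)"
    using ac unfolding abs_continuous_curve_def by blast
  have gi: "set_integrable lborel {s..t} (\<lambda>r. \<bar>g r\<bar>)" "set_integrable lborel {s..t} g"
    if "0 \<le> s" "t \<le> 1" for s t
    using that by (auto intro!: set_integrable_subset[OF g(1)] set_integrable_abs)
  have "dist (stopped a b \<gamma> s) (stopped a b \<gamma> t) \<le> (LINT r:{s..t}|lborel. \<bar>g r\<bar>)"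
    if st: "0 \<le> s" "s \<le> t" "t \<le> 1" for s t
  proof -
    let ?s = "clamp_time a b s" and ?t = "clamp_time a b t"
    have c: "?s \<le> ?t" "0 \<le> ?s" "?t \<le> 1"
      using clamp_time_mono[OF st(2)] clamp_time_in[of a b s] clamp_time_in[of a b t] ab by auto
    show ?thesis
    proof (cases "?s = ?t")
      case True
      have "0 \<le> (LINT r:{s..t}|lborel. \<bar>g r\<bar>)" by (simp add: set_lebesgue_integral_def)
      then show ?thesis using st True by (simp add: stopped_apply)
    next
      case False
      then have sub: "{?s..?t} \<subseteq> {s..t}" using st ab by (auto simp: clamp_time_def max_def min_def split: if_splits)
      have "dist (stopped a b \<gamma> s) (stopped a b \<gamma> t) \<le> (LINT r:{?s..?t}|lborel. g r)"
        using g(2)[of ?s ?t] c st by (simp add: stopped_apply)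
      also have "\<dots> \<le> (LINT r:{?s..?t}|lborel. \<bar>g r\<bar>)"
        using c by (intro set_integral_mono gi) auto
      also have "\<dots> \<le> (LINT r:{s..t}|lborel. \<bar>g r\<bar>)"
        unfolding set_lebesgue_integral_def
        using gi(1)[of s t] gi(1)[of ?s ?t] st c sub
        by (intro integral_mono) (auto simp: set_integrable_def split: split_indicator)
      finally show ?thesis .
    qed
  qed
  then show ?thesis unfolding abs_continuous_curve_def
    using gi(1)[of 0 1] by (intro exI[of _ "\<lambda>r. \<bar>g r\<bar>"]) auto
qed

lemma measurable_eval_times_speed [measurable]:
  fixes G :: "'a::polish_space \<Rightarrow> real"
  assumes [measurable]: "G \<in> borel_measurable borel"
  shows "(\<lambda>p. ennreal (G (fst p (snd p))) * speed_pair p)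
    \<in> borel_measurable ((borel_curves :: (real \<Rightarrow> 'a) measure) \<Otimes>\<^sub>M borel)"
proof -
  have [measurable]: "(\<lambda>p. (fst p) (clamp_time 0 1 (snd p)))
      \<in> borel_measurable ((borel_curves :: (real \<Rightarrow> 'a) measure) \<Otimes>\<^sub>M (borel :: real measure))"
    by (rule measurable_eval_pair)
  have "(\<lambda>p. ennreal (G ((fst p) (clamp_time 0 1 (snd p)))) * speed_pair p)
    \<in> borel_measurable ((borel_curves :: (real \<Rightarrow> 'a) measure) \<Otimes>\<^sub>M borel)"
    by measurable
  also have "(\<lambda>p. ennreal (G ((fst p) (clamp_time 0 1 (snd p)))) * speed_pair p)
      = (\<lambda>p. ennreal (G (fst p (snd p))) * speed_pair p :: ennreal)"
  proof
    fix p :: "(real \<Rightarrow> 'a) \<times> real"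
    show "ennreal (G ((fst p) (clamp_time 0 1 (snd p)))) * speed_pair p = ennreal (G (fst p (snd p))) * speed_pair p"
      by (cases "snd p \<in> {0..1}") (auto simp: speed_pair_def)
  qed
  finally show ?thesis .
qed

lemma measurable_curve_section:
  assumes \<gamma>: "\<gamma> \<in> space (borel_curves :: (real \<Rightarrow> 'a::polish_space) measure)"
    and f: "f \<in> borel_measurable ((borel_curves :: (real \<Rightarrow> 'a) measure) \<Otimes>\<^sub>M borel)"
  shows "(\<lambda>t. f (\<gamma>, t)) \<in> borel_measurable borel"
  using measurable_Pair2[OF f \<gamma>] .

lemmas measurable_speed_section = measurable_curve_section[OF _ measurable_speed_pair]
lemmas measurable_eval_speed_section =
  measurable_curve_section[OF _ measurable_eval_times_speed, simplified fst_conv snd_conv]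

definition finite_energy :: "(real \<Rightarrow> 'a::polish_space) \<Rightarrow> bool" where
  "finite_energy \<gamma> \<longleftrightarrow> (\<integral>\<^sup>+t. (speed_pair (\<gamma>, t))\<^sup>2 \<partial>lborel) < \<infinity>"

lemma finite_energy_speed_finite:
  assumes "\<gamma> \<in> space borel_curves" "finite_energy \<gamma>"
  shows "AE t in lborel. speed_pair (\<gamma>, t) < \<infinity>"
proof -
  have "(\<lambda>t. (speed_pair (\<gamma>, t))\<^sup>2) \<in> borel_measurable lborel"
    using measurable_speed_section[OF assms(1)] by simp
  from nn_integral_PInf_AE[OF this] assms(2)
  have "AE t in lborel. (speed_pair (\<gamma>, t))\<^sup>2 \<noteq> \<infinity>" by (auto simp: finite_energy_def)
  then show ?thesis
    by eventually_elim (auto simp: less_top[symmetric] power2_eq_square ennreal_mult_eq_top_iff)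
qed

lemma ennreal_le_indicator_plus_square: "(x::ennreal) \<le> 1 + x\<^sup>2"
proof (cases "x \<le> 1")
  case True
  then show ?thesis by (simp add: add_increasing2)
next
  case False
  then have "x * 1 \<le> x * x" by (intro mult_left_mono) auto
  then show ?thesis by (simp add: power2_eq_square add_increasing)
qed

text \<open>
  Where the speed \<open>v\<close> is finite, the difference quotients of \<open>g\<close> along the curve are eventually at most
  \<open>(G + e) * (v + e)\<close>, and finite energy makes the speed finite at almost every time. The Lipschitz constant
  only serves to make \<open>g\<close> absolutely continuous along the curve.
\<close>

lemma lipschitz_increment_along_curve:
  fixes \<gamma> :: "real \<Rightarrow> 'a::polish_space" and g G :: "'a \<Rightarrow> real"
  assumes \<gamma>: "\<gamma> \<in> space borel_curves" "abs_continuous_curve \<gamma>" "finite_energy \<gamma>"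
    and g: "L-lipschitz_on UNIV g" and G: "G \<in> borel_measurable borel" "\<And>x. 0 \<le> G x"
    and loc: "\<And>x e. 0 < e \<Longrightarrow> \<forall>\<^sub>F y in at x. \<bar>g y - g x\<bar> \<le> (G x + e) * dist y x"
  shows "ennreal \<bar>g (\<gamma> 1) - g (\<gamma> 0)\<bar> \<le> (\<integral>\<^sup>+t. ennreal (G (\<gamma> t)) * speed_pair (\<gamma>, t) \<partial>lborel)"
proof (cases "(\<integral>\<^sup>+t. ennreal (G (\<gamma> t)) * speed_pair (\<gamma>, t) \<partial>lborel) = \<infinity>")
  case False
  let ?h = "\<lambda>t. ennreal (G (\<gamma> t)) * speed_pair (\<gamma>, t)"
  define k where "k t = enn2real (?h t)" for t
  have hm [measurable]: "?h \<in> borel_measurable borel" by (rule measurable_eval_speed_section[OF \<gamma>(1) G(1)])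
  have sp: "AE t in lborel. speed_pair (\<gamma>, t) < \<infinity>" by (rule finite_energy_speed_finite[OF \<gamma>(1,3)])
  then have hk: "AE t in lborel. ennreal (k t) = ?h t"
    by eventually_elim (simp add: k_def ennreal_mult_less_top)
  have nnk: "(\<integral>\<^sup>+t. ennreal (k t) \<partial>lborel) = (\<integral>\<^sup>+t. ?h t \<partial>lborel)"
    by (rule nn_integral_cong_AE[OF hk])
  have k: "integrable lborel k"
  proof (rule integrableI_nonneg)
    show "k \<in> borel_measurable lborel" unfolding k_def by measurable
    show "(\<integral>\<^sup>+t. ennreal (k t) \<partial>lborel) < \<infinity>" using nnk False by (simp add: less_top)
  qed (simp add: k_def)
  have k0: "0 \<le> k t" for t by (simp add: k_def)
  obtain g0 where g0: "set_integrable lborel {0..1} g0"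
    "\<And>s t. \<lbrakk>0 \<le> s; s \<le> t; t \<le> 1\<rbrakk> \<Longrightarrow> dist (\<gamma> s) (\<gamma> t) \<le> (LINT r:{s..t}|lborel. g0 r)"
    using \<gamma>(2) unfolding abs_continuous_curve_def by blast
  have L0: "0 \<le> L" using g by (rule lipschitz_on_nonneg)
  define w where "w t = L * \<bar>indicator {0..1} t * g0 t\<bar>" for t
  have w: "integrable lborel w" "\<And>t. 0 \<le> w t"
    using g0(1) L0 unfolding w_def set_integrable_def by auto
  have inc: "\<bar>g (\<gamma> t) - g (\<gamma> s)\<bar> \<le> (LINT r:{s..t}|lborel. w r)" if st: "0 \<le> s" "s \<le> t" "t \<le> 1" for s t
  proof -
    have "\<bar>g (\<gamma> t) - g (\<gamma> s)\<bar> \<le> L * dist (\<gamma> s) (\<gamma> t)"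
      using lipschitz_onD[OF g, of "\<gamma> t" "\<gamma> s"] by (simp add: dist_real_def dist_commute)
    also have "\<dots> \<le> L * (LINT r:{s..t}|lborel. g0 r)" using g0(2)[OF st] L0 by (rule mult_left_mono)
    also have "\<dots> = (LINT r:{s..t}|lborel. L * g0 r)" by simp
    also have "\<dots> \<le> (LINT r:{s..t}|lborel. w r)"
    proof (rule set_integral_mono)
      show "set_integrable lborel {s..t} (\<lambda>r. L * g0 r)"
        using set_integrable_subset[OF g0(1), of "{s..t}"] st by auto
      show "set_integrable lborel {s..t} w" using w by (intro set_integrable_of_integrable) auto
      fix r assume "r \<in> {s..t}"
      then show "L * g0 r \<le> w r" using st L0 by (auto simp: w_def intro!: mult_left_mono)
    qed
    finally show ?thesis .
  qed
  have c: "continuous_on {0..1} \<gamma>" using space_curvesD[OF \<gamma>(1)] by simp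
  have "\<bar>g (\<gamma> 1) - g (\<gamma> 0)\<bar> \<le> (LINT t:{0..1}|lborel. k t)"
  proof (rule increment_le_integral_of_speed_bound[OF w k k0 inc])
    show "AE t in lborel. t \<in> {0..1} \<longrightarrow> (\<forall>e>0. \<exists>\<delta>>0. \<forall>s\<in>{0..1}. \<bar>s - t\<bar> < \<delta> \<longrightarrow>
        \<bar>g (\<gamma> s) - g (\<gamma> t)\<bar> \<le> (k t + e) * \<bar>s - t\<bar>)"
      using sp
    proof eventually_elim
      case (elim t)
      show ?case
      proof (intro impI allI)
        fix e :: real assume t: "t \<in> {0..1}" and e: "0 < e"
        define v where "v = enn2real (metric_speed \<gamma> t)"
        have ms: "metric_speed \<gamma> t = ennreal v" "0 \<le> v"
          using elim t by (auto simp: v_def speed_pair_def)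
        have kt: "k t = G (\<gamma> t) * v"
          using t ms G(2) by (simp add: k_def speed_pair_def enn2real_mult)
        \<comment> \<open>chosen such that \<open>(G + e') * (v + e') \<le> G * v + e\<close>\<close>
        define e' where "e' = min 1 (e / (G (\<gamma> t) + v + 1))"
        have den: "0 < G (\<gamma> t) + v + 1" using ms(2) G(2)[of "\<gamma> t"] by linarith
        have e': "0 < e'" "e' \<le> 1" "e' * (G (\<gamma> t) + v + 1) \<le> e"
        proof -
          show "0 < e'" "e' \<le> 1" using e den by (auto simp: e'_def)
          have "e' * (G (\<gamma> t) + v + 1) \<le> e / (G (\<gamma> t) + v + 1) * (G (\<gamma> t) + v + 1)"
            unfolding e'_def using den by (intro mult_right_mono) auto
          then show "e' * (G (\<gamma> t) + v + 1) \<le> e" using den by simp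
        qed
        have prod: "(G (\<gamma> t) + e') * (v + e') \<le> k t + e"
        proof -
          have "(G (\<gamma> t) + e') * (v + e') = k t + e' * (G (\<gamma> t) + v + e')" by (simp add: kt algebra_simps)
          also have "e' * (G (\<gamma> t) + v + e') \<le> e' * (G (\<gamma> t) + v + 1)" using e' by (intro mult_left_mono) auto
          finally show ?thesis using e'(3) by linarith
        qed
        have "metric_speed \<gamma> t < ennreal (v + e')"
          using ms e' by (simp add: ennreal_lessI)
        then have "\<forall>\<^sub>F s in at t within {0..1}. ennreal (dist (\<gamma> s) (\<gamma> t) / \<bar>s - t\<bar>) < ennreal (v + e')"
          unfolding metric_speed_def by (rule Limsup_lessD)
        then obtain d1 where d1: "0 < d1" "\<And>s. \<lbrakk>s \<in> {0..1}; s \<noteq> t; dist s t < d1\<rbrakk>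
            \<Longrightarrow> ennreal (dist (\<gamma> s) (\<gamma> t) / \<bar>s - t\<bar>) < ennreal (v + e')"
          unfolding eventually_at by blast
        obtain \<rho> where \<rho>: "0 < \<rho>" "\<And>y. \<lbrakk>y \<noteq> \<gamma> t; dist y (\<gamma> t) < \<rho>\<rbrakk> \<Longrightarrow> \<bar>g y - g (\<gamma> t)\<bar> \<le> (G (\<gamma> t) + e') * dist y (\<gamma> t)"
          using loc[OF e'(1), of "\<gamma> t"] unfolding eventually_at by blast
        obtain d2 where d2: "0 < d2" "\<And>s. \<lbrakk>s \<in> {0..1}; dist s t < d2\<rbrakk> \<Longrightarrow> dist (\<gamma> s) (\<gamma> t) < \<rho>"
          using c[unfolded continuous_on_iff] t \<rho>(1) by metis
        have "\<bar>g (\<gamma> s) - g (\<gamma> t)\<bar> \<le> (k t + e) * \<bar>s - t\<bar>" if s: "s \<in> {0..1}" "\<bar>s - t\<bar> < min d1 d2" for s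
        proof (cases "s = t \<or> \<gamma> s = \<gamma> t")
          case True
          then show ?thesis using k0[of t] e by auto
        next
          case False
          have "dist (\<gamma> s) (\<gamma> t) / \<bar>s - t\<bar> < v + e'"
            using d1(2)[OF s(1)] s False by (simp add: dist_real_def ennreal_less_iff)
          then have ds: "dist (\<gamma> s) (\<gamma> t) \<le> (v + e') * \<bar>s - t\<bar>" using False by (simp add: field_simps)
          have "\<bar>g (\<gamma> s) - g (\<gamma> t)\<bar> \<le> (G (\<gamma> t) + e') * dist (\<gamma> s) (\<gamma> t)"
            using s False d2(2)[OF s(1)] by (intro \<rho>(2)) (auto simp: dist_real_def)
          also have "\<dots> \<le> (G (\<gamma> t) + e') * ((v + e') * \<bar>s - t\<bar>)"
            using ds G(2)[of "\<gamma> t"] e' by (intro mult_left_mono) auto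
          also have "\<dots> \<le> (k t + e) * \<bar>s - t\<bar>"
            using mult_right_mono[OF prod, of "\<bar>s - t\<bar>"] by (simp add: mult.assoc)
          finally show ?thesis .
        qed
        then show "\<exists>\<delta>>0. \<forall>s\<in>{0..1}. \<bar>s - t\<bar> < \<delta> \<longrightarrow> \<bar>g (\<gamma> s) - g (\<gamma> t)\<bar> \<le> (k t + e) * \<bar>s - t\<bar>"
          using d1(1) d2(1) by (intro exI[of _ "min d1 d2"]) auto
      qed
    qed
  qed
  also have "\<dots> = (LINT t|lborel. k t)"
    unfolding set_lebesgue_integral_def
    by (rule Bochner_Integration.integral_cong) (auto simp: k_def speed_pair_def split: split_indicator)
  finally have "ennreal \<bar>g (\<gamma> 1) - g (\<gamma> 0)\<bar> \<le> ennreal (LINT t|lborel. k t)" by (rule ennreal_leI)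
  also have "\<dots> = (\<integral>\<^sup>+t. ennreal (k t) \<partial>lborel)"
    using k k0 by (intro nn_integral_eq_integral[symmetric]) auto
  finally show ?thesis using nnk by simp
qed simp

lemma nn_integral_stopped:
  fixes \<gamma> :: "real \<Rightarrow> 'a::polish_space"
  assumes ab: "0 \<le> a" "a \<le> b" "b \<le> 1"
  shows "(\<integral>\<^sup>+t. ennreal (G (stopped a b \<gamma> t)) * speed_pair (stopped a b \<gamma>, t) \<partial>lborel)
    = (\<integral>\<^sup>+t. ennreal (G (\<gamma> t)) * speed_pair (\<gamma>, t) * indicator {a..b} t \<partial>lborel)"
    and "(\<integral>\<^sup>+t. (speed_pair (stopped a b \<gamma>, t))\<^sup>2 \<partial>lborel) \<le> (\<integral>\<^sup>+t. (speed_pair (\<gamma>, t))\<^sup>2 \<partial>lborel)"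
proof -
  have ae: "AE t in lborel. t \<noteq> a \<and> t \<noteq> b"
    using AE_lborel_singleton[of a] AE_lborel_singleton[of b] by eventually_elim auto
  show "(\<integral>\<^sup>+t. ennreal (G (stopped a b \<gamma> t)) * speed_pair (stopped a b \<gamma>, t) \<partial>lborel)
    = (\<integral>\<^sup>+t. ennreal (G (\<gamma> t)) * speed_pair (\<gamma>, t) * indicator {a..b} t \<partial>lborel)"
  proof (rule nn_integral_cong_AE)
    show "AE t in lborel. ennreal (G (stopped a b \<gamma> t)) * speed_pair (stopped a b \<gamma>, t)
        = ennreal (G (\<gamma> t)) * speed_pair (\<gamma>, t) * indicator {a..b} t"
      using ae
    proof eventually_elim
      case (elim t)
      show ?case
      proof (cases "t \<in> {a<..<b}")
        case True
        then have "stopped a b \<gamma> t = \<gamma> t" using ab by (auto simp: stopped_apply)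
        then show ?thesis using True elim ab by (simp add: speed_pair_stopped)
      next
        case False
        then show ?thesis using elim ab by (auto simp: speed_pair_stopped split: split_indicator)
      qed
    qed
  qed
  show "(\<integral>\<^sup>+t. (speed_pair (stopped a b \<gamma>, t))\<^sup>2 \<partial>lborel) \<le> (\<integral>\<^sup>+t. (speed_pair (\<gamma>, t))\<^sup>2 \<partial>lborel)"
  proof (rule nn_integral_mono_AE)
    show "AE t in lborel. (speed_pair (stopped a b \<gamma>, t))\<^sup>2 \<le> (speed_pair (\<gamma>, t))\<^sup>2"
      using ae by eventually_elim (use ab in \<open>auto simp: speed_pair_stopped split: split_indicator\<close>)
  qed
qed

text \<open>
  A Borel substitute for absolute continuity. The latter refers to an unspecified integrable function and
  is not evidently a Borel property of the curve, whereas an almost sure property has to be measurable in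
  order to pass to an image measure.
\<close>

definition speed_controlled :: "(real \<Rightarrow> 'a::polish_space) \<Rightarrow> bool" where
  "speed_controlled \<gamma> \<longleftrightarrow> finite_energy \<gamma> \<and> (\<forall>s\<in>\<rat> \<inter> {0..1}. \<forall>t\<in>\<rat> \<inter> {0..1}. s \<le> t \<longrightarrow>
     ennreal (dist (\<gamma> s) (\<gamma> t)) \<le> (\<integral>\<^sup>+r. speed_pair (\<gamma>, r) * indicator {s..t} r \<partial>lborel))"

lemma measurable_nn_integral_curves:
  assumes "f \<in> borel_measurable ((borel_curves :: (real \<Rightarrow> 'a::polish_space) measure) \<Otimes>\<^sub>M borel)"
  shows "(\<lambda>\<gamma>. \<integral>\<^sup>+t. f (\<gamma>, t) \<partial>lborel) \<in> borel_measurable (borel_curves :: (real \<Rightarrow> 'a) measure)"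
proof (rule lborel.borel_measurable_nn_integral)
  have eq: "sets ((borel_curves :: (real \<Rightarrow> 'a) measure) \<Otimes>\<^sub>M lborel) = sets ((borel_curves :: (real \<Rightarrow> 'a) measure) \<Otimes>\<^sub>M borel)"
    by (intro sets_pair_measure_cong) auto
  show "(\<lambda>(\<gamma>, t). f (\<gamma>, t)) \<in> borel_measurable ((borel_curves :: (real \<Rightarrow> 'a) measure) \<Otimes>\<^sub>M lborel)"
    unfolding measurable_cong_sets[OF eq refl] using assms by (simp add: case_prod_eta)
qed

lemma sets_speed_controlled:
  "{\<gamma> \<in> space borel_curves. speed_controlled \<gamma>} \<in> sets (borel_curves :: (real \<Rightarrow> 'a::polish_space) measure)"
proof -
  let ?M = "borel_curves :: (real \<Rightarrow> 'a) measure"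
  let ?Q = "\<rat> \<inter> {0..1} :: real set"
  have Q: "countable ?Q" by (intro countable_Int1 countable_rat)
  have 1 [measurable]: "(\<lambda>\<gamma>. \<integral>\<^sup>+t. (speed_pair (\<gamma>, t))\<^sup>2 \<partial>lborel) \<in> borel_measurable ?M"
    by (rule measurable_nn_integral_curves) measurable
  have 2 [measurable]: "(\<lambda>\<gamma>. \<integral>\<^sup>+r. speed_pair (\<gamma>, r) * indicator {s..t} r \<partial>lborel) \<in> borel_measurable ?M" for s t
  proof -
    have "(\<lambda>p. speed_pair p * indicator {s..t} (snd p)) \<in> borel_measurable (?M \<Otimes>\<^sub>M borel)" by measurable
    from measurable_nn_integral_curves[OF this] show ?thesis by simp
  qed
  have 3: "{\<gamma> \<in> space ?M. s \<le> t \<longrightarrow> ennreal (dist (\<gamma> s) (\<gamma> t)) \<le> (\<integral>\<^sup>+r. speed_pair (\<gamma>, r) * indicator {s..t} r \<partial>lborel)} \<in> sets ?M"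
    if "s \<in> ?Q" "t \<in> ?Q" for s t
  proof -
    have "(\<lambda>\<gamma>. \<gamma> s) \<in> ?M \<rightarrow>\<^sub>M borel" "(\<lambda>\<gamma>. \<gamma> t) \<in> ?M \<rightarrow>\<^sub>M borel"
      using that by (auto intro: measurable_eval)
    then have "(\<lambda>\<gamma>. ennreal (dist (\<gamma> s) (\<gamma> t))) \<in> borel_measurable ?M"
      by (intro measurable_compose[OF borel_measurable_dist measurable_ennreal])
    from borel_measurable_le[OF this 2, of s t] show ?thesis
      by (cases "s \<le> t") auto
  qed
  have "{\<gamma> \<in> space ?M. finite_energy \<gamma>} \<in> sets ?M" unfolding finite_energy_def by measurable
  moreover have "{\<gamma> \<in> space ?M. \<forall>s\<in>?Q. \<forall>t\<in>?Q. s \<le> t \<longrightarrow>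
      ennreal (dist (\<gamma> s) (\<gamma> t)) \<le> (\<integral>\<^sup>+r. speed_pair (\<gamma>, r) * indicator {s..t} r \<partial>lborel)} \<in> sets ?M"
    by (rule sets.sets_Collect_countable_All'[OF sets.sets_Collect_countable_All'[OF 3 Q] Q])
  ultimately have "{\<gamma> \<in> space ?M. finite_energy \<gamma>} \<inter> {\<gamma> \<in> space ?M. \<forall>s\<in>?Q. \<forall>t\<in>?Q. s \<le> t \<longrightarrow>
      ennreal (dist (\<gamma> s) (\<gamma> t)) \<le> (\<integral>\<^sup>+r. speed_pair (\<gamma>, r) * indicator {s..t} r \<partial>lborel)} \<in> sets ?M"
    by (rule sets.Int)
  then show ?thesis
    by (rule back_subst[of "\<lambda>A. A \<in> sets ?M"]) (auto simp: speed_controlled_def)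
qed

text \<open>
  The distance from \<open>\<gamma> s\<close> is \<open>1\<close>-Lipschitz, with slope at most \<open>1\<close>; integrate it along the curve stopped
  outside \<open>[s, t]\<close>.
\<close>

lemma speed_controlled_of_abs_continuous:
  fixes \<gamma> :: "real \<Rightarrow> 'a::polish_space"
  assumes \<gamma>: "\<gamma> \<in> space borel_curves" "abs_continuous_curve \<gamma>" "finite_energy \<gamma>"
  shows "speed_controlled \<gamma>"
  unfolding speed_controlled_def
proof (intro conjI ballI impI)
  fix s t :: real assume "s \<in> \<rat> \<inter> {0..1}" "t \<in> \<rat> \<inter> {0..1}" "s \<le> t"
  then have st: "0 \<le> s" "s \<le> t" "t \<le> 1" by auto
  let ?g = "\<lambda>x. dist (\<gamma> s) x"
  have lip: "1-lipschitz_on UNIV ?g"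
  proof (rule lipschitz_onI)
    fix x y
    show "dist (?g x) (?g y) \<le> 1 * dist x y"
      using dist_triangle[of "\<gamma> s" x y] dist_triangle[of "\<gamma> s" y x]
      by (simp add: dist_real_def dist_commute abs_le_iff)
  qed simp
  have "\<forall>\<^sub>F y in at x. \<bar>?g y - ?g x\<bar> \<le> (1 + e) * dist y x" if "0 < e" for x and e :: real
  proof (rule always_eventually, rule allI)
    fix y
    have "\<bar>?g y - ?g x\<bar> \<le> 1 * dist y x" using lipschitz_onD[OF lip, of y x] by (simp add: dist_real_def)
    also have "\<dots> \<le> (1 + e) * dist y x" using that by (intro mult_right_mono) auto
    finally show "\<bar>?g y - ?g x\<bar> \<le> (1 + e) * dist y x" .
  qed
  moreover have "stopped s t \<gamma> \<in> space borel_curves"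
    using measurable_space[OF measurable_stopped[OF st] \<gamma>(1)] .
  moreover have "finite_energy (stopped s t \<gamma>)"
    using nn_integral_stopped(2)[OF st, of \<gamma>] \<gamma>(3) unfolding finite_energy_def by (rule le_less_trans)
  ultimately have "ennreal \<bar>?g (stopped s t \<gamma> 1) - ?g (stopped s t \<gamma> 0)\<bar>
      \<le> (\<integral>\<^sup>+r. ennreal 1 * speed_pair (stopped s t \<gamma>, r) \<partial>lborel)"
    by (intro lipschitz_increment_along_curve[OF _ abs_continuous_stopped[OF \<gamma>(2) st] _ lip, of "\<lambda>_. 1"]) auto
  also have "\<dots> = (\<integral>\<^sup>+r. ennreal 1 * speed_pair (\<gamma>, r) * indicator {s..t} r \<partial>lborel)"
    by (rule nn_integral_stopped(1)[OF st, of "\<lambda>_. 1"])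
  finally show "ennreal (dist (\<gamma> s) (\<gamma> t)) \<le> (\<integral>\<^sup>+r. speed_pair (\<gamma>, r) * indicator {s..t} r \<partial>lborel)"
    using st by (simp add: stopped_apply clamp_time_def)
qed (rule \<gamma>(3))

text \<open>
  On the unit interval the speed is at most one plus its square, hence integrable, and rational times
  suffice by continuity of the curve.
\<close>

lemma abs_continuous_of_speed_controlled:
  fixes \<gamma> :: "real \<Rightarrow> 'a::polish_space"
  assumes \<gamma>: "\<gamma> \<in> space borel_curves" "speed_controlled \<gamma>"
  shows "abs_continuous_curve \<gamma>"
proof -
  have c: "continuous_on {0..1} \<gamma>" using space_curvesD[OF \<gamma>(1)] by simp
  have fe: "finite_energy \<gamma>" using \<gamma>(2) by (simp add: speed_controlled_def)
  have sp: "AE t in lborel. speed_pair (\<gamma>, t) < \<infinity>" by (rule finite_energy_speed_finite[OF \<gamma>(1) fe])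
  have spm [measurable]: "(\<lambda>t. speed_pair (\<gamma>, t)) \<in> borel_measurable borel"
    by (rule measurable_speed_section[OF \<gamma>(1)])
  define v where "v t = enn2real (speed_pair (\<gamma>, t))" for t
  have vsp: "AE t in lborel. ennreal (v t) = speed_pair (\<gamma>, t)"
    using sp by eventually_elim (simp add: v_def)
  have "(\<integral>\<^sup>+t. speed_pair (\<gamma>, t) \<partial>lborel) \<le> (\<integral>\<^sup>+t. indicator {0..1} t + (speed_pair (\<gamma>, t))\<^sup>2 \<partial>lborel)"
  proof (rule nn_integral_mono)
    fix t
    show "speed_pair (\<gamma>, t) \<le> indicator {0..1} t + (speed_pair (\<gamma>, t))\<^sup>2"
      using ennreal_le_indicator_plus_square[of "speed_pair (\<gamma>, t)"]
      by (cases "t \<in> {0..1}") (auto simp: speed_pair_def)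
  qed
  also have "\<dots> = (\<integral>\<^sup>+t. indicator {0..1::real} t \<partial>lborel) + (\<integral>\<^sup>+t. (speed_pair (\<gamma>, t))\<^sup>2 \<partial>lborel)"
    by (rule nn_integral_add) auto
  also have "\<dots> < \<infinity>" using fe by (simp add: finite_energy_def)
  finally have fin: "(\<integral>\<^sup>+t. speed_pair (\<gamma>, t) \<partial>lborel) < \<infinity>" .
  have vi: "integrable lborel v"
  proof (rule integrableI_nonneg)
    show "(\<integral>\<^sup>+t. ennreal (v t) \<partial>lborel) < \<infinity>" using fin nn_integral_cong_AE[OF vsp] by simp
    show "v \<in> borel_measurable lborel" unfolding v_def by measurable
  qed (auto simp: v_def)
  have rat: "dist (\<gamma> s) (\<gamma> t) \<le> (LINT r:{s..t}|lborel. v r)"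
    if st: "s \<in> \<rat> \<inter> {0..1}" "t \<in> \<rat> \<inter> {0..1}" "s \<le> t" for s t
  proof -
    have "ennreal (dist (\<gamma> s) (\<gamma> t)) \<le> (\<integral>\<^sup>+r. speed_pair (\<gamma>, r) * indicator {s..t} r \<partial>lborel)"
      using \<gamma>(2) st by (auto simp: speed_controlled_def)
    also have "\<dots> = (\<integral>\<^sup>+r. ennreal (indicator {s..t} r * v r) \<partial>lborel)"
    proof (rule nn_integral_cong_AE)
      show "AE r in lborel. speed_pair (\<gamma>, r) * indicator {s..t} r = ennreal (indicator {s..t} r * v r)"
        using vsp by eventually_elim (auto split: split_indicator)
    qed
    also have "\<dots> = ennreal (LINT r:{s..t}|lborel. v r)"
      unfolding set_lebesgue_integral_def using integrable_indicator_times[OF vi, of "{s..t}"]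
      by (subst nn_integral_eq_integral) (auto simp: v_def)
    finally show ?thesis
      by (subst (asm) ennreal_le_iff) (auto simp: set_lebesgue_integral_def v_def)
  qed
  have "dist (\<gamma> s) (\<gamma> t) \<le> (LINT r:{s..t}|lborel. v r)" if st: "0 \<le> s" "s \<le> t" "t \<le> 1" for s t
  proof (cases "s = t")
    case True
    then show ?thesis by (auto simp: set_lebesgue_integral_def v_def)
  next
    case False
    then have lt: "s < t" using st by simp
    define \<eta> where "\<eta> n = (t - s) / real (Suc (Suc n))" for n :: nat
    have \<eta>: "0 < \<eta> n" "2 * \<eta> n \<le> t - s" for n
    proof -
      show "0 < \<eta> n" using lt by (simp add: \<eta>_def)
      have "(t - s) * 2 \<le> (t - s) * real (Suc (Suc n))" using lt by (intro mult_left_mono) auto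
      then show "2 * \<eta> n \<le> t - s" by (simp add: \<eta>_def divide_le_eq mult.commute del: of_nat_Suc)
    qed
    have "\<eta> \<longlonglongrightarrow> 0" unfolding \<eta>_def using lim_const_over_n[of "t - s", THEN LIMSEQ_Suc, THEN LIMSEQ_Suc] by simp
    note \<eta>lim = this
    have "\<forall>n. \<exists>q\<in>\<rat>. s < q \<and> q < s + \<eta> n" using \<eta> by (auto intro: Rats_dense_in_real)
    then obtain p where p: "\<And>n. p n \<in> \<rat>" "\<And>n. s < p n" "\<And>n. p n < s + \<eta> n" by metis
    have "\<forall>n. \<exists>q\<in>\<rat>. t - \<eta> n < q \<and> q < t" using \<eta> by (auto intro: Rats_dense_in_real)
    then obtain q where q: "\<And>n. q n \<in> \<rat>" "\<And>n. t - \<eta> n < q n" "\<And>n. q n < t" by metis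
    have pq: "p n \<le> q n" for n using p(3)[of n] q(2)[of n] \<eta>(2)[of n] by linarith
    have plim: "p \<longlonglongrightarrow> s"
      by (rule tendsto_sandwich[OF _ _ tendsto_const, of _ _ _ "\<lambda>n. s + \<eta> n"])
        (use p \<eta>lim in \<open>auto intro!: always_eventually less_imp_le tendsto_eq_intros\<close>)
    have qlim: "q \<longlonglongrightarrow> t"
      by (rule tendsto_sandwich[of "\<lambda>n. t - \<eta> n", OF _ _ _ tendsto_const])
        (use q \<eta>lim in \<open>auto intro!: always_eventually less_imp_le tendsto_eq_intros\<close>)
    have in01: "p n \<in> {0..1}" "q n \<in> {0..1}" for n
      using p(2)[of n] q(3)[of n] pq[of n] st by auto
    have "(\<lambda>n. dist (\<gamma> (p n)) (\<gamma> (q n))) \<longlonglongrightarrow> dist (\<gamma> s) (\<gamma> t)"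
      using st in01 plim qlim
      by (intro tendsto_dist continuous_on_tendsto_compose[OF c]) auto
    moreover have "dist (\<gamma> (p n)) (\<gamma> (q n)) \<le> (LINT r:{s..t}|lborel. v r)" for n
    proof -
      have "dist (\<gamma> (p n)) (\<gamma> (q n)) \<le> (LINT r:{p n..q n}|lborel. v r)"
        using p(1) q(1) in01 pq by (intro rat) auto
      also have "\<dots> \<le> (LINT r:{s..t}|lborel. v r)"
        unfolding set_lebesgue_integral_def
        using integrable_indicator_times[OF vi, of "{s..t}"] integrable_indicator_times[OF vi, of "{p n..q n}"]
          p(2)[of n] q(3)[of n]
        by (intro integral_mono) (auto simp: v_def split: split_indicator)
      finally show ?thesis .
    qed
    ultimately show ?thesis by (intro LIMSEQ_le_const2) auto
  qed
  then show ?thesis unfolding abs_continuous_curve_def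
    using set_integrable_of_integrable[OF vi, of "{0..1}"] by auto
qed

section \<open>Test plans and their restrictions\<close>

definition path_integral :: "('a::polish_space \<Rightarrow> real) \<Rightarrow> (real \<Rightarrow> 'a) \<Rightarrow> ennreal" where
  "path_integral G \<gamma> = (\<integral>\<^sup>+t. ennreal (G (\<gamma> t)) * speed_pair (\<gamma>, t) \<partial>lborel)"

lemma weak_upper_gradient_iff:
  "weak_upper_gradient m f G \<longleftrightarrow> G \<in> Lp m 2 \<and> (\<forall>x. 0 \<le> G x) \<and>
     (\<forall>\<pi>. test_plan m \<pi> \<longrightarrow>
        (\<integral>\<^sup>+\<gamma>. ennreal \<bar>f (\<gamma> 1) - f (\<gamma> 0)\<bar> \<partial>\<pi>) \<le> (\<integral>\<^sup>+\<gamma>. path_integral G \<gamma> \<partial>\<pi>))"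
proof -
  have "(\<integral>\<^sup>+t\<in>{0..1}. ennreal (G (\<gamma> t)) * metric_speed \<gamma> t \<partial>lborel) = path_integral G \<gamma>" for \<gamma>
    unfolding path_integral_def
    by (rule nn_integral_cong) (simp add: speed_pair_def mult_ac)
  then show ?thesis by (simp add: weak_upper_gradient_def)
qed

lemma measurable_path_integral:
  assumes "G \<in> borel_measurable borel"
  shows "path_integral G \<in> borel_measurable (borel_curves :: (real \<Rightarrow> 'a::polish_space) measure)"
  unfolding path_integral_def[abs_def]
  using measurable_nn_integral_curves[OF measurable_eval_times_speed[OF assms]] by simp

lemma test_plan_sets:
  assumes "test_plan m \<pi>"
  shows "sets \<pi> = sets borel_curves" and "space \<pi> = space borel_curves" and "prob_space \<pi>"
proof -
  show s: "sets \<pi> = sets borel_curves" using assms by (simp add: test_plan_def)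
  show "space \<pi> = space borel_curves" by (rule sets_eq_imp_space_eq[OF s])
  show "prob_space \<pi>" using assms by (intro prob_spaceI) (simp add: test_plan_def)
qed

lemma plan_measurable:
  assumes "test_plan m \<pi>"
  shows "measurable \<pi> N = measurable borel_curves N"
  using test_plan_sets(1)[OF assms] by (rule measurable_cong_sets) simp

lemma test_plan_energy:
  assumes \<pi>: "test_plan m \<pi>"
  shows "(\<integral>\<^sup>+\<gamma>. \<integral>\<^sup>+t. (speed_pair (\<gamma>, t))\<^sup>2 \<partial>lborel \<partial>\<pi>) < \<infinity>"
proof -
  have "(\<integral>\<^sup>+t. (speed_pair (\<gamma>, t))\<^sup>2 \<partial>lborel) = (\<integral>\<^sup>+t\<in>{0..1}. (metric_speed \<gamma> t)\<^sup>2 \<partial>lborel)"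
    for \<gamma> :: "real \<Rightarrow> 'a"
    by (rule nn_integral_cong) (simp add: speed_pair_def split: split_indicator)
  then show ?thesis using \<pi> by (simp add: test_plan_def)
qed

lemma measurable_energy:
  "(\<lambda>\<gamma>. \<integral>\<^sup>+t. (speed_pair (\<gamma>, t))\<^sup>2 \<partial>lborel) \<in> borel_measurable (borel_curves :: (real \<Rightarrow> 'a::polish_space) measure)"
  by (rule measurable_nn_integral_curves) measurable

lemma test_plan_AE:
  assumes \<pi>: "test_plan m \<pi>"
  shows "AE \<gamma> in \<pi>. \<gamma> \<in> space borel_curves \<and> abs_continuous_curve \<gamma> \<and> finite_energy \<gamma>"
proof -
  have "AE \<gamma> in \<pi>. (\<integral>\<^sup>+t. (speed_pair (\<gamma>, t))\<^sup>2 \<partial>lborel) \<noteq> \<infinity>"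
    using test_plan_energy[OF \<pi>] measurable_energy
    by (intro nn_integral_PInf_AE) (auto simp: plan_measurable[OF \<pi>])
  moreover have "AE \<gamma> in \<pi>. abs_continuous_curve \<gamma>" using \<pi> by (simp add: test_plan_def)
  moreover have "AE \<gamma> in \<pi>. \<gamma> \<in> space borel_curves" using test_plan_sets(2)[OF \<pi>] by (metis AE_space)
  ultimately show ?thesis by eventually_elim (auto simp: finite_energy_def less_top)
qed

lemma test_plan_marginal:
  assumes \<pi>: "test_plan m \<pi>" and m: "sets m = sets borel"
  obtains C where "0 < C" "\<And>t \<phi>. \<lbrakk>t \<in> {0..1}; \<phi> \<in> borel_measurable borel\<rbrakk>
    \<Longrightarrow> (\<integral>\<^sup>+\<gamma>. \<phi> (\<gamma> t) \<partial>\<pi>) \<le> ennreal C * (\<integral>\<^sup>+x. \<phi> x \<partial>m)"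
proof -
  obtain C where C: "0 < C" "\<And>t A. \<lbrakk>t \<in> {0..1}; A \<in> sets borel\<rbrakk>
      \<Longrightarrow> emeasure (distr \<pi> borel (\<lambda>\<gamma>. \<gamma> t)) A \<le> ennreal C * emeasure m A"
    using \<pi> unfolding test_plan_def by blast
  have "(\<integral>\<^sup>+\<gamma>. \<phi> (\<gamma> t) \<partial>\<pi>) \<le> ennreal C * (\<integral>\<^sup>+x. \<phi> x \<partial>m)"
    if t: "t \<in> {0..1}" and \<phi>: "\<phi> \<in> borel_measurable borel" for t and \<phi> :: "'a \<Rightarrow> ennreal"
  proof -
    have ev: "(\<lambda>\<gamma>. \<gamma> t) \<in> measurable \<pi> borel" using measurable_eval[OF t] by (simp add: plan_measurable[OF \<pi>])
    have se: "sets (distr \<pi> borel (\<lambda>\<gamma>. \<gamma> t)) = sets (scale_measure (ennreal C) m)" by (simp add: m)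
    have "emeasure (distr \<pi> borel (\<lambda>\<gamma>. \<gamma> t)) A \<le> emeasure (scale_measure (ennreal C) m) A" for A
      using C(2)[OF t, of A] by (cases "A \<in> sets borel") (auto simp: emeasure_notin_sets)
    then have le: "distr \<pi> borel (\<lambda>\<gamma>. \<gamma> t) \<le> scale_measure (ennreal C) m"
      using se sets_eq_imp_space_eq[OF se] by (simp only: le_measure_iff if_True le_fun_def simp_thms)
    have "(\<integral>\<^sup>+\<gamma>. \<phi> (\<gamma> t) \<partial>\<pi>) = (\<integral>\<^sup>+x. \<phi> x \<partial>distr \<pi> borel (\<lambda>\<gamma>. \<gamma> t))"
      using ev \<phi> by (subst nn_integral_distr) auto
    also have "\<dots> \<le> (\<integral>\<^sup>+x. \<phi> x \<partial>scale_measure (ennreal C) m)"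
      by (rule nn_integral_mono_measure[OF _ le]) (simp add: m)
    also have "\<dots> = ennreal C * (\<integral>\<^sup>+x. \<phi> x \<partial>m)"
      using \<phi> by (intro nn_integral_scale_measure) (simp add: measurable_cong_sets[OF m refl])
    finally show ?thesis .
  qed
  with C(1) show thesis by (rule that)
qed

lemma abs_powr_two: "\<bar>u\<bar> powr 2 = (u::real)\<^sup>2"
  by (cases "u = 0") (simp_all add: powr_realpow[of _ 2, simplified])

lemma Lp2_nn_integral:
  assumes m: "sets m = sets borel" and "G \<in> Lp m 2"
  shows "G \<in> borel_measurable borel" and "(\<integral>\<^sup>+x. ennreal ((G x)\<^sup>2) \<partial>m) < \<infinity>"
proof -
  show "G \<in> borel_measurable borel"
    using assms(2) measurable_cong_sets[OF m refl] by (auto simp: Lp_def)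
  have "integrable m (\<lambda>x. (G x)\<^sup>2)" using assms(2) by (simp add: Lp_def abs_powr_two)
  then show "(\<integral>\<^sup>+x. ennreal ((G x)\<^sup>2) \<partial>m) < \<infinity>" by (simp add: integrable_iff_bounded)
qed

text \<open>
  By \<open>G * v \<le> G\<^sup>2 + v\<^sup>2\<close> the integral is bounded by the energy of the plan and, after exchanging the order of
  integration and using the bound on the marginals, by a multiple of the integral of \<open>G\<^sup>2\<close>.
\<close>

lemma path_integral_finite:
  assumes \<pi>: "test_plan m \<pi>" and m: "sets m = sets borel" and G: "G \<in> Lp m 2"
  shows "(\<integral>\<^sup>+\<gamma>. path_integral G \<gamma> \<partial>\<pi>) < \<infinity>"
proof -
  have Gm [measurable]: "G \<in> borel_measurable borel" and Gi: "(\<integral>\<^sup>+x. ennreal ((G x)\<^sup>2) \<partial>m) < \<infinity>"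
    using Lp2_nn_integral[OF m G] by auto
  interpret prob_space \<pi> by (rule test_plan_sets(3)[OF \<pi>])
  interpret P: pair_sigma_finite \<pi> lborel ..
  let ?sq = "\<lambda>\<gamma> t. indicator {0..1} t * ennreal ((G (\<gamma> (clamp_time 0 1 t)))\<^sup>2)"
  have [measurable]: "(\<lambda>p. (fst p) (clamp_time 0 1 (snd p)))
      \<in> borel_measurable ((borel_curves :: (real \<Rightarrow> 'a) measure) \<Otimes>\<^sub>M (borel :: real measure))"
    by (rule measurable_eval_pair)
  have sets_eq: "sets (\<pi> \<Otimes>\<^sub>M lborel) = sets ((borel_curves :: (real \<Rightarrow> 'a) measure) \<Otimes>\<^sub>M borel)"
    by (intro sets_pair_measure_cong test_plan_sets(1)[OF \<pi>]) auto
  have sqm: "(\<lambda>p. ?sq (fst p) (snd p)) \<in> borel_measurable ((borel_curves :: (real \<Rightarrow> 'a) measure) \<Otimes>\<^sub>M borel)"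
    by measurable
  obtain C where C: "0 < C" "\<And>t \<phi>. \<lbrakk>t \<in> {0..1}; \<phi> \<in> borel_measurable borel\<rbrakk>
    \<Longrightarrow> (\<integral>\<^sup>+\<gamma>. \<phi> (\<gamma> t) \<partial>\<pi>) \<le> ennreal C * (\<integral>\<^sup>+x. \<phi> x \<partial>m)"
    using that by (rule test_plan_marginal[OF \<pi> m])
  have "(\<integral>\<^sup>+\<gamma>. \<integral>\<^sup>+t. ?sq \<gamma> t \<partial>lborel \<partial>\<pi>) = (\<integral>\<^sup>+t. \<integral>\<^sup>+\<gamma>. ?sq \<gamma> t \<partial>\<pi> \<partial>lborel)"
    using sqm by (intro P.Fubini'[symmetric]) (simp add: measurable_cong_sets[OF sets_eq refl] split_beta')
  also have "\<dots> \<le> (\<integral>\<^sup>+t. indicator {0..1::real} t * (ennreal C * (\<integral>\<^sup>+x. ennreal ((G x)\<^sup>2) \<partial>m)) \<partial>lborel)"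
  proof (rule nn_integral_mono)
    fix t :: real
    show "(\<integral>\<^sup>+\<gamma>. ?sq \<gamma> t \<partial>\<pi>) \<le> indicator {0..1} t * (ennreal C * (\<integral>\<^sup>+x. ennreal ((G x)\<^sup>2) \<partial>m))"
      using C(2)[of t "\<lambda>x. ennreal ((G x)\<^sup>2)"] by (cases "t \<in> {0..1}") auto
  qed
  also have "\<dots> = ennreal C * (\<integral>\<^sup>+x. ennreal ((G x)\<^sup>2) \<partial>m)"
    by (subst nn_integral_multc) auto
  also have "\<dots> < \<infinity>" using Gi by (simp add: ennreal_mult_less_top)
  finally have sqfin: "(\<integral>\<^sup>+\<gamma>. \<integral>\<^sup>+t. ?sq \<gamma> t \<partial>lborel \<partial>\<pi>) < \<infinity>" .
  have "(\<integral>\<^sup>+\<gamma>. path_integral G \<gamma> \<partial>\<pi>)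
      \<le> (\<integral>\<^sup>+\<gamma>. (\<integral>\<^sup>+t. ?sq \<gamma> t \<partial>lborel) + (\<integral>\<^sup>+t. (speed_pair (\<gamma>, t))\<^sup>2 \<partial>lborel) \<partial>\<pi>)"
  proof (rule nn_integral_mono)
    fix \<gamma> assume "\<gamma> \<in> space \<pi>"
    then have \<gamma>: "\<gamma> \<in> space borel_curves" using test_plan_sets(2)[OF \<pi>] by simp
    have "path_integral G \<gamma> \<le> (\<integral>\<^sup>+t. ?sq \<gamma> t + (speed_pair (\<gamma>, t))\<^sup>2 \<partial>lborel)"
      unfolding path_integral_def
    proof (rule nn_integral_mono)
      fix t
      have prod: "ennreal u * v \<le> ennreal (u\<^sup>2) + v\<^sup>2" for u v
      proof (cases "0 \<le> u")
        case True
        then have e: "ennreal (u\<^sup>2) = ennreal u * ennreal u" by (simp add: power2_eq_square ennreal_mult)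
        show ?thesis
        proof (cases "ennreal u \<le> v")
          case True
          then have "ennreal u * v \<le> v * v" by (intro mult_right_mono) auto
          then show ?thesis by (simp add: power2_eq_square add_increasing)
        next
          case False
          then have "ennreal u * v \<le> ennreal u * ennreal u" by (intro mult_left_mono) auto
          then show ?thesis by (simp add: e add_increasing2)
        qed
      qed (simp add: ennreal_neg)
      show "ennreal (G (\<gamma> t)) * speed_pair (\<gamma>, t) \<le> ?sq \<gamma> t + (speed_pair (\<gamma>, t))\<^sup>2"
        using prod[of "G (\<gamma> t)" "speed_pair (\<gamma>, t)"]
        by (cases "t \<in> {0..1}") (auto simp: speed_pair_def)
    qed
    also have "\<dots> = (\<integral>\<^sup>+t. ?sq \<gamma> t \<partial>lborel) + (\<integral>\<^sup>+t. (speed_pair (\<gamma>, t))\<^sup>2 \<partial>lborel)"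
      using measurable_curve_section[OF \<gamma> sqm] measurable_speed_section[OF \<gamma>]
      by (intro nn_integral_add) auto
    finally show "path_integral G \<gamma> \<le> \<dots>" .
  qed
  also have "\<dots> = (\<integral>\<^sup>+\<gamma>. \<integral>\<^sup>+t. ?sq \<gamma> t \<partial>lborel \<partial>\<pi>) + (\<integral>\<^sup>+\<gamma>. \<integral>\<^sup>+t. (speed_pair (\<gamma>, t))\<^sup>2 \<partial>lborel \<partial>\<pi>)"
    using measurable_nn_integral_curves[OF sqm] measurable_energy
    by (intro nn_integral_add) (auto simp: plan_measurable[OF \<pi>])
  also have "\<dots> < \<infinity>" using sqfin test_plan_energy[OF \<pi>] by simp
  finally show ?thesis .
qed

text \<open>
  Conditioning on \<open>\<Gamma>\<close> multiplies the bounds on the marginals and on the energy by at most the inverse of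
  the probability of \<open>\<Gamma>\<close>; stopping replaces the marginal at each time by the one at another time and does
  not increase the energy.
\<close>

lemma test_plan_restrict_stop:
  fixes m :: "'a::polish_space measure"
  assumes \<pi>: "test_plan m \<pi>" and \<Gamma>: "\<Gamma> \<in> sets borel_curves" "emeasure \<pi> \<Gamma> \<noteq> 0"
    and ab: "0 \<le> a" "a \<le> b" "b \<le> 1"
  shows "test_plan m (distr (uniform_measure \<pi> \<Gamma>) borel_curves (stopped a b))"
proof -
  interpret prob_space \<pi> by (rule test_plan_sets(3)[OF \<pi>])
  let ?u = "uniform_measure \<pi> \<Gamma>" and ?n = "distr (uniform_measure \<pi> \<Gamma>) borel_curves (stopped a b)"
  have \<Gamma>': "\<Gamma> \<in> sets \<pi>" using \<Gamma> test_plan_sets(1)[OF \<pi>] by simp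
  have fin: "emeasure \<pi> \<Gamma> < \<infinity>" by (simp add: emeasure_eq_measure)
  define c where "c = measure \<pi> \<Gamma>"
  have c: "0 < c" "emeasure \<pi> \<Gamma> = ennreal c"
    using \<Gamma>(2) by (auto simp: c_def emeasure_eq_measure zero_less_measure_iff)
  have sets_u: "sets ?u = sets borel_curves" using test_plan_sets(1)[OF \<pi>] by simp
  have meas_u: "measurable ?u N = measurable borel_curves N" for N :: "'c measure"
    by (rule measurable_cong_sets[OF sets_u refl])
  have st: "stopped a b \<in> measurable ?u borel_curves" using measurable_stopped[OF ab] by (simp add: meas_u)
  have nn_u: "(\<integral>\<^sup>+\<gamma>. F \<gamma> \<partial>?u) \<le> (\<integral>\<^sup>+\<gamma>. F \<gamma> \<partial>\<pi>) / ennreal c"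
    if "F \<in> borel_measurable borel_curves" for F
  proof -
    have "(\<integral>\<^sup>+\<gamma>. F \<gamma> \<partial>?u) = (\<integral>\<^sup>+\<gamma>. F \<gamma> * indicator \<Gamma> \<gamma> \<partial>\<pi>) / emeasure \<pi> \<Gamma>"
      using that \<Gamma>' by (intro nn_integral_uniform_measure) (simp_all add: plan_measurable[OF \<pi>])
    also have "\<dots> \<le> (\<integral>\<^sup>+\<gamma>. F \<gamma> \<partial>\<pi>) / emeasure \<pi> \<Gamma>"
      by (intro divide_right_mono_ennreal nn_integral_mono) (auto split: split_indicator)
    finally show ?thesis by (simp add: c)
  qed
  show ?thesis
    unfolding test_plan_def
  proof (intro conjI)
    show "sets ?n = sets borel_curves" by simp
    interpret u: prob_space ?u using \<Gamma>(2) fin by (intro prob_space_uniform_measure) auto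
    interpret n: prob_space ?n by (rule u.prob_space_distr[OF st])
    show "emeasure ?n (space ?n) = 1" by (rule n.emeasure_space_1)
    have "AE \<gamma> in ?u. speed_controlled (stopped a b \<gamma>)"
    proof (rule AE_uniform_measureI[OF \<Gamma>'])
      show "AE \<gamma> in \<pi>. \<gamma> \<in> \<Gamma> \<longrightarrow> speed_controlled (stopped a b \<gamma>)"
        using test_plan_AE[OF \<pi>]
      proof eventually_elim
        case (elim \<gamma>)
        then show ?case
          using speed_controlled_of_abs_continuous[of "stopped a b \<gamma>"] abs_continuous_stopped[OF _ ab, of \<gamma>]
            measurable_space[OF measurable_stopped[OF ab], of \<gamma>] le_less_trans[OF nn_integral_stopped(2)[OF ab, of \<gamma>]]
          by (auto simp: finite_energy_def)
      qed
    qed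
    then have sc: "AE \<gamma> in ?n. speed_controlled \<gamma>"
      by (subst AE_distr_iff[OF st sets_speed_controlled])
    moreover have "AE \<gamma> in ?n. \<gamma> \<in> space borel_curves" using AE_space[of ?n] by simp
    ultimately show "AE \<gamma> in ?n. abs_continuous_curve \<gamma>"
      by eventually_elim (rule abs_continuous_of_speed_controlled)
    have "(\<integral>\<^sup>+\<gamma>. (\<integral>\<^sup>+t\<in>{0..1}. (metric_speed \<gamma> t)\<^sup>2 \<partial>lborel) \<partial>?n) = (\<integral>\<^sup>+\<gamma>. \<integral>\<^sup>+t. (speed_pair (\<gamma>, t))\<^sup>2 \<partial>lborel \<partial>?n)"
      by (intro nn_integral_cong) (simp add: speed_pair_def split: split_indicator)
    also have "\<dots> = (\<integral>\<^sup>+\<gamma>. \<integral>\<^sup>+t. (speed_pair (stopped a b \<gamma>, t))\<^sup>2 \<partial>lborel \<partial>?u)"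
      using measurable_energy by (subst nn_integral_distr[OF st]) auto
    also have "\<dots> \<le> (\<integral>\<^sup>+\<gamma>. \<integral>\<^sup>+t. (speed_pair (\<gamma>, t))\<^sup>2 \<partial>lborel \<partial>?u)"
      by (intro nn_integral_mono nn_integral_stopped(2)[OF ab])
    also have "\<dots> \<le> (\<integral>\<^sup>+\<gamma>. \<integral>\<^sup>+t. (speed_pair (\<gamma>, t))\<^sup>2 \<partial>lborel \<partial>\<pi>) / ennreal c"
      by (rule nn_u[OF measurable_energy])
    also have "\<dots> < \<infinity>"
      using test_plan_energy[OF \<pi>] c by (auto simp: ennreal_divide_eq_top_iff less_top[symmetric])
    finally show "(\<integral>\<^sup>+\<gamma>. (\<integral>\<^sup>+t\<in>{0..1}. (metric_speed \<gamma> t)\<^sup>2 \<partial>lborel) \<partial>?n) < \<infinity>" .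
    obtain C where C: "0 < C" "\<And>t A. \<lbrakk>t \<in> {0..1}; A \<in> sets borel\<rbrakk>
        \<Longrightarrow> emeasure (distr \<pi> borel (\<lambda>\<gamma>. \<gamma> t)) A \<le> ennreal C * emeasure m A"
      using \<pi> unfolding test_plan_def by blast
    have "emeasure (distr ?n borel (\<lambda>\<gamma>. \<gamma> t)) A \<le> ennreal (C / c) * emeasure m A"
      if t: "t \<in> {0..1}" and A: "A \<in> sets borel" for t A
    proof -
      let ?t = "clamp_time a b t"
      have t': "?t \<in> {0..1}" using clamp_time_in[of a b t] ab by auto
      have ind: "(\<lambda>\<gamma>. indicator A (\<gamma> s) :: ennreal) \<in> borel_measurable borel_curves" if "s \<in> {0..1}" for s
        using measurable_compose[OF measurable_eval[OF that] borel_measurable_indicator[of A borel]] A by simp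
      have evt: "(\<lambda>\<gamma>. \<gamma> t) \<in> measurable ?n borel" using measurable_eval[OF t] by simp
      have evu: "(\<lambda>\<gamma>. \<gamma> ?t) \<in> measurable ?u borel" using measurable_eval[OF t'] by (simp add: meas_u)
      have ev\<pi>: "(\<lambda>\<gamma>. \<gamma> ?t) \<in> measurable \<pi> borel" using measurable_eval[OF t'] by (simp add: plan_measurable[OF \<pi>])
      have "emeasure (distr ?n borel (\<lambda>\<gamma>. \<gamma> t)) A = (\<integral>\<^sup>+x. indicator A x \<partial>distr ?n borel (\<lambda>\<gamma>. \<gamma> t))"
        using A by simp
      also have "\<dots> = (\<integral>\<^sup>+\<gamma>. indicator A (\<gamma> t) \<partial>?n)"
        using A by (subst nn_integral_distr[OF evt]) auto
      also have "\<dots> = (\<integral>\<^sup>+\<gamma>. indicator A (stopped a b \<gamma> t) \<partial>?u)"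
        using ind[OF t] by (subst nn_integral_distr[OF st]) auto
      also have "\<dots> = (\<integral>\<^sup>+\<gamma>. indicator A (\<gamma> ?t) \<partial>?u)" using t by (simp add: stopped_apply)
      also have "\<dots> \<le> (\<integral>\<^sup>+\<gamma>. indicator A (\<gamma> ?t) \<partial>\<pi>) / ennreal c"
        by (rule nn_u[OF ind[OF t']])
      also have "(\<integral>\<^sup>+\<gamma>. indicator A (\<gamma> ?t) \<partial>\<pi>) = emeasure (distr \<pi> borel (\<lambda>\<gamma>. \<gamma> ?t)) A"
      proof -
        have "(\<integral>\<^sup>+\<gamma>. indicator A (\<gamma> ?t) \<partial>\<pi>) = (\<integral>\<^sup>+x. indicator A x \<partial>distr \<pi> borel (\<lambda>\<gamma>. \<gamma> ?t))"
          using A by (subst nn_integral_distr[OF ev\<pi>]) auto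
        then show ?thesis using A by simp
      qed
      also have "emeasure (distr \<pi> borel (\<lambda>\<gamma>. \<gamma> ?t)) A / ennreal c \<le> ennreal C * emeasure m A / ennreal c"
        by (intro divide_right_mono_ennreal C(2) t' A)
      also have "\<dots> = ennreal (C / c) * emeasure m A"
        using c C(1) by (simp add: divide_ennreal[symmetric] ennreal_times_divide mult.commute)
      finally show ?thesis .
    qed
    then show "\<exists>C>0. \<forall>t\<in>{0..1}. \<forall>A\<in>sets borel. emeasure (distr ?n borel (\<lambda>\<gamma>. \<gamma> t)) A \<le> ennreal C * emeasure m A"
      using C(1) c(1) by (intro exI[of _ "C / c"]) auto
  qed
qed

text \<open>
  Testing the integral inequality on the plan conditioned to the set of curves that violate the pathwise
  inequality on \<open>[a, b]\<close> shows that this set is null.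
\<close>

lemma weak_upper_gradient_along_paths:
  fixes m :: "'a::polish_space measure"
  assumes wug: "weak_upper_gradient m f G" and f: "f \<in> borel_measurable borel" and m: "sets m = sets borel"
    and \<pi>: "test_plan m \<pi>" and ab: "0 \<le> a" "a \<le> b" "b \<le> 1"
  shows "AE \<gamma> in \<pi>. ennreal \<bar>f (\<gamma> b) - f (\<gamma> a)\<bar> \<le> path_integral G (stopped a b \<gamma>)"
proof -
  interpret prob_space \<pi> by (rule test_plan_sets(3)[OF \<pi>])
  have G: "G \<in> Lp m 2" using wug by (simp add: weak_upper_gradient_def)
  have Gm: "G \<in> borel_measurable borel" using Lp2_nn_integral[OF m G] by auto
  let ?M = "borel_curves :: (real \<Rightarrow> 'a) measure"
  let ?u = "\<lambda>\<gamma>. ennreal \<bar>f (\<gamma> b) - f (\<gamma> a)\<bar>" and ?v = "\<lambda>\<gamma>. path_integral G (stopped a b \<gamma>)"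
  have inc: "(\<lambda>\<gamma>. ennreal \<bar>f (\<gamma> t) - f (\<gamma> s)\<bar>) \<in> borel_measurable ?M" if "s \<in> {0..1}" "t \<in> {0..1}" for s t
  proof -
    note [measurable] = measurable_compose[OF measurable_eval[OF that(1)] f] measurable_compose[OF measurable_eval[OF that(2)] f]
    show ?thesis by measurable
  qed
  have um: "?u \<in> borel_measurable ?M" using ab by (intro inc) auto
  have vm: "?v \<in> borel_measurable ?M"
    by (rule measurable_compose[OF measurable_stopped[OF ab] measurable_path_integral[OF Gm]])
  have um' [measurable]: "?u \<in> borel_measurable \<pi>" and vm' [measurable]: "?v \<in> borel_measurable \<pi>"
    using um vm by (simp_all add: plan_measurable[OF \<pi>])
  define \<Gamma> where "\<Gamma> = {\<gamma> \<in> space \<pi>. ?v \<gamma> < ?u \<gamma>}"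
  have \<Gamma>': "\<Gamma> \<in> sets \<pi>" unfolding \<Gamma>_def by measurable
  then have \<Gamma>: "\<Gamma> \<in> sets ?M" using test_plan_sets(1)[OF \<pi>] by simp
  have "emeasure \<pi> \<Gamma> = 0"
  proof (rule ccontr)
    assume nz: "emeasure \<pi> \<Gamma> \<noteq> 0"
    let ?n = "distr (uniform_measure \<pi> \<Gamma>) borel_curves (stopped a b)"
    have plan: "test_plan m ?n" by (rule test_plan_restrict_stop[OF \<pi> \<Gamma> nz ab])
    have st: "stopped a b \<in> measurable (uniform_measure \<pi> \<Gamma>) borel_curves"
      using measurable_stopped[OF ab] measurable_cong_sets[of "uniform_measure \<pi> \<Gamma>" ?M ?M ?M] test_plan_sets(1)[OF \<pi>] by simp
    have "(\<integral>\<^sup>+\<gamma>. ennreal \<bar>f (\<gamma> 1) - f (\<gamma> 0)\<bar> \<partial>?n) \<le> (\<integral>\<^sup>+\<gamma>. path_integral G \<gamma> \<partial>?n)"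
      using wug plan by (simp add: weak_upper_gradient_iff)
    also have "(\<integral>\<^sup>+\<gamma>. ennreal \<bar>f (\<gamma> 1) - f (\<gamma> 0)\<bar> \<partial>?n) = (\<integral>\<^sup>+\<gamma>. ennreal \<bar>f (stopped a b \<gamma> 1) - f (stopped a b \<gamma> 0)\<bar> \<partial>uniform_measure \<pi> \<Gamma>)"
      using inc[of 0 1] by (subst nn_integral_distr[OF st]) auto
    also have "\<dots> = (\<integral>\<^sup>+\<gamma>. ?u \<gamma> \<partial>uniform_measure \<pi> \<Gamma>)"
      using ab by (simp add: stopped_apply clamp_time_def)
    also have "\<dots> = (\<integral>\<^sup>+\<gamma>. ?u \<gamma> * indicator \<Gamma> \<gamma> \<partial>\<pi>) / emeasure \<pi> \<Gamma>"
      by (rule nn_integral_uniform_measure[OF um' \<Gamma>'])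
    also have "(\<integral>\<^sup>+\<gamma>. path_integral G \<gamma> \<partial>?n) = (\<integral>\<^sup>+\<gamma>. ?v \<gamma> \<partial>uniform_measure \<pi> \<Gamma>)"
      using measurable_path_integral[OF Gm] by (subst nn_integral_distr[OF st]) auto
    also have "\<dots> = (\<integral>\<^sup>+\<gamma>. ?v \<gamma> * indicator \<Gamma> \<gamma> \<partial>\<pi>) / emeasure \<pi> \<Gamma>"
      by (rule nn_integral_uniform_measure[OF vm' \<Gamma>'])
    finally have "(\<integral>\<^sup>+\<gamma>. ?u \<gamma> * indicator \<Gamma> \<gamma> \<partial>\<pi>) / emeasure \<pi> \<Gamma> \<le> (\<integral>\<^sup>+\<gamma>. ?v \<gamma> * indicator \<Gamma> \<gamma> \<partial>\<pi>) / emeasure \<pi> \<Gamma>" .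
    then have le: "(\<integral>\<^sup>+\<gamma>. ?u \<gamma> * indicator \<Gamma> \<gamma> \<partial>\<pi>) \<le> (\<integral>\<^sup>+\<gamma>. ?v \<gamma> * indicator \<Gamma> \<gamma> \<partial>\<pi>)"
    proof -
      have fin: "emeasure \<pi> \<Gamma> < top" by (simp add: emeasure_eq_measure)
      have "x / emeasure \<pi> \<Gamma> * emeasure \<pi> \<Gamma> = x" for x
        using nz fin by (simp add: ennreal_divide_times ennreal_times_divide mult.commute mult_divide_eq_ennreal less_top)
      with mult_right_mono[OF \<open>_ \<le> (\<integral>\<^sup>+\<gamma>. ?v \<gamma> * indicator \<Gamma> \<gamma> \<partial>\<pi>) / emeasure \<pi> \<Gamma>\<close>, of "emeasure \<pi> \<Gamma>"]
      show ?thesis by simp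
    qed
    have fin: "(\<integral>\<^sup>+\<gamma>. ?v \<gamma> * indicator \<Gamma> \<gamma> \<partial>\<pi>) < \<infinity>"
    proof -
      have "(\<integral>\<^sup>+\<gamma>. ?v \<gamma> * indicator \<Gamma> \<gamma> \<partial>\<pi>) \<le> (\<integral>\<^sup>+\<gamma>. path_integral G \<gamma> \<partial>\<pi>)"
      proof (rule nn_integral_mono)
        fix \<gamma>
        have "?v \<gamma> \<le> path_integral G \<gamma>"
          unfolding path_integral_def nn_integral_stopped(1)[OF ab]
          by (rule nn_integral_mono) (auto split: split_indicator)
        then show "?v \<gamma> * indicator \<Gamma> \<gamma> \<le> path_integral G \<gamma>" by (auto split: split_indicator)
      qed
      then show ?thesis using path_integral_finite[OF \<pi> m G] by (rule le_less_trans)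
    qed
    have "(\<integral>\<^sup>+\<gamma>. ?u \<gamma> * indicator \<Gamma> \<gamma> - ?v \<gamma> * indicator \<Gamma> \<gamma> \<partial>\<pi>)
        = (\<integral>\<^sup>+\<gamma>. ?u \<gamma> * indicator \<Gamma> \<gamma> \<partial>\<pi>) - (\<integral>\<^sup>+\<gamma>. ?v \<gamma> * indicator \<Gamma> \<gamma> \<partial>\<pi>)"
      using fin \<Gamma>' by (intro nn_integral_diff) (auto simp: \<Gamma>_def split: split_indicator)
    also have "\<dots> = 0" using le le_less_trans[OF le fin] by (simp add: diff_eq_0_iff_ennreal)
    finally have "AE \<gamma> in \<pi>. ?u \<gamma> * indicator \<Gamma> \<gamma> - ?v \<gamma> * indicator \<Gamma> \<gamma> = 0"
      using \<Gamma>' by (subst (asm) nn_integral_0_iff_AE) auto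
    then have "AE \<gamma> in \<pi>. \<gamma> \<notin> \<Gamma>"
    proof eventually_elim
      case (elim \<gamma>)
      show ?case
      proof
        assume g: "\<gamma> \<in> \<Gamma>"
        then have "?u \<gamma> - ?v \<gamma> = 0" "?v \<gamma> < ?u \<gamma>" using elim by (auto simp: \<Gamma>_def)
        then show False by (auto simp: diff_eq_0_iff_ennreal)
      qed
    qed
    then show False using nz AE_iff_null_sets[OF \<Gamma>'] by (auto simp: null_sets_def)
  qed
  then have "AE \<gamma> in \<pi>. \<gamma> \<notin> \<Gamma>" using \<Gamma>' by (intro AE_not_in) auto
  with AE_space show ?thesis by eventually_elim (auto simp: \<Gamma>_def not_less)
qed

section \<open>Weak upper gradients along almost every curve\<close>

lemma Lp2_mono:
  assumes m: "sets m = sets borel" and G1: "G1 \<in> Lp m 2" and G: "G \<in> borel_measurable borel"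
    and le: "\<And>x. \<bar>G x\<bar> \<le> \<bar>G1 x\<bar>"
  shows "G \<in> Lp m 2"
proof -
  have Gm: "G \<in> borel_measurable m" using G by (simp add: measurable_cong_sets[OF m refl])
  have "integrable m (\<lambda>x. \<bar>G x\<bar> powr 2)"
  proof (rule Bochner_Integration.integrable_bound)
    show "integrable m (\<lambda>x. \<bar>G1 x\<bar> powr 2)" using G1 by (simp add: Lp_def)
    show "(\<lambda>x. \<bar>G x\<bar> powr 2) \<in> borel_measurable m" using Gm by measurable
    show "AE x in m. norm (\<bar>G x\<bar> powr 2) \<le> norm (\<bar>G1 x\<bar> powr 2)"
      using le by (intro AE_I2) (simp add: abs_le_square_iff[symmetric])
  qed
  then show ?thesis using Gm by (simp add: Lp_def)
qed

definition segment_integral :: "('a::polish_space \<Rightarrow> real) \<Rightarrow> (real \<Rightarrow> 'a) \<Rightarrow> real \<Rightarrow> real \<Rightarrow> ennreal" where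
  "segment_integral G \<gamma> a b = (\<integral>\<^sup>+t. ennreal (G (\<gamma> t)) * speed_pair (\<gamma>, t) * indicator {a..b} t \<partial>lborel)"

text \<open>
  The pathwise inequality between the time \<open>a\<close> and all rational times. Two tame times are compared
  through a rational time between them, so that countably many inequalities per time are enough.
\<close>

definition tame_time :: "('a::polish_space \<Rightarrow> real) \<Rightarrow> ('a \<Rightarrow> real) \<Rightarrow> (real \<Rightarrow> 'a) \<Rightarrow> real \<Rightarrow> bool" where
  "tame_time f G \<gamma> a \<longleftrightarrow> (\<forall>q\<in>\<rat> \<inter> {0..1}. ennreal \<bar>f (\<gamma> q) - f (\<gamma> (clamp_time 0 1 a))\<bar>
     \<le> segment_integral G \<gamma> (min (clamp_time 0 1 a) q) (max (clamp_time 0 1 a) q))"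

text \<open>
  Each single time is tame for almost every curve; Fubini exchanges the two quantifiers.
\<close>

lemma AE_tame_time:
  fixes m :: "'a::polish_space measure"
  assumes wug: "weak_upper_gradient m f G" and f: "f \<in> borel_measurable borel" and m: "sets m = sets borel"
    and \<pi>: "test_plan m \<pi>"
  shows "AE \<gamma> in \<pi>. (\<forall>a\<in>\<rat> \<inter> {0..1}. tame_time f G \<gamma> a) \<and> (AE a in lborel. tame_time f G \<gamma> a)"
proof -
  interpret prob_space \<pi> by (rule test_plan_sets(3)[OF \<pi>])
  interpret P: pair_sigma_finite \<pi> lborel ..
  let ?Q = "\<rat> \<inter> {0..1} :: real set"
  let ?B = "borel_curves :: (real \<Rightarrow> 'a) measure"
  have Q: "countable ?Q" by (intro countable_Int1 countable_rat)
  have G: "G \<in> Lp m 2" using wug by (simp add: weak_upper_gradient_def)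
  have Gm: "G \<in> borel_measurable borel" using Lp2_nn_integral[OF m G] by auto
  have pt: "AE \<gamma> in \<pi>. tame_time f G \<gamma> a" for a
    unfolding tame_time_def
  proof (rule AE_ball_countable'[OF _ Q])
    fix q assume q: "q \<in> ?Q"
    let ?a = "clamp_time 0 1 a"
    have a: "?a \<in> {0..1}" using clamp_time_in[of 0 1 a] by simp
    have mm: "0 \<le> min ?a q" "min ?a q \<le> max ?a q" "max ?a q \<le> 1" using a q by auto
    from weak_upper_gradient_along_paths[OF wug f m \<pi> this]
    show "AE \<gamma> in \<pi>. ennreal \<bar>f (\<gamma> q) - f (\<gamma> ?a)\<bar> \<le> segment_integral G \<gamma> (min ?a q) (max ?a q)"
    proof eventually_elim
      case (elim \<gamma>)
      then show ?case
        unfolding path_integral_def nn_integral_stopped(1)[OF mm] segment_integral_def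
        by (cases "?a \<le> q") (auto simp: min_def max_def abs_minus_commute)
    qed
  qed
  have sets_eq: "sets (\<pi> \<Otimes>\<^sub>M lborel) = sets (?B \<Otimes>\<^sub>M borel)"
    by (intro sets_pair_measure_cong test_plan_sets(1)[OF \<pi>]) auto
  have meas: "{p \<in> space (\<pi> \<Otimes>\<^sub>M lborel). tame_time f G (fst p) (snd p)} \<in> sets (\<pi> \<Otimes>\<^sub>M lborel)"
    unfolding sets_eq_imp_space_eq[OF sets_eq] sets_eq tame_time_def
  proof (rule sets.sets_Collect_countable_All'[OF _ Q])
    fix q assume q: "q \<in> ?Q"
    have ev: "(\<lambda>p. (fst p) (clamp_time 0 1 (snd p))) \<in> borel_measurable (?B \<Otimes>\<^sub>M (borel :: real measure))"
      by (rule measurable_eval_pair)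
    have evq: "(\<lambda>p. (fst p) q) \<in> borel_measurable (?B \<Otimes>\<^sub>M (borel :: real measure))"
      using measurable_compose[OF measurable_fst measurable_eval[of q]] q by auto
    have 1: "(\<lambda>p. ennreal \<bar>f (fst p q) - f (fst p (clamp_time 0 1 (snd p)))\<bar>) \<in> borel_measurable (?B \<Otimes>\<^sub>M (borel :: real measure))"
      using measurable_compose[OF ev f] measurable_compose[OF evq f] by measurable
    have 2: "(\<lambda>p. segment_integral G (fst p) (min (clamp_time 0 1 (snd p)) q) (max (clamp_time 0 1 (snd p)) q))
        \<in> borel_measurable (?B \<Otimes>\<^sub>M (borel :: real measure))"
      unfolding segment_integral_def
    proof (rule lborel.borel_measurable_nn_integral)
      have eq: "sets ((?B \<Otimes>\<^sub>M (borel :: real measure)) \<Otimes>\<^sub>M lborel) = sets ((?B \<Otimes>\<^sub>M (borel :: real measure)) \<Otimes>\<^sub>M (borel :: real measure))"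
        by (intro sets_pair_measure_cong) auto
      have "(\<lambda>z. (fst (fst z), snd z)) \<in> (?B \<Otimes>\<^sub>M (borel :: real measure)) \<Otimes>\<^sub>M (borel :: real measure) \<rightarrow>\<^sub>M ?B \<Otimes>\<^sub>M borel"
        by measurable
      from measurable_compose[OF this measurable_eval_times_speed[OF Gm]]
      have [measurable]: "(\<lambda>z. ennreal (G (fst (fst z) (snd z))) * speed_pair (fst (fst z), snd z))
        \<in> borel_measurable ((?B \<Otimes>\<^sub>M (borel :: real measure)) \<Otimes>\<^sub>M (borel :: real measure))" by simp
      have "(\<lambda>z. if min (clamp_time 0 1 (snd (fst z))) q \<le> snd z \<and> snd z \<le> max (clamp_time 0 1 (snd (fst z))) q
          then ennreal (G (fst (fst z) (snd z))) * speed_pair (fst (fst z), snd z) else 0)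
        \<in> borel_measurable ((?B \<Otimes>\<^sub>M (borel :: real measure)) \<Otimes>\<^sub>M (borel :: real measure))"
        by measurable
      also have "(\<lambda>z. if min (clamp_time 0 1 (snd (fst z))) q \<le> snd z \<and> snd z \<le> max (clamp_time 0 1 (snd (fst z))) q
          then ennreal (G (fst (fst z) (snd z))) * speed_pair (fst (fst z), snd z) else 0)
        = (\<lambda>(p, t). ennreal (G (fst p t)) * speed_pair (fst p, t) *
            indicator {min (clamp_time 0 1 (snd p)) q..max (clamp_time 0 1 (snd p)) q} t)"
        by (auto simp: fun_eq_iff split: split_indicator)
      finally show "(\<lambda>(p, t). ennreal (G (fst p t)) * speed_pair (fst p, t) *
            indicator {min (clamp_time 0 1 (snd p)) q..max (clamp_time 0 1 (snd p)) q} t)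
          \<in> borel_measurable ((?B \<Otimes>\<^sub>M (borel :: real measure)) \<Otimes>\<^sub>M lborel)"
        unfolding measurable_cong_sets[OF eq refl] .
    qed
    show "{p \<in> space (?B \<Otimes>\<^sub>M borel). ennreal \<bar>f (fst p q) - f (fst p (clamp_time 0 1 (snd p)))\<bar>
        \<le> segment_integral G (fst p) (min (clamp_time 0 1 (snd p)) q) (max (clamp_time 0 1 (snd p)) q)}
      \<in> sets (?B \<Otimes>\<^sub>M borel)"
      by (rule borel_measurable_le[OF 1 2])
  qed
  have "AE \<gamma> in \<pi>. AE a in lborel. tame_time f G \<gamma> a"
    using P.AE_commute[of "tame_time f G"] meas pt by simp
  moreover have "AE \<gamma> in \<pi>. \<forall>a\<in>?Q. tame_time f G \<gamma> a"
    using pt by (intro AE_ball_countable'[OF _ Q])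
  ultimately show ?thesis by eventually_elim simp
qed

lemma tame_path_increment:
  fixes \<gamma> :: "real \<Rightarrow> 'a::polish_space"
  assumes \<gamma>: "\<gamma> \<in> space borel_curves" and G: "G \<in> borel_measurable borel"
    and fin: "path_integral G \<gamma> < \<infinity>"
    and g: "g = (\<lambda>t. enn2real (ennreal (G (\<gamma> t)) * speed_pair (\<gamma>, t)))"
  shows "integrable lborel g" and "\<And>t. 0 \<le> g t"
    and "\<And>s t. \<lbrakk>s \<in> {0..1}; t \<in> {0..1}; s \<le> t; tame_time f G \<gamma> s; tame_time f G \<gamma> t\<rbrakk>
      \<Longrightarrow> \<bar>f (\<gamma> t) - f (\<gamma> s)\<bar> \<le> (LINT r:{s..t}|lborel. g r)"
proof -
  let ?h = "\<lambda>t. ennreal (G (\<gamma> t)) * speed_pair (\<gamma>, t)"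
  have hm [measurable]: "?h \<in> borel_measurable borel" by (rule measurable_eval_speed_section[OF \<gamma> G])
  have "AE t in lborel. ?h t \<noteq> \<infinity>"
    using fin by (intro nn_integral_PInf_AE) (auto simp: path_integral_def)
  then have gh: "AE t in lborel. ennreal (g t) = ?h t"
    by eventually_elim (simp add: g less_top)
  show g0: "0 \<le> g t" for t by (simp add: g)
  show gi: "integrable lborel g"
  proof (rule integrableI_nonneg)
    show "g \<in> borel_measurable lborel" unfolding g by measurable
    show "(\<integral>\<^sup>+t. ennreal (g t) \<partial>lborel) < \<infinity>"
      using fin nn_integral_cong_AE[OF gh] by (simp add: path_integral_def)
  qed (simp add: g)
  have seg: "segment_integral G \<gamma> s t = ennreal (LINT r:{s..t}|lborel. g r)" for s t
  proof -
    have "segment_integral G \<gamma> s t = (\<integral>\<^sup>+r. ennreal (indicator {s..t} r * g r) \<partial>lborel)"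
      unfolding segment_integral_def
    proof (rule nn_integral_cong_AE)
      show "AE r in lborel. ?h r * indicator {s..t} r = ennreal (indicator {s..t} r * g r)"
        using gh by eventually_elim (auto split: split_indicator)
    qed
    also have "\<dots> = ennreal (LINT r:{s..t}|lborel. g r)"
      unfolding set_lebesgue_integral_def using integrable_indicator_times[OF gi, of "{s..t}"] g0
      by (subst nn_integral_eq_integral) auto
    finally show ?thesis .
  qed
  have nn: "0 \<le> (LINT r:{s..t}|lborel. g r)" for s t
    using g0 by (simp add: set_lebesgue_integral_def)
  fix s t :: real assume st: "s \<in> {0..1}" "t \<in> {0..1}" "s \<le> t" "tame_time f G \<gamma> s" "tame_time f G \<gamma> t"
  show "\<bar>f (\<gamma> t) - f (\<gamma> s)\<bar> \<le> (LINT r:{s..t}|lborel. g r)"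
  proof (cases "s = t")
    case False
    then obtain q where q: "q \<in> \<rat>" "s < q" "q < t" using Rats_dense_in_real[of s t] st(3) by auto
    have q01: "q \<in> \<rat> \<inter> {0..1}" using q st by auto
    have "ennreal \<bar>f (\<gamma> q) - f (\<gamma> s)\<bar> \<le> segment_integral G \<gamma> s q"
      using st(4)[unfolded tame_time_def, rule_format, OF q01] st(1) q by simp
    then have 1: "\<bar>f (\<gamma> q) - f (\<gamma> s)\<bar> \<le> (LINT r:{s..q}|lborel. g r)"
      using nn by (simp add: seg ennreal_le_iff)
    have "ennreal \<bar>f (\<gamma> q) - f (\<gamma> t)\<bar> \<le> segment_integral G \<gamma> q t"
      using st(5)[unfolded tame_time_def, rule_format, OF q01] st(2) q by simp
    then have 2: "\<bar>f (\<gamma> q) - f (\<gamma> t)\<bar> \<le> (LINT r:{q..t}|lborel. g r)"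
      using nn by (simp add: seg ennreal_le_iff)
    have "(LINT r:{s..t}|lborel. g r) = (LINT r:{s..q}|lborel. g r) + (LINT r:{q..t}|lborel. g r)"
      using q by (intro set_integral_split[OF gi]) auto
    then show ?thesis using 1 2 by linarith
  qed (use nn[of t t] in simp)
qed

text \<open>
  The source of both the existence of minimal weak upper gradients (the case \<open>f1 = f2\<close>) and their locality.
  Along almost every curve the increments of \<open>f1\<close> and \<open>f2\<close> between tame times are controlled by the
  integrals of \<open>G1\<close> and \<open>G2\<close> times the speed, and almost every time is tame, so that the coincidence of
  \<open>f1\<close> and \<open>f2\<close> may be exploited one curve at a time.
\<close>

lemma weak_upper_gradient_localize:
  fixes m :: "'a::polish_space measure"
  assumes m: "sets m = sets borel"
    and w1: "weak_upper_gradient m f1 G1" and f1: "f1 \<in> borel_measurable borel"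
    and w2: "weak_upper_gradient m f2 G2" and f2: "f2 \<in> borel_measurable borel"
  shows "weak_upper_gradient m f1 (\<lambda>x. if f1 x = f2 x then min (G1 x) (G2 x) else G1 x)" (is "weak_upper_gradient m f1 ?G")
  unfolding weak_upper_gradient_iff
proof (intro conjI allI impI)
  have G1: "G1 \<in> Lp m 2" "\<And>x. 0 \<le> G1 x" and G2: "G2 \<in> Lp m 2" "\<And>x. 0 \<le> G2 x"
    using w1 w2 by (auto simp: weak_upper_gradient_def)
  have Gm [measurable]: "G1 \<in> borel_measurable borel" "G2 \<in> borel_measurable borel"
    using Lp2_nn_integral[OF m] G1 G2 by auto
  note f1 [measurable] f2 [measurable]
  have GGm [measurable]: "?G \<in> borel_measurable borel" by measurable
  show "?G \<in> Lp m 2"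
    using G1(2) G2(2) by (intro Lp2_mono[OF m G1(1)] GGm) (auto simp: min_def)
  show "0 \<le> ?G x" for x using G1(2) G2(2) by simp
  fix \<pi> assume \<pi>: "test_plan m \<pi>"
  have fin: "AE \<gamma> in \<pi>. path_integral G \<gamma> \<noteq> \<infinity>" if "G \<in> Lp m 2" for G
    using path_integral_finite[OF \<pi> m that] measurable_path_integral Lp2_nn_integral(1)[OF m that]
    by (intro nn_integral_PInf_AE) (auto simp: plan_measurable[OF \<pi>])
  have "AE \<gamma> in \<pi>. ennreal \<bar>f1 (\<gamma> 1) - f1 (\<gamma> 0)\<bar> \<le> path_integral ?G \<gamma>"
    using AE_tame_time[OF w1 f1 m \<pi>] AE_tame_time[OF w2 f2 m \<pi>] fin[OF G1(1)] fin[OF G2(1)] test_plan_AE[OF \<pi>]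
  proof eventually_elim
    case (elim \<gamma>)
    have \<gamma>: "\<gamma> \<in> space borel_curves" using elim by simp
    define g1 where "g1 = (\<lambda>t. enn2real (ennreal (G1 (\<gamma> t)) * speed_pair (\<gamma>, t)))"
    define g2 where "g2 = (\<lambda>t. enn2real (ennreal (G2 (\<gamma> t)) * speed_pair (\<gamma>, t)))"
    have fin1: "path_integral G1 \<gamma> < \<infinity>" and fin2: "path_integral G2 \<gamma> < \<infinity>" using elim by (auto simp: less_top)
    note t1 = tame_path_increment[OF \<gamma> Gm(1) fin1 g1_def]
    note t2 = tame_path_increment[OF \<gamma> Gm(2) fin2 g2_def]
    have "AE t in lborel. tame_time f1 G1 \<gamma> t \<and> tame_time f2 G2 \<gamma> t" using elim by auto
    then obtain N where N: "{t \<in> space lborel. \<not> (tame_time f1 G1 \<gamma> t \<and> tame_time f2 G2 \<gamma> t)} \<subseteq> N"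
      "emeasure lborel N = 0" "N \<in> sets lborel" by (rule AE_E)
    define D where "D = {t \<in> {0..1}. tame_time f1 G1 \<gamma> t \<and> tame_time f2 G2 \<gamma> t}"
    define A where "A = {t \<in> {0..1}. f1 (\<gamma> (clamp_time 0 1 t)) = f2 (\<gamma> (clamp_time 0 1 t)) \<and>
      G2 (\<gamma> (clamp_time 0 1 t)) < G1 (\<gamma> (clamp_time 0 1 t))} - N"
    have [measurable]: "(\<lambda>t. \<gamma> (clamp_time 0 1 t)) \<in> borel_measurable borel"
      using measurable_curve_section[OF \<gamma>] measurable_Pair2[OF measurable_eval_pair \<gamma>] by simp
    have Nb: "N \<in> sets borel" using N(3) by simp
    have "{t \<in> space borel. t \<in> {0..1} \<and> f1 (\<gamma> (clamp_time 0 1 t)) = f2 (\<gamma> (clamp_time 0 1 t)) \<and>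
      G2 (\<gamma> (clamp_time 0 1 t)) < G1 (\<gamma> (clamp_time 0 1 t))} \<in> sets borel" by measurable
    then have Ab: "A \<in> sets borel" unfolding A_def using Nb by (intro sets.Diff) auto
    have AD: "A \<subseteq> D" using N(1) by (auto simp: A_def D_def)
    have "\<bar>f1 (\<gamma> 1) - f1 (\<gamma> 0)\<bar> \<le> (LINT t:{0..1}|lborel. if t \<in> A then g2 t else g1 t)"
    proof (rule increment_le_on_coincidence_set[OF t1(1,2) t2(1,2), of D])
      show "\<rat> \<inter> {0..1} \<subseteq> D" using elim by (auto simp: D_def)
      show "D \<subseteq> {0..1}" by (auto simp: D_def)
      show "f1 (\<gamma> t) = f2 (\<gamma> t)" if "t \<in> A" for t using that by (auto simp: A_def)
    qed (use Ab AD t1(3) t2(3) in \<open>auto simp: D_def\<close>)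
    also have "\<dots> = (LINT t|lborel. indicator {0..1} t * (if t \<in> A then g2 t else g1 t))"
      by (simp add: set_lebesgue_integral_def)
    finally have "ennreal \<bar>f1 (\<gamma> 1) - f1 (\<gamma> 0)\<bar> \<le> ennreal (LINT t|lborel. indicator {0..1} t * (if t \<in> A then g2 t else g1 t))"
      by (rule ennreal_leI)
    also have "\<dots> = (\<integral>\<^sup>+t. ennreal (indicator {0..1} t * (if t \<in> A then g2 t else g1 t)) \<partial>lborel)"
    proof (rule nn_integral_eq_integral[symmetric])
      have "(\<lambda>t. if t \<in> A then g2 t else g1 t) = (\<lambda>t. indicator A t * g2 t + indicator (- A) t * g1 t)"
        by (auto split: split_indicator)
      then have "integrable lborel (\<lambda>t. if t \<in> A then g2 t else g1 t)"
        using Ab by (simp only:) (intro Bochner_Integration.integrable_add integrable_indicator_times t1 t2, auto)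
      then show "integrable lborel (\<lambda>t. indicator {0..1} t * (if t \<in> A then g2 t else g1 t))"
        by (rule integrable_indicator_times) auto
      show "AE t in lborel. 0 \<le> indicator {0..1} t * (if t \<in> A then g2 t else g1 t)"
        using t1(2) t2(2) by simp
    qed
    also have "\<dots> \<le> path_integral ?G \<gamma>"
      unfolding path_integral_def
    proof (rule nn_integral_mono_AE)
      have "AE t in lborel. t \<notin> N" using N by (intro AE_not_in) auto
      then show "AE t in lborel. ennreal (indicator {0..1} t * (if t \<in> A then g2 t else g1 t))
          \<le> ennreal (?G (\<gamma> t)) * speed_pair (\<gamma>, t)"
      proof eventually_elim
        case (elim t)
        have le: "ennreal (enn2real x) \<le> x" for x by (cases x) auto
        show ?case
        proof (cases "t \<in> {0..1}")
          case True
          then have "(if t \<in> A then g2 t else g1 t) = enn2real (ennreal (?G (\<gamma> t)) * speed_pair (\<gamma>, t))"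
            using elim by (auto simp: A_def g1_def g2_def min_def)
          then show ?thesis using True le by simp
        qed simp
      qed
    qed
    finally show ?case .
  qed
  then show "(\<integral>\<^sup>+\<gamma>. ennreal \<bar>f1 (\<gamma> 1) - f1 (\<gamma> 0)\<bar> \<partial>\<pi>) \<le> (\<integral>\<^sup>+\<gamma>. path_integral ?G \<gamma> \<partial>\<pi>)"
    by (rule nn_integral_mono_AE)
qed

section \<open>Minimal weak upper gradients and locality\<close>

text \<open>
  Dominated convergence, first in time along almost every curve and then over the plan, both dominated by
  the first term of the sequence.
\<close>

lemma weak_upper_gradient_limit:
  fixes m :: "'a::polish_space measure"
  assumes m: "sets m = sets borel" and w: "\<And>n. weak_upper_gradient m f (H n)"
    and dec: "\<And>n x. H (Suc n) x \<le> H n x" and lim: "\<And>x. (\<lambda>n. H n x) \<longlonglongrightarrow> G x"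
  shows "weak_upper_gradient m f G"
  unfolding weak_upper_gradient_iff
proof (intro conjI allI impI)
  have H: "H n \<in> Lp m 2" "0 \<le> H n x" for n x using w[of n] by (auto simp: weak_upper_gradient_def)
  have Hm: "H n \<in> borel_measurable borel" for n using Lp2_nn_integral(1)[OF m H(1)] .
  have Gm: "G \<in> borel_measurable borel" by (rule borel_measurable_LIMSEQ_real[OF lim Hm])
  have decs: "decseq (\<lambda>n. H n x)" for x using dec by (intro decseq_SucI)
  have H0: "H n x \<le> H 0 x" for n x using decseqD[OF decs, of 0 n] by simp
  have G0: "0 \<le> G x" for x using lim[of x] H(2) by (intro LIMSEQ_le_const) auto
  have GH: "G x \<le> H 0 x" for x using lim[of x] H0 by (intro LIMSEQ_le_const2) auto
  show "0 \<le> G x" for x by (rule G0)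
  show "G \<in> Lp m 2" using G0 GH H(2) by (intro Lp2_mono[OF m H(1)[of 0] Gm]) auto
  fix \<pi> assume \<pi>: "test_plan m \<pi>"
  have fin0: "(\<integral>\<^sup>+\<gamma>. path_integral (H 0) \<gamma> \<partial>\<pi>) < \<infinity>" by (rule path_integral_finite[OF \<pi> m H(1)])
  have pm: "path_integral F \<in> borel_measurable \<pi>" if "F \<in> borel_measurable borel" for F
    using measurable_path_integral[OF that] by (simp add: plan_measurable[OF \<pi>])
  have mono: "path_integral (H n) \<gamma> \<le> path_integral (H 0) \<gamma>" for n \<gamma>
    unfolding path_integral_def using H0 by (intro nn_integral_mono mult_right_mono ennreal_leI) auto
  have "(\<lambda>n. \<integral>\<^sup>+\<gamma>. path_integral (H n) \<gamma> \<partial>\<pi>) \<longlonglongrightarrow> (\<integral>\<^sup>+\<gamma>. path_integral G \<gamma> \<partial>\<pi>)"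
  proof (rule nn_integral_dominated_convergence[where w = "path_integral (H 0)"])
    show "AE \<gamma> in \<pi>. path_integral (H n) \<gamma> \<le> path_integral (H 0) \<gamma>" for n using mono by simp
    have "AE \<gamma> in \<pi>. path_integral (H 0) \<gamma> \<noteq> \<infinity>"
      using fin0 pm[OF Hm] by (intro nn_integral_PInf_AE) auto
    then show "AE \<gamma> in \<pi>. (\<lambda>n. path_integral (H n) \<gamma>) \<longlonglongrightarrow> path_integral G \<gamma>"
      using test_plan_AE[OF \<pi>]
    proof eventually_elim
      case (elim \<gamma>)
      then have \<gamma>: "\<gamma> \<in> space borel_curves" "finite_energy \<gamma>" by auto
      show ?case
        unfolding path_integral_def
      proof (rule nn_integral_dominated_convergence[where w = "\<lambda>t. ennreal (H 0 (\<gamma> t)) * speed_pair (\<gamma>, t)"])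
        show "(\<lambda>t. ennreal (H n (\<gamma> t)) * speed_pair (\<gamma>, t)) \<in> borel_measurable lborel" for n
          using measurable_eval_speed_section[OF \<gamma>(1) Hm] by simp
        show "(\<lambda>t. ennreal (G (\<gamma> t)) * speed_pair (\<gamma>, t)) \<in> borel_measurable lborel"
          using measurable_eval_speed_section[OF \<gamma>(1) Gm] by simp
        then show "(\<lambda>t. ennreal (H 0 (\<gamma> t)) * speed_pair (\<gamma>, t)) \<in> borel_measurable lborel"
          using measurable_eval_speed_section[OF \<gamma>(1) Hm] by simp
        show "AE t in lborel. ennreal (H n (\<gamma> t)) * speed_pair (\<gamma>, t) \<le> ennreal (H 0 (\<gamma> t)) * speed_pair (\<gamma>, t)" for n
          using H0 by (intro AE_I2 mult_right_mono ennreal_leI) auto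
        show "(\<integral>\<^sup>+t. ennreal (H 0 (\<gamma> t)) * speed_pair (\<gamma>, t) \<partial>lborel) < \<infinity>"
          using elim by (simp add: path_integral_def less_top)
        show "AE t in lborel. (\<lambda>n. ennreal (H n (\<gamma> t)) * speed_pair (\<gamma>, t)) \<longlonglongrightarrow> ennreal (G (\<gamma> t)) * speed_pair (\<gamma>, t)"
          using finite_energy_speed_finite[OF \<gamma>]
        proof eventually_elim
          case (elim t)
          then show ?case
            by (intro tendsto_mult_ennreal tendsto_ennrealI lim tendsto_const) auto
        qed
      qed
    qed
  qed (use pm Hm Gm fin0 in auto)
  moreover have "(\<integral>\<^sup>+\<gamma>. ennreal \<bar>f (\<gamma> 1) - f (\<gamma> 0)\<bar> \<partial>\<pi>) \<le> (\<integral>\<^sup>+\<gamma>. path_integral (H n) \<gamma> \<partial>\<pi>)" for n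
    using w[of n] \<pi> by (simp add: weak_upper_gradient_iff)
  ultimately show "(\<integral>\<^sup>+\<gamma>. ennreal \<bar>f (\<gamma> 1) - f (\<gamma> 0)\<bar> \<partial>\<pi>) \<le> (\<integral>\<^sup>+\<gamma>. path_integral G \<gamma> \<partial>\<pi>)"
    by (intro LIMSEQ_le_const) auto
qed

lemma weak_upper_gradient_min:
  assumes "sets m = sets borel" "f \<in> borel_measurable borel"
    and "weak_upper_gradient m f G1" "weak_upper_gradient m f G2"
  shows "weak_upper_gradient m f (\<lambda>x. min (G1 x) (G2 x))"
  using weak_upper_gradient_localize[OF assms(1) assms(3,2) assms(4,2)] by simp

text \<open>
  Weak upper gradients are closed under minima and under decreasing limits. Hence one of them attains the
  least \<open>L\<^sup>2\<close> norm, and its minimum with another one cannot have a smaller norm.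
\<close>

lemma minimal_weak_upper_gradient_exists:
  fixes m :: "'a::polish_space measure"
  assumes m: "sets m = sets borel" and f: "f \<in> S2 m"
  shows "\<exists>G. weak_upper_gradient m f G \<and> (\<forall>G'. weak_upper_gradient m f G' \<longrightarrow> (AE x in m. G x \<le> G' x))"
proof -
  have fm: "f \<in> borel_measurable borel" using f by (simp add: S2_def measurable_cong_sets[OF m refl])
  define J where "J G = (\<integral>\<^sup>+x. ennreal ((G x)\<^sup>2) \<partial>m)" for G :: "'a \<Rightarrow> real"
  let ?S = "{G. weak_upper_gradient m f G}"
  obtain G0 where G0: "weak_upper_gradient m f G0" using f by (auto simp: S2_def)
  have Lp: "G \<in> Lp m 2" and nn: "\<And>x. 0 \<le> G x" and Gm: "G \<in> borel_measurable borel" and Jfin: "J G < \<infinity>"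
    if "weak_upper_gradient m f G" for G
    using that Lp2_nn_integral[OF m, of G] by (auto simp: weak_upper_gradient_def J_def)
  define I where "I = (INF G\<in>?S. J G)"
  have IJ: "I \<le> J G" if "weak_upper_gradient m f G" for G using that by (auto simp: I_def intro: INF_lower)
  have Ifin: "I < \<infinity>" using IJ[OF G0] Jfin[OF G0] by (rule le_less_trans)
  have "\<exists>G. weak_upper_gradient m f G \<and> J G < I + ennreal (1 / real (Suc n))" for n
  proof -
    have "I < I + ennreal (1 / real (Suc n))"
      using Ifin by (cases I) (auto simp: ennreal_plus[symmetric] ennreal_less_iff simp del: ennreal_plus)
    then show ?thesis unfolding I_def by (auto simp: INF_less_iff)
  qed
  then obtain g where g: "\<And>n. weak_upper_gradient m f (g n)" "\<And>n. J (g n) < I + ennreal (1 / real (Suc n))"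
    by metis
  define H where "H n x = rec_nat (g 0 x) (\<lambda>n h. min h (g (Suc n) x)) n" for n x
  have HS: "H (Suc n) = (\<lambda>x. min (H n x) (g (Suc n) x))" "H 0 = g 0" for n by (simp_all add: H_def fun_eq_iff)
  have Hw: "weak_upper_gradient m f (H n)" for n
    by (induction n) (simp_all only: HS, rule g, intro weak_upper_gradient_min[OF m fm] g)
  have Hg: "H n x \<le> g n x" for n x by (cases n) (simp_all add: HS)
  have Hdec: "H (Suc n) x \<le> H n x" for n x by (simp add: HS)
  define G where "G x = (INF n. H n x)" for x
  have lim: "(\<lambda>n. H n x) \<longlonglongrightarrow> G x" for x
    unfolding G_def using nn[OF Hw] Hdec
    by (intro LIMSEQ_decseq_INF decseq_SucI bdd_belowI[where m = 0]) auto
  have Gw: "weak_upper_gradient m f G" by (rule weak_upper_gradient_limit[OF m Hw Hdec lim])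
  have GH: "G x \<le> H n x" for x n
    unfolding G_def using nn[OF Hw] by (intro cINF_lower bdd_belowI[where m = 0]) auto
  have "J G \<le> I + ennreal (1 / real (Suc n))" for n
  proof -
    have "J G \<le> J (g n)"
      unfolding J_def using nn[OF Gw] order_trans[OF GH Hg]
      by (intro nn_integral_mono ennreal_leI power_mono) auto
    then show ?thesis using g(2)[of n] by simp
  qed
  moreover have "(\<lambda>n. I + ennreal (1 / real (Suc n))) \<longlonglongrightarrow> I + ennreal 0"
    by (intro tendsto_add tendsto_const tendsto_ennrealI LIMSEQ_Suc[OF lim_const_over_n])
  ultimately have JG: "J G \<le> I" by (intro LIMSEQ_le_const[of _ I]) auto
  have "AE x in m. G x \<le> G' x" if G': "weak_upper_gradient m f G'" for G'
  proof -
    let ?M = "\<lambda>x. min (G x) (G' x)"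
    have Mw: "weak_upper_gradient m f ?M" by (rule weak_upper_gradient_min[OF m fm Gw G'])
    have [measurable]: "G \<in> borel_measurable m" "?M \<in> borel_measurable m"
      using Gm[OF Gw] Gm[OF Mw] by (simp_all add: measurable_cong_sets[OF m refl])
    have le: "ennreal ((?M x)\<^sup>2) \<le> ennreal ((G x)\<^sup>2)" for x
      using nn[OF Mw, of x] by (intro ennreal_leI power_mono) auto
    have "(\<integral>\<^sup>+x. ennreal ((G x)\<^sup>2) - ennreal ((?M x)\<^sup>2) \<partial>m) = J G - J ?M"
      unfolding J_def using Jfin[OF Mw] le by (intro nn_integral_diff) (auto simp: J_def)
    also have "\<dots> = 0"
      using JG IJ[OF Mw] Jfin[OF Gw] by (subst diff_eq_0_iff_ennreal) auto
    finally have "AE x in m. ennreal ((G x)\<^sup>2) - ennreal ((?M x)\<^sup>2) = 0"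
      by (subst (asm) nn_integral_0_iff_AE) auto
    then show ?thesis
    proof eventually_elim
      case (elim x)
      then have "(G x)\<^sup>2 \<le> (?M x)\<^sup>2" by (simp add: diff_eq_0_iff_ennreal)
      then have "G x \<le> ?M x" using nn[OF Mw, of x] by (rule power2_le_imp_le)
      then show ?case by simp
    qed
  qed
  with Gw show ?thesis by blast
qed

lemma min_weak_ug:
  fixes m :: "'a::polish_space measure"
  assumes "sets m = sets borel" "f \<in> S2 m"
  shows "weak_upper_gradient m f (min_weak_ug m f)"
    and "weak_upper_gradient m f G' \<Longrightarrow> AE x in m. min_weak_ug m f x \<le> G' x"
  using someI_ex[OF minimal_weak_upper_gradient_exists[OF assms]] by (auto simp: min_weak_ug_def)

text \<open>
  Otherwise the gradient of one function could be lowered on \<open>{f = g}\<close> by that of the other,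
  contradicting minimality.
\<close>

lemma min_weak_ug_local:
  fixes m :: "'a::polish_space measure"
  assumes m: "sets m = sets borel" and f: "f \<in> S2 m" and g: "g \<in> S2 m"
  shows "AE x in m. f x = g x \<longrightarrow> min_weak_ug m f x = min_weak_ug m g x"
proof -
  have half: "AE x in m. f x = g x \<longrightarrow> min_weak_ug m f x \<le> min_weak_ug m g x" if f: "f \<in> S2 m" and g: "g \<in> S2 m" for f g
  proof -
    have "f \<in> borel_measurable borel" "g \<in> borel_measurable borel"
      using f g by (simp_all add: S2_def measurable_cong_sets[OF m refl])
    then have "weak_upper_gradient m f (\<lambda>x. if f x = g x then min (min_weak_ug m f x) (min_weak_ug m g x) else min_weak_ug m f x)"
      using min_weak_ug(1)[OF m] f g by (intro weak_upper_gradient_localize[OF m]) auto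
    from min_weak_ug(2)[OF m f this] show ?thesis by eventually_elim (auto split: if_splits)
  qed
  from half[OF f g] half[OF g f] show ?thesis by eventually_elim auto
qed

text \<open>
  The choice defining \<open>min_weak_ug_loc\<close> is satisfiable: on the shell of points at distance between \<open>n - 1\<close>
  and \<open>n\<close> from a base point, take the gradient of a function in \<open>S2 m\<close> that represents \<open>f\<close> on the
  ball of radius \<open>n\<close>. By locality every other representative has the same gradient.
\<close>

lemma min_weak_ug_loc:
  fixes m :: "'a::polish_space measure"
  assumes m: "sets m = sets borel" and f: "f \<in> S2_loc m"
    and B: "bounded B" and g: "g \<in> S2 m" and eq: "AE x in m. x \<in> B \<longrightarrow> f x = g x"
  shows "AE x in m. x \<in> B \<longrightarrow> min_weak_ug_loc m f x = min_weak_ug m g x"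
proof -
  obtain x0 :: 'a where True by blast
  have "\<forall>n::nat. \<exists>g\<in>S2 m. AE x in m. x \<in> cball x0 n \<longrightarrow> f x = g x"
    using f bounded_cball[of x0] unfolding S2_loc_def mem_Collect_eq by blast
  then obtain g' where g': "\<And>n::nat. g' n \<in> S2 m" "\<And>n::nat. AE x in m. x \<in> cball x0 n \<longrightarrow> f x = g' n x"
    by metis
  define N where "N x = nat \<lceil>dist x0 x\<rceil>" for x
  have inN: "x \<in> cball x0 (real (N x))" for x by (simp add: N_def)
  have [measurable]: "N \<in> borel \<rightarrow>\<^sub>M count_space UNIV" unfolding N_def by measurable
  have "(\<lambda>x. min_weak_ug m (g' (N x)) x) \<in> borel_measurable borel"
  proof (rule measurable_compose_countable[where f = "\<lambda>n x. min_weak_ug m (g' n) x"])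
    show "(\<lambda>x. min_weak_ug m (g' n) x) \<in> borel_measurable borel" for n
      using min_weak_ug(1)[OF m g'(1)[of n]] Lp2_nn_integral(1)[OF m] by (auto simp: weak_upper_gradient_def)
  qed measurable
  then have meas: "(\<lambda>x. min_weak_ug m (g' (N x)) x) \<in> borel_measurable m"
    by (simp add: measurable_cong_sets[OF m refl])
  have "AE x in m. x \<in> B' \<longrightarrow> min_weak_ug m (g' (N x)) x = min_weak_ug m k x"
    if k: "k \<in> S2 m" and eqk: "AE x in m. x \<in> B' \<longrightarrow> f x = k x" for B' k
  proof -
    have "AE x in m. \<forall>n. (x \<in> cball x0 n \<longrightarrow> f x = g' n x) \<and> (g' n x = k x \<longrightarrow> min_weak_ug m (g' n) x = min_weak_ug m k x)"
      using g'(2) min_weak_ug_local[OF m g'(1) k] by (simp add: AE_all_countable AE_conj_iff)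
    with eqk show ?thesis
    proof eventually_elim
      case (elim x)
      then show ?case using inN[of x] by metis
    qed
  qed
  then have "\<exists>G. G \<in> borel_measurable m \<and>
        (\<forall>B. \<forall>g\<in>S2 m. bounded B \<longrightarrow> (AE x in m. x \<in> B \<longrightarrow> f x = g x) \<longrightarrow>
           (AE x in m. x \<in> B \<longrightarrow> G x = min_weak_ug m g x))"
    using meas by (intro exI[of _ "\<lambda>x. min_weak_ug m (g' (N x)) x"]) auto
  from someI_ex[OF this] B g eq show ?thesis by (simp add: min_weak_ug_loc_def)
qed

lemma weak_upper_gradient_of_lipschitz:
  fixes m :: "'a::polish_space measure"
  assumes m: "sets m = sets borel" and g: "L-lipschitz_on UNIV g" and G: "G \<in> Lp m 2" "\<And>x. 0 \<le> G x"
    and loc: "\<And>x e. 0 < e \<Longrightarrow> \<forall>\<^sub>F y in at x. \<bar>g y - g x\<bar> \<le> (G x + e) * dist y x"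
  shows "weak_upper_gradient m g G"
  unfolding weak_upper_gradient_iff
proof (intro conjI allI impI G)
  fix \<pi> assume \<pi>: "test_plan m \<pi>"
  show "(\<integral>\<^sup>+\<gamma>. ennreal \<bar>g (\<gamma> 1) - g (\<gamma> 0)\<bar> \<partial>\<pi>) \<le> (\<integral>\<^sup>+\<gamma>. path_integral G \<gamma> \<partial>\<pi>)"
  proof (rule nn_integral_mono_AE)
    show "AE \<gamma> in \<pi>. ennreal \<bar>g (\<gamma> 1) - g (\<gamma> 0)\<bar> \<le> path_integral G \<gamma>"
      using test_plan_AE[OF \<pi>]
    proof eventually_elim
      case (elim \<gamma>)
      then show ?case unfolding path_integral_def
        by (intro lipschitz_increment_along_curve[OF _ _ _ g Lp2_nn_integral(1)[OF m G(1)] G(2) loc]) auto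
    qed
  qed
qed

text \<open>
  Cut \<open>u\<close> off outside a ball. The product \<open>g\<close> is Lipschitz with bounded support, so the function equal to
  (a truncation of) \<open>R\<close> on the ball, to the Lipschitz constant of \<open>g\<close> on the rest of the support and to
  \<open>0\<close> elsewhere lies in \<open>L\<^sup>2\<close> and dominates the slope of \<open>g\<close> everywhere.
\<close>

lemma locally_lipschitz_gradient_bound:
  fixes m :: "'a::polish_space measure" and u R :: "'a \<Rightarrow> real"
  assumes m: "metric_measure_space m"
    and lip: "\<And>B. bounded B \<Longrightarrow> \<exists>L\<ge>0. \<forall>x\<in>B. \<forall>y\<in>B. \<bar>u x - u y\<bar> \<le> L * dist x y"
    and R: "R \<in> borel_measurable borel" "\<And>x. 0 \<le> R x"
    and loc: "\<And>x e. 0 < e \<Longrightarrow> \<forall>\<^sub>F y in at x. \<bar>u y - u x\<bar> \<le> (R x + e) * dist y x"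
  shows "u \<in> S2_loc m" and "AE x in m. 0 \<le> min_weak_ug_loc m u x \<and> min_weak_ug_loc m u x \<le> R x"
proof -
  have sets: "sets m = sets borel" using m by (simp add: metric_measure_space_def)
  obtain x0 :: 'a where True by blast
  have "\<exists>g\<in>S2 m. (\<forall>x\<in>ball x0 r. g x = u x) \<and> (AE x in m. x \<in> ball x0 r \<longrightarrow> min_weak_ug m g x \<le> R x)" if r: "0 < r" for r
  proof -
    define \<eta> where "\<eta> x = max 0 (min 1 (r + 1 - dist x0 x))" for x
    have \<eta>: "0 \<le> \<eta> x" "\<eta> x \<le> 1" for x by (auto simp: \<eta>_def)
    have \<eta>lip: "\<bar>\<eta> x - \<eta> y\<bar> \<le> dist x y" for x y
      using dist_triangle[of x0 x y] dist_triangle[of x0 y x]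
      by (auto simp: \<eta>_def dist_commute max_def min_def abs_le_iff)
    let ?B = "cball x0 (r + 1)"
    obtain L where L: "0 \<le> L" "\<And>x y. \<lbrakk>x \<in> ?B; y \<in> ?B\<rbrakk> \<Longrightarrow> \<bar>u x - u y\<bar> \<le> L * dist x y"
      using lip[OF bounded_cball[of x0 "r + 1"]] by blast
    define M where "M = \<bar>u x0\<bar> + L * (r + 1)"
    have M0: "0 \<le> M" using L r by (simp add: M_def)
    have uM: "\<bar>u x\<bar> \<le> M" if "x \<in> ?B" for x
    proof -
      have "\<bar>u x - u x0\<bar> \<le> L * dist x x0" using that r by (intro L) auto
      also have "\<dots> \<le> L * (r + 1)" using that L by (intro mult_left_mono) (auto simp: dist_commute)
      finally show ?thesis by (simp add: M_def)
    qed
    define g where "g x = u x * \<eta> x" for x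
    have out: "\<eta> x = 0" if "x \<notin> ?B" for x using that by (auto simp: \<eta>_def)
    have one: "\<bar>g x - g y\<bar> \<le> (L + M) * dist x y" if x: "x \<in> ?B" for x y
    proof (cases "y \<in> ?B")
      case True
      have "g x - g y = u x * (\<eta> x - \<eta> y) + (u x - u y) * \<eta> y" by (simp add: g_def algebra_simps)
      then have "\<bar>g x - g y\<bar> \<le> \<bar>u x\<bar> * \<bar>\<eta> x - \<eta> y\<bar> + \<bar>u x - u y\<bar> * \<eta> y"
        using \<eta>(1)[of y] by (metis abs_mult abs_of_nonneg abs_triangle_ineq)
      also have "\<dots> \<le> M * dist x y + (L * dist x y) * 1"
        using uM[OF x] \<eta>lip[of x y] L(2)[OF x True] \<eta>[of y] M0 L(1) by (intro add_mono mult_mono) auto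
      finally show ?thesis by (simp add: algebra_simps)
    next
      case False
      then have "\<bar>g x - g y\<bar> = \<bar>u x\<bar> * \<bar>\<eta> x - \<eta> y\<bar>" using \<eta>(1)[of x] by (simp add: g_def out abs_mult)
      also have "\<dots> \<le> M * dist x y" using uM[OF x] \<eta>lip[of x y] M0 by (intro mult_mono) auto
      also have "\<dots> \<le> (L + M) * dist x y" using L(1) by (intro mult_right_mono) auto
      finally show ?thesis .
    qed
    have glip: "(L + M)-lipschitz_on UNIV g"
    proof (rule lipschitz_onI)
      fix x y
      show "dist (g x) (g y) \<le> (L + M) * dist x y"
      proof (cases "x \<in> ?B \<or> y \<in> ?B")
        case True
        then show ?thesis using one[of x y] one[of y x] by (auto simp: dist_real_def dist_commute abs_minus_commute)
      next
        case False
        then show ?thesis using L M0 by (simp add: g_def out)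
      qed
    qed (use L M0 in simp)
    define G where "G x = (if x \<in> ball x0 r then min (R x) (L + M) else if x \<in> ?B then L + M else 0)" for x
    have G0: "0 \<le> G x" for x using R(2) L M0 by (simp add: G_def)
    have [measurable]: "R \<in> borel_measurable borel" by (rule R)
    have [measurable]: "ball x0 r \<in> sets borel" "?B \<in> sets borel" by auto
    have Gm: "G \<in> borel_measurable borel"
      unfolding G_def by (intro measurable_If_set borel_measurable_min borel_measurable_const R(1)) auto
    have GLp: "G \<in> Lp m 2"
    proof (rule Lp2_mono[OF sets _ Gm])
      have B: "?B \<in> sets m" by (simp add: sets)
      have "emeasure m ?B < \<infinity>" using m by (simp add: metric_measure_space_def)
      then have "integrable m (\<lambda>x. (L + M)\<^sup>2 * indicator ?B x)"
        using B by (intro integrable_mult_right integrable_real_indicator) auto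
      moreover have "\<bar>(L + M) * indicator ?B x\<bar> powr 2 = (L + M)\<^sup>2 * indicator ?B x" for x :: 'a
        by (simp add: power2_eq_square split: split_indicator)
      ultimately show "(\<lambda>x. (L + M) * indicator ?B x) \<in> Lp m 2"
        using B by (simp add: Lp_def)
      show "\<bar>G x\<bar> \<le> \<bar>(L + M) * indicator ?B x\<bar>" for x
        using G0[of x] R(2)[of x] L M0 by (auto simp: G_def split: split_indicator)
    qed
    have Gloc: "\<forall>\<^sub>F y in at x. \<bar>g y - g x\<bar> \<le> (G x + e) * dist y x" if e: "0 < e" for x e
    proof -
      have L': "\<forall>\<^sub>F y in at x. \<bar>g y - g x\<bar> \<le> (L + M + e) * dist y x"
      proof (rule always_eventually, rule allI)
        fix y
        have "\<bar>g y - g x\<bar> \<le> (L + M) * dist y x" using lipschitz_onD[OF glip, of y x] by (simp add: dist_real_def)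
        also have "\<dots> \<le> (L + M + e) * dist y x" using e by (intro mult_right_mono) auto
        finally show "\<bar>g y - g x\<bar> \<le> (L + M + e) * dist y x" .
      qed
      consider "x \<in> ball x0 r" | "x \<notin> ball x0 r" "x \<in> ?B" | "x \<notin> ?B" by blast
      then show ?thesis
      proof cases
        case 1
        have gu: "g y = u y" if "y \<in> ball x0 r" for y using that by (simp add: g_def \<eta>_def)
        have "\<forall>\<^sub>F y in at x. y \<in> ball x0 r" using 1 by (intro eventually_at_in_open') auto
        then have "\<forall>\<^sub>F y in at x. \<bar>g y - g x\<bar> \<le> (R x + e) * dist y x"
          using loc[OF e, of x] by eventually_elim (use 1 gu in auto)
        with L' show ?thesis
          by eventually_elim (use 1 in \<open>auto simp: G_def min_def\<close>)
      next
        case 2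
        then show ?thesis using L' by (simp add: G_def)
      next
        case 3
        have "\<forall>\<^sub>F y in at x. y \<in> - ?B" using 3 by (intro eventually_at_in_open') auto
        then show ?thesis
        proof eventually_elim
          case (elim y)
          then show ?case using 3 e G0[of x] by (simp add: g_def out)
        qed
      qed
    qed
    have gw: "weak_upper_gradient m g G"
      by (rule weak_upper_gradient_of_lipschitz[OF sets glip GLp G0 Gloc])
    have "g \<in> borel_measurable m"
      using borel_measurable_continuous_onI[OF lipschitz_on_continuous_on[OF glip]]
      by (simp add: measurable_cong_sets[OF sets refl])
    then have gS: "g \<in> S2 m" using gw by (auto simp: S2_def)
    have "AE x in m. x \<in> ball x0 r \<longrightarrow> min_weak_ug m g x \<le> R x"
      using min_weak_ug(2)[OF sets gS gw] by eventually_elim (auto simp: G_def)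
    moreover have "\<forall>x\<in>ball x0 r. g x = u x" by (simp add: g_def \<eta>_def)
    ultimately show ?thesis using gS by blast
  qed
  note ex = this
  show S2: "u \<in> S2_loc m"
    unfolding S2_loc_def
  proof (rule CollectI, intro allI impI)
    fix B :: "'a set" assume "bounded B"
    then obtain r where r: "0 < r" "B \<subseteq> ball x0 r" by (metis bounded_subset_ballD)
    with ex[OF r(1)] obtain g where "g \<in> S2 m" "\<forall>x\<in>ball x0 r. g x = u x" by blast
    then show "\<exists>g\<in>S2 m. AE x in m. x \<in> B \<longrightarrow> u x = g x"
      using r(2) by (intro bexI[of _ g]) (auto simp: subset_iff)
  qed
  have "AE x in m. x \<in> ball x0 (real (Suc n)) \<longrightarrow> 0 \<le> min_weak_ug_loc m u x \<and> min_weak_ug_loc m u x \<le> R x" for n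
  proof -
    obtain g where g: "g \<in> S2 m" "\<forall>x\<in>ball x0 (real (Suc n)). g x = u x"
      "AE x in m. x \<in> ball x0 (real (Suc n)) \<longrightarrow> min_weak_ug m g x \<le> R x"
      using ex[of "real (Suc n)"] by auto
    have "AE x in m. x \<in> ball x0 (real (Suc n)) \<longrightarrow> min_weak_ug_loc m u x = min_weak_ug m g x"
      using g by (intro min_weak_ug_loc[OF sets S2 _ g(1)]) auto
    with g(3) show ?thesis
    proof eventually_elim
      case (elim x)
      then show ?case using min_weak_ug(1)[OF sets g(1)] by (auto simp: weak_upper_gradient_def)
    qed
  qed
  then have "AE x in m. \<forall>n. x \<in> ball x0 (real (Suc n)) \<longrightarrow> 0 \<le> min_weak_ug_loc m u x \<and> min_weak_ug_loc m u x \<le> R x"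
    by (simp only: AE_all_countable) simp
  then show "AE x in m. 0 \<le> min_weak_ug_loc m u x \<and> min_weak_ug_loc m u x \<le> R x"
  proof eventually_elim
    case (elim x)
    obtain n where "dist x0 x < real n" using reals_Archimedean2 by blast
    then have "x \<in> ball x0 (real (Suc n))" by simp
    with elim show ?case by blast
  qed
qed

section \<open>Gradient bounds from the dimension-free Harnack inequality\<close>

text \<open>
  The graph of a convex power lies above its tangent at \<open>v\<close>; this is Young's inequality for \<open>u\<close> and
  \<open>v powr (p - 1)\<close>.
\<close>

lemma powr_tangent_le:
  fixes u v p :: real
  assumes "0 \<le> u" "0 < v" "1 < p"
  shows "v powr p + p * v powr (p - 1) * (u - v) \<le> u powr p"
proof -
  define q where "q = p / (p - 1)"
  have q: "1 < q" "1 / p + 1 / q = 1"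
    using assms by (auto simp: q_def field_simps)
  have "u * v powr (p - 1) \<le> u powr p / p + (v powr (p - 1)) powr q / q"
    using assms q by (intro Youngs_inequality) auto
  also have "(v powr (p - 1)) powr q = v powr p"
    using assms by (simp add: powr_powr q_def)
  finally have "u * v powr (p - 1) \<le> u powr p / p + v powr p * (p - 1) / p"
    by (simp add: q_def)
  then have "p * (u * v powr (p - 1)) \<le> u powr p + v powr p * (p - 1)"
    using assms by (simp add: field_simps)
  moreover have "v powr p = v * v powr (p - 1)"
    using assms by (simp add: powr_diff)
  ultimately show ?thesis
    by (simp add: algebra_simps)
qed

lemma powr_quotient_mono:
  fixes x s s' :: real
  assumes "0 < x" "0 < s" "s \<le> s'"
  shows "(x powr s - 1) / s \<le> (x powr s' - 1) / s'"
proof (cases "s = s'")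
  case False
  then have "1 < s' / s" using assms by simp
  from powr_tangent_le[of "x powr s" 1, OF _ _ this] assms
  have "1 + s' / s * (x powr s - 1) \<le> x powr s'"
    by (simp add: powr_powr)
  then have "s' * (x powr s - 1) / s \<le> x powr s' - 1" by simp
  then show ?thesis using assms by (simp add: field_simps)
qed simp

lemma ln_le_powr_quotient:
  fixes x s :: real
  assumes "0 < x" "0 < s"
  shows "ln x \<le> (x powr s - 1) / s"
proof -
  have "1 + s * ln x \<le> x powr s"
    using assms exp_ge_add_one_self[of "s * ln x"] by (simp add: powr_def)
  then show ?thesis using assms by (simp add: field_simps)
qed

lemma powr_quotient_tendsto_ln:
  fixes x :: real
  assumes "0 < x"
  shows "((\<lambda>s. (x powr s - 1) / s) \<longlongrightarrow> ln x) (at_right 0)"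
proof -
  have "((\<lambda>s. x powr s) has_real_derivative ln x) (at 0)"
    using assms by (auto intro!: derivative_eq_intros)
  then have "((\<lambda>s. (x powr s - 1) / s) \<longlongrightarrow> ln x) (at 0)"
    using DERIV_D[of "\<lambda>s. x powr s" "ln x" 0] assms by simp
  then show ?thesis by (rule filterlim_at_split[THEN iffD1, THEN conjunct2])
qed

text \<open>
  The values of the heat semigroup at a fixed time are averages against the measures \<open>mu x\<close>. The Harnack
  inequality is required for all nonnegative functions with integrable \<open>p\<close>-th power at \<open>y\<close>, and then
  includes integrability at \<open>x\<close>.
\<close>

locale harnack_kernel =
  fixes mu :: "'a::metric_space \<Rightarrow> 'a measure" and c :: real
  assumes prob_space_mu: "prob_space (mu x)"
    and sets_mu: "sets (mu x) = sets borel"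
    and c_pos: "0 < c"
    and harnack: "\<lbrakk>1 < p; f \<in> borel_measurable borel; \<And>z. 0 \<le> f z; integrable (mu y) (\<lambda>z. f z powr p)\<rbrakk>
      \<Longrightarrow> integrable (mu x) f \<and>
          (\<integral>z. f z \<partial>mu x) powr p
            \<le> (\<integral>z. f z powr p \<partial>mu y) * exp (p * c * (dist x y)\<^sup>2 / (2 * (p - 1)))"
begin

lemma measurable_mu: "borel_measurable (mu x) = borel_measurable borel"
  by (rule measurable_cong_sets) (simp_all add: sets_mu)

lemma integrable_const_mu [simp]: "integrable (mu x) (\<lambda>_. k :: real)"
proof -
  interpret prob_space "mu x" by (rule prob_space_mu)
  show ?thesis by (rule integrable_const)
qed

lemma measure_space_mu [simp]: "measure (mu x) (space (mu x)) = 1"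
  using prob_space_mu[of x] by (rule prob_space.prob_space)

definition ave :: "('a \<Rightarrow> real) \<Rightarrow> 'a \<Rightarrow> real" where
  "ave f x = (\<integral>z. f z \<partial>mu x)"

text \<open>
  The average of \<open>f * ((f / U) powr s - 1) / s\<close> against \<open>mu x\<close>, where \<open>U = ave f x\<close>: a difference quotient
  at exponent \<open>1\<close> of the normalized power means of \<open>f\<close>, with the entropy as its limit for \<open>s\<close> tending to
  \<open>0\<close>.
\<close>

definition excess :: "('a \<Rightarrow> real) \<Rightarrow> real \<Rightarrow> 'a \<Rightarrow> real" where
  "excess f s x = (ave f x powr (- s) * ave (\<lambda>z. f z powr (1 + s)) x - ave f x) / s"

definition entropy :: "('a \<Rightarrow> real) \<Rightarrow> 'a \<Rightarrow> real" where
  "entropy f x = ave (\<lambda>z. f z * ln (f z)) x - ave f x * ln (ave f x)"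

lemma powr_le_one_plus:
  fixes u :: real assumes "0 \<le> u" "0 \<le> p" "p \<le> q"
  shows "u powr p \<le> 1 + u powr q"
proof (cases "u \<le> 1")
  case True
  then have "u powr p \<le> 1"
    using assms by (simp add: powr_le1)
  then show ?thesis by (simp add: add_increasing2)
next
  case False
  then have "u powr p \<le> u powr q" using assms by (intro powr_mono) auto
  then show ?thesis by simp
qed

lemma integrable_lower_power:
  fixes f :: "'a \<Rightarrow> real"
  assumes "f \<in> borel_measurable borel" "\<And>z. 0 \<le> f z" "integrable (mu x) (\<lambda>z. f z powr q)" "0 \<le> p" "p \<le> q"
  shows "integrable (mu x) (\<lambda>z. f z powr p)"
proof (rule Bochner_Integration.integrable_bound)
  show "integrable (mu x) (\<lambda>z. 1 + f z powr q)"
    by (intro Bochner_Integration.integrable_add integrable_const_mu assms(3))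
  show "(\<lambda>z. f z powr p) \<in> borel_measurable (mu x)"
    using assms(1) by (auto simp: measurable_mu)
  show "AE z in mu x. norm (f z powr p) \<le> norm (1 + f z powr q)"
    using powr_le_one_plus[OF assms(2,4,5)] by (intro AE_I2) (smt (verit) powr_ge_zero real_norm_def)
qed

lemma integrable_of_power:
  fixes f :: "'a \<Rightarrow> real"
  assumes "f \<in> borel_measurable borel" "\<And>z. 0 \<le> f z" "integrable (mu x) (\<lambda>z. f z powr q)" "1 \<le> q"
  shows "integrable (mu x) f"
  using integrable_lower_power[OF assms(1-3) zero_le_one assms(4)] assms(2) by simp

lemma excess_eq_integral:
  assumes f: "f \<in> borel_measurable borel" "\<And>z. 0 \<le> f z"
    and i: "integrable (mu x) (\<lambda>z. f z powr (1 + s))" and s: "0 < s" and v: "0 < ave f x"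
  shows "integrable (mu x) (\<lambda>z. f z * (((f z / ave f x) powr s - 1) / s))" (is ?int)
    and "excess f s x = (\<integral>z. f z * (((f z / ave f x) powr s - 1) / s) \<partial>mu x)" (is ?eq)
proof -
  let ?v = "ave f x"
  have eq: "f z * (((f z / ?v) powr s - 1) / s) = (?v powr (- s) * f z powr (1 + s) - f z) / s" for z
  proof (cases "f z = 0")
    case False
    then have "0 < f z" using f(2)[of z] by simp
    then show ?thesis using v s
      by (simp add: powr_divide powr_add powr_minus field_simps)
  qed simp
  have fi: "integrable (mu x) f" using integrable_of_power[OF f i] s by simp
  show ?int unfolding eq using i fi by simp
  show ?eq unfolding eq excess_def using i fi
    by (simp add: ave_def)
qed

text \<open>
  Jensen's inequality for the power, by integrating its tangent at the mean.
\<close>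

lemma excess_nonneg:
  assumes f: "f \<in> borel_measurable borel" "\<And>z. 0 \<le> f z"
    and i: "integrable (mu x) (\<lambda>z. f z powr (1 + s))" and s: "0 < s" and v: "0 < ave f x"
  shows "0 \<le> excess f s x"
proof -
  let ?v = "ave f x"
  have fi: "integrable (mu x) f" using integrable_of_power[OF f i] s by simp
  have ineq: "?v powr (1 + s) + (1 + s) * ?v powr s * (f z - ?v) \<le> f z powr (1 + s)" for z
    using powr_tangent_le[of "f z" ?v "1 + s"] f(2)[of z] s v by simp
  have "(\<integral>z. ?v powr (1 + s) + (1 + s) * ?v powr s * (f z - ?v) \<partial>mu x) \<le> ave (\<lambda>z. f z powr (1 + s)) x"
    unfolding ave_def using i fi ineq by (intro integral_mono) (auto simp: ave_def)
  also have "(\<integral>z. ?v powr (1 + s) + (1 + s) * ?v powr s * (f z - ?v) \<partial>mu x) = ?v powr (1 + s)"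
    using fi by (simp add: ave_def)
  finally have "?v powr (- s) * ?v powr (1 + s) \<le> ?v powr (- s) * ave (\<lambda>z. f z powr (1 + s)) x"
    by (intro mult_left_mono) auto
  moreover have "?v powr (- s) * ?v powr (1 + s) = ?v"
    using v by (simp add: powr_add[symmetric])
  ultimately show ?thesis using s by (simp add: excess_def)
qed

lemma excess_mono:
  assumes f: "f \<in> borel_measurable borel" "\<And>z. 0 \<le> f z"
    and i: "integrable (mu x) (\<lambda>z. f z powr (1 + s'))" and s: "0 < s" "s \<le> s'" and v: "0 < ave f x"
  shows "excess f s x \<le> excess f s' x"
proof -
  have i': "integrable (mu x) (\<lambda>z. f z powr (1 + s))"
    using integrable_lower_power[OF f i] s by simp
  have "(\<integral>z. f z * (((f z / ave f x) powr s - 1) / s) \<partial>mu x)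
      \<le> (\<integral>z. f z * (((f z / ave f x) powr s' - 1) / s') \<partial>mu x)"
  proof (rule integral_mono)
    fix z
    show "f z * (((f z / ave f x) powr s - 1) / s) \<le> f z * (((f z / ave f x) powr s' - 1) / s')"
    proof (cases "f z = 0")
      case False
      then have "0 < f z" using f(2)[of z] by simp
      then show ?thesis using v s by (intro mult_left_mono powr_quotient_mono) auto
    qed simp
  qed (use excess_eq_integral(1)[OF f i'] excess_eq_integral(1)[OF f i] s v in auto)
  then show ?thesis
    using excess_eq_integral(2)[OF f i'] excess_eq_integral(2)[OF f i] s v by simp
qed

text \<open>
  The integrands decrease to \<open>f * ln (f / U)\<close>, which is bounded below by \<open>f - U\<close>.
\<close>

lemma excess_tendsto_entropy:
  assumes f: "f \<in> borel_measurable borel" "\<And>z. 0 \<le> f z"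
    and i: "integrable (mu x) (\<lambda>z. f z powr (1 + s0))" and s0: "0 < s0" and v: "0 < ave f x"
  shows "integrable (mu x) (\<lambda>z. f z * ln (f z))"
    and "(\<lambda>n. excess f (s0 / Suc n) x) \<longlonglongrightarrow> entropy f x"
    and "0 \<le> entropy f x"
proof -
  let ?v = "ave f x"
  let ?g = "\<lambda>s z. f z * (((f z / ?v) powr s - 1) / s)"
  have fi: "integrable (mu x) f" using integrable_of_power[OF f i] s0 by simp
  have gi: "integrable (mu x) (?g s0)" using excess_eq_integral(1)[OF f i s0 v] .
  have [measurable]: "f \<in> borel_measurable borel" by (rule f)
  have [measurable]: "f \<in> borel_measurable (mu x)" by (simp add: measurable_mu f)
  have lower: "f z - ?v \<le> f z * ln (f z / ?v)" for z
  proof (cases "f z = 0")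
    case False
    then have fz: "0 < f z" using f(2)[of z] by simp
    have "- ln (f z / ?v) = ln (?v / f z)" using fz v by (simp add: ln_div)
    also have "\<dots> \<le> ?v / f z - 1" using fz v by (intro ln_le_minus_one) simp
    finally have "f z * (1 - ?v / f z) \<le> f z * ln (f z / ?v)"
      using fz by (intro mult_left_mono) auto
    then show ?thesis using fz by (simp add: algebra_simps)
  qed (use v in simp)
  have upper: "f z * ln (f z / ?v) \<le> ?g s z" if "0 < s" for s z
  proof (cases "f z = 0")
    case False
    then have fz: "0 < f z" using f(2)[of z] by simp
    show ?thesis using ln_le_powr_quotient[of "f z / ?v" s] fz v that
      by (intro mult_left_mono) auto
  qed simp
  have li: "integrable (mu x) (\<lambda>z. f z * ln (f z / ?v))"
  proof (rule Bochner_Integration.integrable_bound)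
    show "integrable (mu x) (\<lambda>z. \<bar>f z - ?v\<bar> + \<bar>?g s0 z\<bar>)"
      by (intro Bochner_Integration.integrable_add integrable_abs Bochner_Integration.integrable_diff fi gi
          integrable_const_mu)
    show "AE z in mu x. norm (f z * ln (f z / ?v)) \<le> norm (\<bar>f z - ?v\<bar> + \<bar>?g s0 z\<bar>)"
    proof (intro AE_I2)
      fix z
      show "norm (f z * ln (f z / ?v)) \<le> norm (\<bar>f z - ?v\<bar> + \<bar>?g s0 z\<bar>)"
        unfolding real_norm_def using lower[of z] upper[OF s0, of z] by linarith
    qed
  qed simp
  have split: "f z * ln (f z) = f z * ln (f z / ?v) + f z * ln ?v" for z
    using f(2)[of z] v by (cases "f z = 0") (simp_all add: ln_div algebra_simps)
  show "integrable (mu x) (\<lambda>z. f z * ln (f z))"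
    unfolding split using li fi by simp
  have ent: "entropy f x = (\<integral>z. f z * ln (f z / ?v) \<partial>mu x)"
    unfolding entropy_def ave_def[of "\<lambda>z. f z * ln (f z)"] split using li fi by (simp add: ave_def)
  show "0 \<le> entropy f x"
  proof -
    have "(\<integral>z. f z - ?v \<partial>mu x) \<le> entropy f x"
      unfolding ent using fi li lower by (intro integral_mono) auto
    then show ?thesis using fi by (simp add: ave_def)
  qed
  have s: "0 < s0 / Suc n" "s0 / Suc n \<le> s0" for n
    using s0 by (auto simp: field_simps)
  have "(\<lambda>n. \<integral>z. ?g (s0 / Suc n) z \<partial>mu x) \<longlonglongrightarrow> (\<integral>z. f z * ln (f z / ?v) \<partial>mu x)"
  proof (rule integral_dominated_convergence)
    show "integrable (mu x) (\<lambda>z. \<bar>f z * ln (f z / ?v)\<bar> + \<bar>?g s0 z\<bar>)"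
      by (intro Bochner_Integration.integrable_add integrable_abs li gi)
    have below: "?g (s0 / Suc n) z \<le> ?g s0 z" for n z
    proof (cases "f z = 0")
      case False
      then have "0 < f z" using f(2)[of z] by simp
      then show ?thesis using v s by (intro mult_left_mono powr_quotient_mono) auto
    qed simp
    show "AE z in mu x. norm (?g (s0 / Suc n) z) \<le> \<bar>f z * ln (f z / ?v)\<bar> + \<bar>?g s0 z\<bar>" for n
    proof (intro AE_I2)
      fix z
      show "norm (?g (s0 / Suc n) z) \<le> \<bar>f z * ln (f z / ?v)\<bar> + \<bar>?g s0 z\<bar>"
        unfolding real_norm_def using upper[OF s(1)[of n], of z] below[where z=z and n=n] by linarith
    qed
    have lim0: "filterlim (\<lambda>n. s0 / Suc n) (at_right 0) sequentially"
      using s(1) by (intro tendsto_imp_filterlim_at_right LIMSEQ_Suc[OF lim_const_over_n]) auto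
    have "(\<lambda>n. ?g (s0 / Suc n) z) \<longlonglongrightarrow> f z * ln (f z / ?v)" for z
    proof (cases "f z = 0")
      case False
      then have "0 < f z" using f(2)[of z] by simp
      then show ?thesis using v
        by (intro tendsto_mult tendsto_const
            filterlim_compose[OF powr_quotient_tendsto_ln lim0]) simp
    qed simp
    then show "AE z in mu x. (\<lambda>n. ?g (s0 / Suc n) z) \<longlonglongrightarrow> f z * ln (f z / ?v)"
      by simp
  qed (auto simp del: of_nat_Suc)
  moreover have "excess f (s0 / Suc n) x = (\<integral>z. ?g (s0 / Suc n) z \<partial>mu x)" for n
    using integrable_lower_power[OF f i] s[of n]
    by (intro excess_eq_integral(2) f v) (auto simp del: of_nat_Suc)
  ultimately show "(\<lambda>n. excess f (s0 / Suc n) x) \<longlonglongrightarrow> entropy f x"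
    by (simp only: ent)
qed

text \<open>
  The Harnack inequality with exponent \<open>1 + s\<close> bounds \<open>u powr (1 + s)\<close> above and the tangent at \<open>v\<close> bounds
  it below; the result is divided by \<open>v powr s\<close>. The factor \<open>1 + s\<close> of \<open>u - v\<close> that appears may be
  dropped because the right-hand side is nonnegative.
\<close>

lemma ave_difference_le:
  assumes f: "f \<in> borel_measurable borel" "\<And>z. 0 \<le> f z"
    and i: "integrable (mu y) (\<lambda>z. f z powr (1 + s))" and s: "0 < s" and v: "0 < ave f y"
    and E: "E = (1 + s) * c * (dist x y)\<^sup>2 / (2 * s)"
  shows "ave f x - ave f y \<le> ave f y * (exp E - 1) + s * exp E * excess f s y"
proof -
  let ?u = "ave f x" and ?v = "ave f y" and ?I = "ave (\<lambda>z. f z powr (1 + s)) y"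
  have u: "0 \<le> ?u" using f(2) by (simp add: ave_def)
  have A: "0 \<le> excess f s y" by (rule excess_nonneg[OF f i s v])
  have "?u powr (1 + s) \<le> ?I * exp E"
    using harnack[OF _ f i, of x] s by (simp add: ave_def E)
  with powr_tangent_le[OF u v, of "1 + s"] s
  have "?v powr (1 + s) + (1 + s) * ?v powr s * (?u - ?v) \<le> ?I * exp E" by simp
  then have "?v powr (- s) * (?v powr (1 + s) + (1 + s) * ?v powr s * (?u - ?v)) \<le> ?v powr (- s) * (?I * exp E)"
    by (intro mult_left_mono) auto
  also have "?v powr (- s) * (?v powr (1 + s) + (1 + s) * ?v powr s * (?u - ?v)) = ?v + (1 + s) * (?u - ?v)"
  proof -
    have "?v powr (- s) * ?v powr s = 1" "?v powr (1 + s) = ?v * ?v powr s"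
      using v by (simp_all add: powr_add powr_minus)
    then show ?thesis by (simp add: algebra_simps)
  qed
  also have "?v powr (- s) * (?I * exp E) = (?v + s * excess f s y) * exp E"
    using s by (simp add: excess_def)
  finally have *: "(1 + s) * (?u - ?v) \<le> ?v * (exp E - 1) + s * exp E * excess f s y"
    by (simp add: algebra_simps)
  have E0: "0 \<le> E" unfolding E using s c_pos by simp
  show ?thesis
  proof (cases "?v \<le> ?u")
    case True
    then have "?u - ?v \<le> (1 + s) * (?u - ?v)" using s by (simp add: algebra_simps)
    with * show ?thesis by simp
  next
    case False
    then show ?thesis using E0 v A s
      by (smt (verit) exp_ge_zero mult_nonneg_nonneg one_le_exp_iff)
  qed
qed

text \<open>
  The Harnack inequality propagates integrability from one point to all points, at the cost of an exponent
  larger than \<open>1\<close>, with bounds that are uniform on balls.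
\<close>

lemma ave_le_of_power:
  assumes k: "k \<in> borel_measurable borel" "\<And>z. 0 \<le> k z" and p: "1 < p"
    and i: "integrable (mu y0) (\<lambda>z. k z powr p)"
  shows "integrable (mu x) k" and "\<exists>M. \<forall>x\<in>cball y0 R. ave k x \<le> M"
proof -
  show "integrable (mu x) k" using harnack[OF p k i] by blast
  define J where "J = ave (\<lambda>z. k z powr p) y0 * exp (p * c * R\<^sup>2 / (2 * (p - 1)))"
  have "ave k x \<le> J powr (1 / p)" if "x \<in> cball y0 R" for x
  proof -
    have d: "dist x y0 \<le> R" using that by (simp add: dist_commute)
    have "(ave k x) powr p \<le> ave (\<lambda>z. k z powr p) y0 * exp (p * c * (dist x y0)\<^sup>2 / (2 * (p - 1)))"
      using harnack[OF p k i, of x] by (simp add: ave_def)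
    also have "\<dots> \<le> J"
      unfolding J_def using d p c_pos
      by (intro mult_left_mono) (auto simp: ave_def intro!: divide_right_mono mult_left_mono power_mono)
    finally have "((ave k x) powr p) powr (1 / p) \<le> J powr (1 / p)"
      using p by (intro powr_mono2) auto
    moreover have "0 \<le> ave k x" using k(2) by (simp add: ave_def)
    ultimately show ?thesis using p by (simp add: powr_powr)
  qed
  then show "\<exists>M. \<forall>x\<in>cball y0 R. ave k x \<le> M" by blast
qed

lemma integrable_add_one_power:
  fixes f :: "'a \<Rightarrow> real"
  assumes f: "f \<in> borel_measurable borel" "\<And>z. 0 \<le> f z" and q: "0 \<le> q"
    and i: "integrable (mu x) (\<lambda>z. f z powr q)"
  shows "integrable (mu x) (\<lambda>z. (f z + 1) powr q)"
proof (rule Bochner_Integration.integrable_bound)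
  show "integrable (mu x) (\<lambda>z. 2 powr q * (f z powr q + 1))"
    using i by (intro integrable_mult_right Bochner_Integration.integrable_add integrable_const_mu) auto
  show "(\<lambda>z. (f z + 1) powr q) \<in> borel_measurable (mu x)"
    using f(1) by (simp add: measurable_mu)
  have "(u + 1) powr q \<le> 2 powr q * (u powr q + 1)" if "0 \<le> u" for u :: real
  proof -
    have "(u + 1) powr q \<le> (2 * max u 1) powr q"
      using that q by (intro powr_mono2) auto
    also have "\<dots> = 2 powr q * (max u 1) powr q"
      using that by (simp add: powr_mult)
    also have "(max u 1) powr q \<le> u powr q + 1"
      by (cases "u \<le> 1") (auto simp: max_def)
    finally show ?thesis by simp
  qed
  then show "AE z in mu x. norm ((f z + 1) powr q) \<le> norm (2 powr q * (f z powr q + 1))"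
    using f(2) by (intro AE_I2) (simp add: abs_mult)
qed

text \<open>
  For nearby points take \<open>s = d\<close> in the bound on differences. Adding \<open>1\<close> to \<open>f\<close> does not change the
  differences and keeps the averages away from \<open>0\<close>, where the negative power in the excess is large. For
  distances above \<open>s0\<close> the bound on the averages themselves is enough.
\<close>

lemma ave_lipschitz:
  assumes f: "f \<in> borel_measurable borel" "\<And>z. 0 \<le> f z" and s0: "0 < s0" "s0 \<le> 1"
    and S: "\<And>x. x \<in> S \<Longrightarrow> integrable (mu x) (\<lambda>z. (f z + 1) powr (1 + s0))"
      "\<And>x. x \<in> S \<Longrightarrow> ave (\<lambda>z. (f z + 1) powr (1 + s0)) x \<le> M"
    and xy: "x \<in> S" "y \<in> S"
  shows "\<bar>ave f x - ave f y\<bar> \<le> M * exp c * (c + 1 / s0) * dist x y"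
proof -
  let ?k = "\<lambda>z. f z + 1"
  have k: "?k \<in> borel_measurable borel" "\<And>z. 0 \<le> ?k z" using f by (auto simp: add_nonneg_nonneg)
  have ki: "integrable (mu x) ?k" if "x \<in> S" for x
    using integrable_of_power[OF k S(1)[OF that]] s0 by simp
  have fi: "integrable (mu x) f" if "x \<in> S" for x
    using Bochner_Integration.integrable_diff[OF ki[OF that] integrable_const_mu[of _ 1]] by simp
  have kf: "ave ?k x = ave f x + 1" if "x \<in> S" for x
    using fi[OF that] by (simp add: ave_def)
  have f0: "0 \<le> ave f x" for x using f(2) by (simp add: ave_def)
  have kM: "ave ?k x \<le> M" if "x \<in> S" for x
  proof -
    have "ave ?k x \<le> ave (\<lambda>z. ?k z powr (1 + s0)) x"
      unfolding ave_def
    proof (rule integral_mono[OF ki[OF that] S(1)[OF that]])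
      fix z
      show "?k z \<le> ?k z powr (1 + s0)"
        using powr_mono[of 1 "1 + s0" "?k z"] f(2)[of z] s0 by simp
    qed
    then show ?thesis using S(2)[OF that] by simp
  qed
  have one_sided: "ave f x - ave f y \<le> M * exp c * (c + 1 / s0) * dist x y"
    if xy: "x \<in> S" "y \<in> S" "x \<noteq> y" for x y
  proof -
    let ?d = "dist x y"
    have d0: "0 < ?d" using xy by simp
    have M1: "1 \<le> M" using kM[OF xy(1)] kf[OF xy(1)] f0[of x] by simp
    have ec: "1 \<le> exp c" using c_pos by simp
    show ?thesis
    proof (cases "?d \<le> s0")
      case True
      define E where "E = (1 + ?d) * c * ?d\<^sup>2 / (2 * ?d)"
      have E: "E = (1 + ?d) / 2 * (c * ?d)"
        using d0 by (simp add: E_def power2_eq_square)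
      have d1: "?d \<le> 1" using True s0 by simp
      have E1: "E \<le> 1 * (c * ?d)"
        unfolding E using d1 d0 c_pos by (intro mult_right_mono) auto
      have E0: "0 \<le> E" unfolding E using c_pos by simp
      have "c * ?d \<le> c * 1" using d1 c_pos by (intro mult_left_mono) auto
      then have Ec: "exp E \<le> exp c" using E1 by simp
      have v: "0 < ave ?k y" using kf[OF xy(2)] f0[of y] by simp
      have i: "integrable (mu y) (\<lambda>z. ?k z powr (1 + ?d))"
        using integrable_lower_power[OF k S(1)[OF xy(2)], of "1 + ?d"] True d0 by simp
      have "ave ?k x - ave ?k y \<le> ave ?k y * (exp E - 1) + ?d * exp E * excess ?k ?d y"
        by (rule ave_difference_le[OF k i d0 v E_def])
      also have "\<dots> \<le> M * (c * ?d * exp c) + ?d * exp c * (M / s0)"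
      proof (intro add_mono mult_mono)
        have "1 - E \<le> exp (- E)" using exp_ge_add_one_self[of "- E"] by simp
        then have "(1 - E) * exp E \<le> exp (- E) * exp E" by (intro mult_right_mono) auto
        then have "exp E - 1 \<le> E * exp E" by (simp add: algebra_simps exp_minus)
        also have "\<dots> \<le> c * ?d * exp c"
          using E1 Ec c_pos by (intro mult_mono) auto
        finally show "exp E - 1 \<le> c * ?d * exp c" .
        have "excess ?k ?d y \<le> excess ?k s0 y"
          by (rule excess_mono[OF k S(1)[OF xy(2)] d0 True v])
        also have "excess ?k s0 y \<le> M / s0"
        proof -
          have "ave ?k y powr (- s0) \<le> 1"
            using kf[OF xy(2)] f0[of y] s0 powr_mono[of "- s0" 0 "ave ?k y"] by simp
          then have "ave ?k y powr (- s0) * ave (\<lambda>z. ?k z powr (1 + s0)) y \<le> 1 * ave (\<lambda>z. ?k z powr (1 + s0)) y"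
            by (intro mult_right_mono) (simp_all add: ave_def)
          then have "ave ?k y powr (- s0) * ave (\<lambda>z. ?k z powr (1 + s0)) y - ave ?k y \<le> M"
            using S(2)[OF xy(2)] v by simp
          then show ?thesis unfolding excess_def using s0 by (intro divide_right_mono) auto
        qed
        finally show "excess ?k ?d y \<le> M / s0" .
        show "0 \<le> excess ?k ?d y" by (rule excess_nonneg[OF k i d0 v])
      qed (use kM[OF xy(2)] M1 E0 Ec c_pos in auto)
      also have "\<dots> = M * exp c * (c + 1 / s0) * ?d" by (simp add: algebra_simps)
      finally show ?thesis using kf[OF xy(1)] kf[OF xy(2)] by simp
    next
      case False
      have "ave f x - ave f y \<le> M * 1 * (0 + 1 / s0) * s0"
        using kM[OF xy(1)] kf[OF xy(1)] f0[of y] s0 by simp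
      also have "\<dots> \<le> M * exp c * (c + 1 / s0) * ?d"
        using M1 s0 c_pos ec False by (intro mult_mono add_mono order_refl) auto
      finally show ?thesis .
    qed
  qed
  show ?thesis
    using one_sided[OF xy] one_sided[OF xy(2,1)]
    by (cases "x = y") (auto simp: dist_commute abs_le_iff)
qed

lemma ave_lipschitz_on_bounded:
  assumes f: "f \<in> borel_measurable borel" "\<And>z. 0 \<le> f z" and q: "1 < q"
    and i: "integrable (mu y0) (\<lambda>z. f z powr q)" and B: "bounded B"
  shows "\<exists>L\<ge>0. \<forall>x\<in>B. \<forall>y\<in>B. \<bar>ave f x - ave f y\<bar> \<le> L * dist x y"
proof -
  define s0 where "s0 = min 1 ((q - 1) / 2)"
  have s0: "0 < s0" "s0 \<le> 1" "1 + s0 < q" using q by (auto simp: s0_def min_def field_simps)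
  obtain R where R: "B \<subseteq> cball y0 R"
    using B bounded_any_center[of B y0] by (auto simp: subset_iff)
  let ?k = "\<lambda>z. (f z + 1) powr (1 + s0)"
  have k: "?k \<in> borel_measurable borel" "\<And>z. 0 \<le> ?k z" using f by auto
  have p: "1 < q / (1 + s0)" using s0 by simp
  have "integrable (mu y0) (\<lambda>z. (f z + 1) powr q)"
    using integrable_add_one_power[OF f _ i] q by simp
  then have ik: "integrable (mu y0) (\<lambda>z. ?k z powr (q / (1 + s0)))"
    using s0 by (simp add: powr_powr)
  obtain M where M: "\<forall>x\<in>cball y0 R. ave ?k x \<le> M"
    using ave_le_of_power(2)[OF k p ik] by blast
  have "\<bar>ave f x - ave f y\<bar> \<le> M * exp c * (c + 1 / s0) * dist x y" if "x \<in> B" "y \<in> B" for x y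
    using that R M
    by (intro ave_lipschitz[OF f s0(1,2), of B M] ave_le_of_power(1)[OF k p ik]) auto
  then have "\<bar>ave f x - ave f y\<bar> \<le> \<bar>M * exp c * (c + 1 / s0)\<bar> * dist x y" if "x \<in> B" "y \<in> B" for x y
    using that by (meson abs_ge_self mult_right_mono order_trans zero_le_dist)
  then show ?thesis by (intro exI[of _ "\<bar>M * exp c * (c + 1 / s0)\<bar>"]) auto
qed

lemma ave_continuous:
  assumes f: "f \<in> borel_measurable borel" "\<And>z. 0 \<le> f z" and q: "1 < q"
    and i: "integrable (mu y0) (\<lambda>z. f z powr q)"
  shows "continuous_on UNIV (ave f)"
proof -
  have "isCont (ave f) x" for x
  proof -
    obtain L where L: "0 \<le> L" "\<And>y z. \<lbrakk>y \<in> ball x 1; z \<in> ball x 1\<rbrakk> \<Longrightarrow> \<bar>ave f y - ave f z\<bar> \<le> L * dist y z"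
      using ave_lipschitz_on_bounded[OF f q i bounded_ball[of x 1]] by blast
    have "L-lipschitz_on (ball x 1) (ave f)"
      using L by (intro lipschitz_onI) (auto simp: dist_real_def)
    then have "continuous_on (ball x 1) (ave f)" by (rule lipschitz_on_continuous_on)
    then show ?thesis by (simp add: continuous_on_eq_continuous_at)
  qed
  then show ?thesis by (simp add: continuous_on_eq_continuous_at)
qed

text \<open>
  By the Harnack inequality the measures \<open>mu x\<close> have the same null sets, so that the average of a
  nonnegative function vanishes everywhere or nowhere.
\<close>

lemma ave_zero_everywhere:
  assumes f: "f \<in> borel_measurable borel" "\<And>z. 0 \<le> f z" and i: "integrable (mu x) f" and z: "ave f x = 0"
  shows "AE z in mu y. f z = 0" and "ave f y = 0"
proof -
  have "AE z in mu x. f z = 0"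
    using z i f(2) by (simp add: ave_def integral_nonneg_eq_0_iff_AE)
  then have ae: "AE z in mu x. f z powr 2 = 0" by auto
  have "integrable (mu x) (\<lambda>z. f z powr 2)"
    using ae f(1) by (subst integrable_cong_AE[where g = "\<lambda>_. 0"]) (auto simp: measurable_mu)
  from harnack[OF _ f this, of y] have "integrable (mu y) f" "(ave f y) powr 2 \<le> 0"
    using integral_cong_AE[OF _ _ ae] f(1) by (auto simp: measurable_mu ave_def)
  then show "ave f y = 0" "AE z in mu y. f z = 0"
    using f(2) by (auto simp: ave_def integral_nonneg_eq_0_iff_AE)
qed

lemma excess_continuous:
  assumes f: "f \<in> borel_measurable borel" "\<And>z. 0 \<le> f z" and s: "0 < s" "1 + s < q"
    and i: "integrable (mu y0) (\<lambda>z. f z powr q)" and pos: "\<And>x. 0 < ave f x"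
  shows "continuous_on UNIV (excess f s)"
proof -
  have 1: "continuous_on UNIV (ave f)" using ave_continuous[OF f _ i] s by simp
  have p: "1 < q / (1 + s)" using s by simp
  have 2: "continuous_on UNIV (ave (\<lambda>z. f z powr (1 + s)))"
    by (rule ave_continuous[OF _ _ p, of _ y0]) (use f s i in \<open>auto simp: powr_powr\<close>)
  show ?thesis unfolding excess_def[abs_def]
    using 1 2 s pos by (intro continuous_intros) (auto simp: less_imp_neq[symmetric])
qed

text \<open>
  Take \<open>s = a * d\<close>. Then \<open>(exp E - 1) / d\<close> tends to \<open>c / (2 * a)\<close>. Since the slope of \<open>ave f\<close> at \<open>x\<close>
  concerns increments of either sign, the base point of the bound on differences is once \<open>x\<close> and once the
  moving point \<open>y\<close>; in the second case monotonicity allows fixing the exponent of the excess, which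
  is then continuous in \<open>y\<close>.
\<close>

lemma ave_gradient_bound_param:
  assumes f: "f \<in> borel_measurable borel" "\<And>z. 0 \<le> f z" and s: "0 < s" "1 + s < q"
    and i: "integrable (mu y0) (\<lambda>z. f z powr q)" and pos: "\<And>x. 0 < ave f x"
    and a: "0 < a" and e: "0 < e"
  shows "\<forall>\<^sub>F y in at x. \<bar>ave f y - ave f x\<bar> \<le> (ave f x * (c / (2 * a)) + a * excess f s x + e) * dist y x"
proof -
  define E where "E d = (1 + a * d) * c * d / (2 * a)" for d
  define H where "H z d = ave f z * ((exp (E d) - 1) / d) + a * exp (E d) * excess f s z" for z d
  let ?L = "ave f x * (c / (2 * a)) + a * excess f s x"
  have ipow: "integrable (mu z) (\<lambda>w. f w powr (1 + s))" for z
    by (rule ave_le_of_power(1)[where p = "q / (1 + s)" and ?y0.0 = y0])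
      (use f s i in \<open>auto simp: powr_powr\<close>)
  have "((\<lambda>d. exp (E d)) has_real_derivative c / (2 * a)) (at 0)"
    unfolding E_def using a by (auto intro!: derivative_eq_intros)
  from DERIV_D[OF this] have "((\<lambda>d. (exp (E d) - 1) / d) \<longlongrightarrow> c / (2 * a)) (at 0)"
    by (simp add: E_def)
  then have \<psi>: "((\<lambda>d. (exp (E d) - 1) / d) \<longlongrightarrow> c / (2 * a)) (at_right 0)"
    by (rule filterlim_at_split[THEN iffD1, THEN conjunct2])
  have d0: "((\<lambda>y. dist y x) \<longlongrightarrow> 0) (at x)"
    by (rule tendsto_eq_intros | simp)+
  have d: "filterlim (\<lambda>y. dist y x) (at_right 0) (at x)"
    using d0 by (rule tendsto_imp_filterlim_at_right) (simp add: eventually_at_filter)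
  have \<psi>': "((\<lambda>y. (exp (E (dist y x)) - 1) / dist y x) \<longlongrightarrow> c / (2 * a)) (at x)"
    by (rule filterlim_compose[OF \<psi> d])
  have \<chi>: "((\<lambda>y. exp (E (dist y x))) \<longlongrightarrow> 1) (at x)"
    unfolding E_def using d0 a by (auto intro!: tendsto_eq_intros)
  have cf: "(ave f \<longlongrightarrow> ave f x) (at x)" and ce: "(excess f s \<longlongrightarrow> excess f s x) (at x)"
    using ave_continuous[OF f _ i] excess_continuous[OF f s i pos] s
    by (auto simp: continuous_on_def)
  have 1: "((\<lambda>y. H y (dist y x)) \<longlongrightarrow> ave f x * (c / (2 * a)) + a * 1 * excess f s x) (at x)"
    unfolding H_def by (intro tendsto_intros \<psi>' \<chi> cf ce)
  have 2: "((\<lambda>y. H x (dist y x)) \<longlongrightarrow> ave f x * (c / (2 * a)) + a * 1 * excess f s x) (at x)"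
    unfolding H_def by (intro tendsto_intros \<psi>' \<chi>)
  have "\<forall>\<^sub>F y in at x. H y (dist y x) < ?L + e" "\<forall>\<^sub>F y in at x. H x (dist y x) < ?L + e"
    using order_tendstoD(2)[OF 1, of "?L + e"] order_tendstoD(2)[OF 2, of "?L + e"] e by auto
  moreover have "\<forall>\<^sub>F y in at x. dist y x < s / a"
    using order_tendstoD(2)[OF d0, of "s / a"] s a by simp
  moreover have "\<forall>\<^sub>F y in at x. y \<noteq> x" by (simp add: eventually_at_filter)
  ultimately show ?thesis
  proof eventually_elim
    case (elim y)
    let ?d = "dist y x"
    have d: "0 < ?d" "0 < a * ?d" "a * ?d \<le> s" using elim a by (auto simp: field_simps)
    have key: "ave f u - ave f z \<le> H z ?d * ?d" if "dist u z = ?d" for u z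
    proof -
      have iz: "integrable (mu z) (\<lambda>w. f w powr (1 + a * ?d))"
        using integrable_lower_power[OF f ipow] d by simp
      have "E ?d = (1 + a * ?d) * c * (dist u z)\<^sup>2 / (2 * (a * ?d))"
        using d a that by (simp add: E_def power2_eq_square)
      from ave_difference_le[OF f iz d(2) pos this]
      have "ave f u - ave f z \<le> ave f z * (exp (E ?d) - 1) + a * ?d * exp (E ?d) * excess f (a * ?d) z" .
      also have "\<dots> \<le> ave f z * (exp (E ?d) - 1) + a * ?d * exp (E ?d) * excess f s z"
        using d by (intro add_left_mono mult_left_mono excess_mono[OF f ipow d(2,3) pos]) auto
      also have "\<dots> = H z ?d * ?d" using d by (simp add: H_def field_simps)
      finally show ?thesis .
    qed
    have "H x ?d * ?d \<le> (?L + e) * ?d" "H y ?d * ?d \<le> (?L + e) * ?d"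
      using elim by (auto intro!: mult_right_mono)
    then show ?case using key[of y x] key[of x y] by (simp add: dist_commute abs_le_iff)
  qed
qed

text \<open>
  Let the exponent of the excess tend to \<open>0\<close> and minimize over \<open>a\<close>.
\<close>

lemma ave_gradient_bound:
  assumes f: "f \<in> borel_measurable borel" "\<And>z. 0 \<le> f z" and q: "1 < q"
    and i: "integrable (mu y0) (\<lambda>z. f z powr q)" and e: "0 < e"
  shows "\<forall>\<^sub>F y in at x. \<bar>ave f y - ave f x\<bar> \<le> (sqrt (2 * c * (ave f x * entropy f x)) + e) * dist y x"
proof (cases "ave f x = 0")
  case True
  have "ave f y = 0" for y
    by (rule ave_zero_everywhere(2)[OF f ave_le_of_power(1)[OF f q i] True])
  then show ?thesis using e by simp
next
  case False
  have fi: "integrable (mu y) f" for y by (rule ave_le_of_power(1)[OF f q i])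
  have pos: "0 < ave f y" for y
  proof -
    have "0 \<le> ave f y" using f(2) by (simp add: ave_def)
    then show ?thesis using ave_zero_everywhere(2)[OF f fi, of y x] False by fastforce
  qed
  define s0 where "s0 = (q - 1) / 2"
  have s0: "0 < s0" "1 + s0 < q" using q by (auto simp: s0_def field_simps)
  have ipow: "integrable (mu z) (\<lambda>w. f w powr (1 + s0))" for z
    by (rule ave_le_of_power(1)[where p = "q / (1 + s0)" and ?y0.0 = y0])
      (use f s0 i in \<open>auto simp: powr_powr\<close>)
  let ?U = "ave f x" and ?T = "entropy f x"
  have T0: "0 \<le> ?T" by (rule excess_tendsto_entropy(3)[OF f ipow s0(1) pos])
  obtain a where a: "0 < a" "?U * (c / (2 * a)) + a * ?T \<le> sqrt (2 * c * (?U * ?T)) + e / 3"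
  proof (cases "?T = 0")
    case True
    have "0 < 3 * ?U * c / (2 * e)" using pos c_pos e by simp
    \<comment> \<open>Without the entropy term only a large \<open>a\<close> is needed.\<close>
    then show ?thesis using True pos[of x] c_pos e by (intro that[of "3 * ?U * c / (2 * e)"]) (auto simp: field_simps)
  next
    case False
    then have T: "0 < ?T" using T0 by simp
    \<comment> \<open>the minimizer of \<open>U * c / (2 * a) + a * T\<close>, which makes both terms equal\<close>
    define a where "a = sqrt (?U * c / (2 * ?T))"
    have a: "0 < a" using T pos c_pos by (simp add: a_def)
    have a2: "a * a = ?U * c / (2 * ?T)" using T pos[of x] c_pos by (simp add: a_def)
    have 1: "?U * (c / (2 * a)) = a * ?T"
    proof -
      have "?U * c = 2 * ?T * (a * a)" using T by (simp add: a2)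
      then show ?thesis using a by (simp add: field_simps)
    qed
    have "(2 * a * ?T)\<^sup>2 = 4 * ?T * ?T * (a * a)" by (simp add: power2_eq_square algebra_simps)
    also have "\<dots> = 2 * c * (?U * ?T)" using T by (simp add: a2)
    finally have "sqrt (2 * c * (?U * ?T)) = 2 * a * ?T"
      using a T by (intro real_sqrt_unique) auto
    then show ?thesis using 1 a e by (intro that[of a]) auto
  qed
  have "\<forall>\<^sub>F n in sequentially. excess f (s0 / Suc n) x < ?T + e / (3 * a)"
    using excess_tendsto_entropy(2)[OF f ipow s0(1) pos, of x] a e by (intro order_tendstoD) auto
  then obtain n where n: "excess f (s0 / Suc n) x < ?T + e / (3 * a)"
    using eventually_happens'[OF sequentially_bot] by blast
  define s where "s = s0 / Suc n"
  have "s \<le> s0" using s0 by (simp add: s_def field_simps)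
  then have s: "0 < s" "1 + s < q" using s0 by (auto simp: s_def)
  have ex: "a * excess f s x \<le> a * ?T + e / 3"
    using n a by (simp add: s_def field_simps)
  from ave_gradient_bound_param[OF f s i pos a(1), of "e / 3" x] e
  have "\<forall>\<^sub>F y in at x. \<bar>ave f y - ave f x\<bar> \<le> (?U * (c / (2 * a)) + a * excess f s x + e / 3) * dist y x"
    by simp
  then show ?thesis
  proof eventually_elim
    case (elim y)
    have "?U * (c / (2 * a)) + a * excess f s x + e / 3 \<le> sqrt (2 * c * (?U * ?T)) + e"
      using a(2) ex by linarith
    with elim show ?case by (meson mult_right_mono order_trans zero_le_dist)
  qed
qed

text \<open>
  Where \<open>ave f\<close> is positive, the entropy is a pointwise limit of continuous excesses, hence Borel.
\<close>

lemma ave_entropy_regularity: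
  assumes f: "f \<in> borel_measurable borel" "\<And>z. 0 \<le> f z" and q: "1 < q"
    and i: "integrable (mu y0) (\<lambda>z. f z powr q)"
  shows "integrable (mu x) (\<lambda>z. f z * ln (f z))"
    and "0 \<le> entropy f x"
    and "(\<lambda>x. ave f x * entropy f x) \<in> borel_measurable borel"
proof -
  define s0 where "s0 = (q - 1) / 2"
  have s0: "0 < s0" "1 + s0 < q" using q by (auto simp: s0_def field_simps)
  have ipow: "integrable (mu z) (\<lambda>w. f w powr (1 + s0))" for z
    by (rule ave_le_of_power(1)[where p = "q / (1 + s0)" and ?y0.0 = y0])
      (use f s0 i in \<open>auto simp: powr_powr\<close>)
  have fi: "integrable (mu y) f" for y by (rule ave_le_of_power(1)[OF f q i])
  have "integrable (mu x) (\<lambda>z. f z * ln (f z)) \<and> 0 \<le> entropy f x \<and>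
    (\<lambda>x. ave f x * entropy f x) \<in> borel_measurable borel"
  proof (cases "ave f x = 0")
    case True
    have ae: "AE z in mu y. f z = 0" and z: "ave f y = 0" for y
      by (rule ave_zero_everywhere[OF f fi True])+
    have ae': "AE z in mu y. f z * ln (f z) = 0" for y using ae[of y] by eventually_elim simp
    have "integrable (mu x) (\<lambda>z. f z * ln (f z))"
      using ae'[of x] f(1) by (subst integrable_cong_AE[where g = "\<lambda>_. 0"]) (auto simp: measurable_mu)
    moreover have "ave (\<lambda>z. f z * ln (f z)) x = 0"
      unfolding ave_def using integral_cong_AE[OF _ _ ae'[of x]] f(1) by (simp add: measurable_mu)
    ultimately show ?thesis using z by (simp add: entropy_def)
  next
    case False
    have pos: "0 < ave f y" for y
    proof -
      have "0 \<le> ave f y" using f(2) by (simp add: ave_def)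
      then show ?thesis using ave_zero_everywhere(2)[OF f fi, of y x] False by fastforce
    qed
    have "excess f (s0 / Suc n) \<in> borel_measurable borel" for n
    proof (rule borel_measurable_continuous_onI[OF excess_continuous[OF f _ _ i pos]])
      show "0 < s0 / Suc n" using s0 by simp
      have "s0 / Suc n \<le> s0" using s0 by (simp add: field_simps)
      then show "1 + s0 / Suc n < q" using s0 by simp
    qed
    then have "entropy f \<in> borel_measurable borel"
      by (rule borel_measurable_LIMSEQ_real[OF excess_tendsto_entropy(2)[OF f ipow s0(1) pos]])
    moreover have "ave f \<in> borel_measurable borel"
      by (rule borel_measurable_continuous_onI[OF ave_continuous[OF f q i]])
    ultimately show ?thesis
      using excess_tendsto_entropy(1,3)[OF f ipow s0(1) pos] by auto
  qed
  then show "integrable (mu x) (\<lambda>z. f z * ln (f z))" "0 \<le> entropy f x"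
    "(\<lambda>x. ave f x * entropy f x) \<in> borel_measurable borel" by blast+
qed

end

section \<open>Self-adjointness of the heat flow\<close>

lemma Lp2_iff: "f \<in> Lp m 2 \<longleftrightarrow> f \<in> borel_measurable m \<and> integrable m (\<lambda>x. (f x)\<^sup>2)"
  by (auto simp: Lp_def abs_powr_two)

lemma Lp2_integrable_mult:
  assumes "f \<in> Lp m 2" "g \<in> Lp m 2"
  shows "integrable m (\<lambda>x. f x * g x)"
proof (rule Bochner_Integration.integrable_bound)
  show "integrable m (\<lambda>x. (f x)\<^sup>2 + (g x)\<^sup>2)" using assms by (auto simp: Lp2_iff)
  show "(\<lambda>x. f x * g x) \<in> borel_measurable m" using assms by (auto simp: Lp2_iff)
  have "\<bar>a * b\<bar> \<le> \<bar>a\<^sup>2 + b\<^sup>2\<bar>" for a b :: real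
  proof -
    have "2 * (\<bar>a\<bar> * \<bar>b\<bar>) \<le> a\<^sup>2 + b\<^sup>2" "0 \<le> \<bar>a\<bar> * \<bar>b\<bar>"
      using sum_squares_bound[of "\<bar>a\<bar>" "\<bar>b\<bar>"] by (simp_all add: mult.assoc)
    then have "\<bar>a\<bar> * \<bar>b\<bar> \<le> \<bar>a\<^sup>2 + b\<^sup>2\<bar>" by linarith
    then show ?thesis by (simp only: abs_mult)
  qed
  then show "AE x in m. norm (f x * g x) \<le> norm ((f x)\<^sup>2 + (g x)\<^sup>2)"
    by (intro AE_I2) (simp only: real_norm_def)
qed

lemma Lp2_scale: "f \<in> Lp m 2 \<Longrightarrow> (\<lambda>x. c * f x) \<in> Lp m 2"
  by (auto simp: Lp2_iff power_mult_distrib)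

lemma Lp2_add:
  assumes "f \<in> Lp m 2" "g \<in> Lp m 2"
  shows "(\<lambda>x. f x + g x) \<in> Lp m 2"
proof -
  have "(\<lambda>x. (f x + g x)\<^sup>2) = (\<lambda>x. (f x)\<^sup>2 + 2 * (f x * g x) + (g x)\<^sup>2)"
    by (auto simp: power2_eq_square algebra_simps)
  then show ?thesis using assms Lp2_integrable_mult[OF assms] by (auto simp: Lp2_iff)
qed

lemma Lp2_diff: "f \<in> Lp m 2 \<Longrightarrow> g \<in> Lp m 2 \<Longrightarrow> (\<lambda>x. f x - g x) \<in> Lp m 2"
  using Lp2_add[OF _ Lp2_scale[of g m "-1"], of f] by simp

lemma L2_norm_nonneg: "0 \<le> L2_norm m f"
  by (simp add: L2_norm_def)

lemma L2_norm_square: "(L2_norm m f)\<^sup>2 = (\<integral>x. (f x)\<^sup>2 \<partial>m)"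
  by (simp add: L2_norm_def)

lemma L2_norm_scale: "L2_norm m (\<lambda>x. c * f x) = \<bar>c\<bar> * L2_norm m f"
  by (simp add: L2_norm_def power_mult_distrib real_sqrt_mult)

lemma L2_Cauchy_Schwarz:
  assumes f: "f \<in> Lp m 2" and g: "g \<in> Lp m 2"
  shows "\<bar>\<integral>x. f x * g x \<partial>m\<bar> \<le> L2_norm m f * L2_norm m g"
proof -
  let ?A = "\<integral>x. (f x)\<^sup>2 \<partial>m" and ?B = "\<integral>x. (g x)\<^sup>2 \<partial>m" and ?c = "\<integral>x. f x * g x \<partial>m"
  have i: "integrable m (\<lambda>x. (f x)\<^sup>2)" "integrable m (\<lambda>x. (g x)\<^sup>2)" "integrable m (\<lambda>x. f x * g x)"
    using f g Lp2_integrable_mult[OF f g] by (auto simp: Lp2_iff)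
  have "?c\<^sup>2 \<le> ?A * ?B"
  proof (cases "?A = 0")
    case True
    then have "AE x in m. (f x)\<^sup>2 = 0" using i(1) by (simp add: integral_nonneg_eq_0_iff_AE)
    then have "AE x in m. f x * g x = 0" by eventually_elim simp
    then have "?c = 0" using i(3) integral_cong_AE[of "\<lambda>x. f x * g x" m "\<lambda>_. 0"] by simp
    then show ?thesis using True by simp
  next
    case False
    have A0: "0 < ?A" using False integral_nonneg_AE[of "\<lambda>x. (f x)\<^sup>2" m] by (simp add: less_le)
    have "0 \<le> (\<integral>x. (g x - ?c / ?A * f x)\<^sup>2 \<partial>m)" by simp
    also have "(\<lambda>x. (g x - ?c / ?A * f x)\<^sup>2) = (\<lambda>x. (g x)\<^sup>2 - 2 * (?c / ?A) * (f x * g x) + (?c / ?A)\<^sup>2 * (f x)\<^sup>2)"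
      by (auto simp: power2_eq_square algebra_simps)
    also have "(\<integral>x. (g x)\<^sup>2 - 2 * (?c / ?A) * (f x * g x) + (?c / ?A)\<^sup>2 * (f x)\<^sup>2 \<partial>m)
        = ?B - 2 * (?c / ?A) * ?c + (?c / ?A)\<^sup>2 * ?A"
      using i by simp
    also have "\<dots> = ?B - ?c\<^sup>2 / ?A" using A0 by (simp add: power2_eq_square)
    finally show ?thesis using A0 by (simp add: field_simps)
  qed
  then have "sqrt (?c\<^sup>2) \<le> sqrt (?A * ?B)" by (rule real_sqrt_le_mono)
  then show ?thesis by (simp add: L2_norm_def real_sqrt_mult)
qed

lemma L2_norm_triangle:
  assumes f: "f \<in> Lp m 2" and g: "g \<in> Lp m 2"
  shows "L2_norm m (\<lambda>x. f x + g x) \<le> L2_norm m f + L2_norm m g"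
proof -
  have i: "integrable m (\<lambda>x. (f x)\<^sup>2)" "integrable m (\<lambda>x. (g x)\<^sup>2)" "integrable m (\<lambda>x. f x * g x)"
    using f g Lp2_integrable_mult[OF f g] by (auto simp: Lp2_iff)
  have "(L2_norm m (\<lambda>x. f x + g x))\<^sup>2 = (\<integral>x. (f x)\<^sup>2 + 2 * (f x * g x) + (g x)\<^sup>2 \<partial>m)"
    unfolding L2_norm_square by (rule Bochner_Integration.integral_cong) (auto simp: power2_eq_square algebra_simps)
  also have "\<dots> = (L2_norm m f)\<^sup>2 + 2 * (\<integral>x. f x * g x \<partial>m) + (L2_norm m g)\<^sup>2"
    using i by (simp add: L2_norm_square)
  also have "\<dots> \<le> (L2_norm m f + L2_norm m g)\<^sup>2"
    using L2_Cauchy_Schwarz[OF f g] by (simp add: power2_sum)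
  finally show ?thesis by (rule power2_le_imp_le) (simp add: L2_norm_nonneg)
qed

text \<open>
  Expand \<open>a s * b s - a0 * b0\<close> in the differences and apply the Cauchy-Schwarz inequality to each term.
\<close>

lemma L2_inner_tendsto:
  assumes F: "\<forall>\<^sub>F s in F. a s \<in> Lp m 2 \<and> b s \<in> Lp m 2" and a: "a0 \<in> Lp m 2" and b: "b0 \<in> Lp m 2"
    and la: "((\<lambda>s. L2_norm m (\<lambda>x. a s x - a0 x)) \<longlongrightarrow> 0) F"
    and lb: "((\<lambda>s. L2_norm m (\<lambda>x. b s x - b0 x)) \<longlongrightarrow> 0) F"
  shows "((\<lambda>s. \<integral>x. a s x * b s x \<partial>m) \<longlongrightarrow> (\<integral>x. a0 x * b0 x \<partial>m)) F"
proof -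
  let ?\<alpha> = "\<lambda>s. L2_norm m (\<lambda>x. a s x - a0 x)" and ?\<beta> = "\<lambda>s. L2_norm m (\<lambda>x. b s x - b0 x)"
  have "((\<lambda>s. (\<integral>x. a s x * b s x \<partial>m) - (\<integral>x. a0 x * b0 x \<partial>m)) \<longlongrightarrow> 0) F"
  proof (rule Lim_null_comparison)
    show "\<forall>\<^sub>F s in F. norm ((\<integral>x. a s x * b s x \<partial>m) - (\<integral>x. a0 x * b0 x \<partial>m))
        \<le> ?\<alpha> s * ?\<beta> s + ?\<alpha> s * L2_norm m b0 + L2_norm m a0 * ?\<beta> s"
      using F
    proof eventually_elim
      case (elim s)
      have da: "(\<lambda>x. a s x - a0 x) \<in> Lp m 2" and db: "(\<lambda>x. b s x - b0 x) \<in> Lp m 2"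
        using elim a b by (auto intro: Lp2_diff)
      have "(\<integral>x. a s x * b s x \<partial>m) - (\<integral>x. a0 x * b0 x \<partial>m) = (\<integral>x. a s x * b s x - a0 x * b0 x \<partial>m)"
        using elim a b by (intro Bochner_Integration.integral_diff[symmetric] Lp2_integrable_mult) auto
      also have "\<dots> = (\<integral>x. (a s x - a0 x) * (b s x - b0 x) + (a s x - a0 x) * b0 x + a0 x * (b s x - b0 x) \<partial>m)"
        by (rule Bochner_Integration.integral_cong) (auto simp: algebra_simps)
      also have "\<dots> = (\<integral>x. (a s x - a0 x) * (b s x - b0 x) \<partial>m) + (\<integral>x. (a s x - a0 x) * b0 x \<partial>m)
          + (\<integral>x. a0 x * (b s x - b0 x) \<partial>m)"
        using Lp2_integrable_mult[OF da db] Lp2_integrable_mult[OF da b] Lp2_integrable_mult[OF a db]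
        by simp
      finally show ?case
        using L2_Cauchy_Schwarz[OF da db] L2_Cauchy_Schwarz[OF da b] L2_Cauchy_Schwarz[OF a db]
        unfolding real_norm_def by linarith
    qed
    show "((\<lambda>s. ?\<alpha> s * ?\<beta> s + ?\<alpha> s * L2_norm m b0 + L2_norm m a0 * ?\<beta> s) \<longlongrightarrow> 0) F"
      using la lb by (auto intro!: tendsto_eq_intros)
  qed
  then show ?thesis by (simp add: LIM_zero_iff)
qed

text \<open>
  A function and its negative have the same weak upper gradients, so the polarization is symmetric.
\<close>

lemma dirichlet_form_sym: "dirichlet_form m f g = dirichlet_form m g f"
proof -
  have wug: "weak_upper_gradient m (\<lambda>x. - u x) G \<longleftrightarrow> weak_upper_gradient m u G" for u G
  proof -
    have "\<bar>- a - - b\<bar> = \<bar>a - b\<bar>" for a b :: real by simp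
    then show ?thesis unfolding weak_upper_gradient_def by (simp only:)
  qed
  have S2: "(\<lambda>x. - u x) \<in> S2 m \<longleftrightarrow> u \<in> S2 m" for u
    by (auto simp: S2_def wug borel_measurable_uminus_eq)
  have W: "(\<lambda>x. - u x) \<in> W12 m \<longleftrightarrow> u \<in> W12 m" for u
    by (simp add: W12_def S2 Lp_def borel_measurable_uminus_eq)
  have "cheeger m (\<lambda>x. - u x) = cheeger m u" for u
    by (simp add: cheeger_def W min_weak_ug_def wug)
  from this[of "\<lambda>x. f x - g x"] have "cheeger m (\<lambda>x. f x - g x) = cheeger m (\<lambda>x. g x - f x)"
    by simp
  then show ?thesis by (simp add: dirichlet_form_def add.commute)
qed

lemma heat_flow_continuous:
  assumes h: "is_heat_flow m h" and f: "f \<in> Lp m 2" and t: "0 < t"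
  shows "((\<lambda>s. L2_norm m (\<lambda>x. h s f x - h t f x)) \<longlongrightarrow> 0) (at t)"
proof -
  have hL: "\<And>s. 0 < s \<Longrightarrow> h s f \<in> Lp m 2" using h f by (simp add: is_heat_flow_def)
  obtain g where g: "has_laplacian m (h t f) g"
    "((\<lambda>s. L2_norm m (\<lambda>x. (h s f x - h t f x) / (s - t) - g x)) \<longlongrightarrow> 0) (at t)"
    using h f t unfolding is_heat_flow_def by blast
  have gL: "g \<in> Lp m 2" using g(1) by (simp add: has_laplacian_def)
  let ?\<delta> = "\<lambda>s. L2_norm m (\<lambda>x. (h s f x - h t f x) / (s - t) - g x)"
  show ?thesis
  proof (rule Lim_null_comparison)
    have "\<forall>\<^sub>F s in at t. s \<in> {0<..}" using t by (intro eventually_at_in_open') auto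
    moreover have "\<forall>\<^sub>F s in at t. s \<noteq> t" by (simp add: eventually_at_filter)
    ultimately show "\<forall>\<^sub>F s in at t. norm (L2_norm m (\<lambda>x. h s f x - h t f x)) \<le> \<bar>s - t\<bar> * (?\<delta> s + L2_norm m g)"
    proof eventually_elim
      case (elim s)
      have q: "(\<lambda>x. (h s f x - h t f x) / (s - t)) \<in> Lp m 2"
        using Lp2_scale[OF Lp2_diff[OF hL hL], of s t "1 / (s - t)"] elim t by simp
      have "L2_norm m (\<lambda>x. h s f x - h t f x) = L2_norm m (\<lambda>x. (s - t) * ((h s f x - h t f x) / (s - t)))"
        using elim by simp
      also have "\<dots> = \<bar>s - t\<bar> * L2_norm m (\<lambda>x. ((h s f x - h t f x) / (s - t) - g x) + g x)"
        by (simp only: L2_norm_scale) simp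
      also have "\<dots> \<le> \<bar>s - t\<bar> * (?\<delta> s + L2_norm m g)"
        by (intro mult_left_mono L2_norm_triangle Lp2_diff q gL) auto
      finally show ?case by (simp add: L2_norm_nonneg)
    qed
    have "((\<lambda>s. \<bar>s - t\<bar> * (?\<delta> s + L2_norm m g)) \<longlongrightarrow> \<bar>t - t\<bar> * (0 + L2_norm m g)) (at t)"
      by (intro tendsto_intros g(2))
    then show "((\<lambda>s. \<bar>s - t\<bar> * (?\<delta> s + L2_norm m g)) \<longlongrightarrow> 0) (at t)" by simp
  qed
qed

lemma filterlim_minus_at: "filterlim (\<lambda>s. t - s) (at (t - s0)) (at s0)" for t s0 :: real
  by (rule filterlim_atI) (auto intro!: tendsto_eq_intros simp: eventually_at_filter)

text \<open>
  The product of \<open>h s f\<close> and \<open>h (t - s) g\<close> has derivative zero on \<open>(0, t)\<close>: the two terms given by the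
  Laplacian are values of the Dirichlet form with exchanged arguments. Its limits at the two ends of the
  interval are the two sides.
\<close>

lemma heat_flow_self_adjoint:
  assumes h: "is_heat_flow m h" and f: "f \<in> Lp m 2" and g: "g \<in> Lp m 2" and t: "0 < t"
  shows "(\<integral>x. h t f x * g x \<partial>m) = (\<integral>x. f x * h t g x \<partial>m)"
proof -
  have hL: "0 < s \<Longrightarrow> k \<in> Lp m 2 \<Longrightarrow> h s k \<in> Lp m 2" for s k using h by (simp add: is_heat_flow_def)
  define F where "F s = (\<integral>x. h s f x * h (t - s) g x \<partial>m)" for s
  have der: "(F has_real_derivative 0) (at s)" if s: "s \<in> {0<..<t}" for s
  proof -
    have s': "0 < s" "0 < t - s" using s by auto
    obtain u where u: "has_laplacian m (h s f) u"
      "((\<lambda>r. L2_norm m (\<lambda>x. (h r f x - h s f x) / (r - s) - u x)) \<longlongrightarrow> 0) (at s)"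
      using h f s' unfolding is_heat_flow_def by blast
    obtain v where v: "has_laplacian m (h (t - s) g) v"
      "((\<lambda>r. L2_norm m (\<lambda>x. (h r g x - h (t - s) g x) / (r - (t - s)) - v x)) \<longlongrightarrow> 0) (at (t - s))"
      using h g s' unfolding is_heat_flow_def by blast
    have uL: "u \<in> Lp m 2" "v \<in> Lp m 2" using u(1) v(1) by (auto simp: has_laplacian_def)
    note hs = hL[OF s'(1) f] hL[OF s'(2) g]
    let ?p = "\<lambda>r x. (h r f x - h s f x) / (r - s)"
    let ?q = "\<lambda>r x. (h (t - r) g x - h (t - s) g x) / ((t - r) - (t - s))"
    have near: "\<forall>\<^sub>F r in at s. r \<in> {0<..<t}" using s by (intro eventually_at_in_open') auto
    have inL: "\<forall>\<^sub>F r in at s. ?p r \<in> Lp m 2 \<and> ?q r \<in> Lp m 2 \<and> h r f \<in> Lp m 2 \<and> h (t - r) g \<in> Lp m 2"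
      using near
    proof eventually_elim
      case (elim r)
      then have r: "h r f \<in> Lp m 2" "h (t - r) g \<in> Lp m 2" using hL f g by auto
      show ?case
        using r Lp2_scale[OF Lp2_diff[OF r(1) hs(1)], of "1 / (r - s)"]
          Lp2_scale[OF Lp2_diff[OF r(2) hs(2)], of "1 / ((t - r) - (t - s))"] by simp
    qed
    have vlim: "((\<lambda>r. L2_norm m (\<lambda>x. ?q r x - v x)) \<longlongrightarrow> 0) (at s)"
      by (rule filterlim_compose[OF v(2) filterlim_minus_at])
    have glim: "((\<lambda>r. L2_norm m (\<lambda>x. h (t - r) g x - h (t - s) g x)) \<longlongrightarrow> 0) (at s)"
      by (rule filterlim_compose[OF heat_flow_continuous[OF h g s'(2)] filterlim_minus_at])
    have 1: "((\<lambda>r. \<integral>x. ?p r x * h (t - r) g x \<partial>m) \<longlongrightarrow> (\<integral>x. u x * h (t - s) g x \<partial>m)) (at s)"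
      by (rule L2_inner_tendsto[OF eventually_mono[OF inL] uL(1) hs(2) u(2) glim]) simp
    have "((\<lambda>r. L2_norm m (\<lambda>x. h s f x - h s f x)) \<longlongrightarrow> 0) (at s)"
      by (simp add: L2_norm_def)
    then have 2: "((\<lambda>r. \<integral>x. h s f x * ?q r x \<partial>m) \<longlongrightarrow> (\<integral>x. h s f x * v x \<partial>m)) (at s)"
      by (intro L2_inner_tendsto[OF eventually_mono[OF inL] hs(1) uL(2) _ vlim]) (simp_all add: hs)
    have "(\<integral>x. u x * h (t - s) g x \<partial>m) = - dirichlet_form m (h (t - s) g) (h s f)"
      using u(1) v(1) by (auto simp: has_laplacian_def mult.commute)
    moreover have "(\<integral>x. h s f x * v x \<partial>m) = - dirichlet_form m (h s f) (h (t - s) g)"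
      using u(1) v(1) by (auto simp: has_laplacian_def)
    ultimately have eq: "(\<integral>x. u x * h (t - s) g x \<partial>m) - (\<integral>x. h s f x * v x \<partial>m) = 0"
      by (simp add: dirichlet_form_sym[of m "h s f"])
    have "((\<lambda>r. (\<integral>x. ?p r x * h (t - r) g x \<partial>m) - (\<integral>x. h s f x * ?q r x \<partial>m)) \<longlongrightarrow> 0) (at s)"
      using tendsto_diff[OF 1 2] unfolding eq .
    moreover have "\<forall>\<^sub>F r in at s. r \<noteq> s" by (simp add: eventually_at_filter)
    with inL have "\<forall>\<^sub>F r in at s. (\<integral>x. ?p r x * h (t - r) g x \<partial>m) - (\<integral>x. h s f x * ?q r x \<partial>m) = (F r - F s) / (r - s)"
    proof eventually_elim
      case (elim r)
      have "(\<integral>x. ?p r x * h (t - r) g x \<partial>m) - (\<integral>x. h s f x * ?q r x \<partial>m)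
          = (\<integral>x. ?p r x * h (t - r) g x - h s f x * ?q r x \<partial>m)"
        using elim hs by (intro Bochner_Integration.integral_diff[symmetric] Lp2_integrable_mult) auto
      also have "\<dots> = (\<integral>x. (h r f x * h (t - r) g x - h s f x * h (t - s) g x) / (r - s) \<partial>m)"
      proof (rule Bochner_Integration.integral_cong[OF refl])
        fix x
        have "(t - r) - (t - s) = - (r - s)" by simp
        then have "?q r x = - ((h (t - r) g x - h (t - s) g x) / (r - s))" by (simp only: divide_minus_right)
        moreover have "A / d * B - C * - ((B - E) / d) = (A * B + C * (B - E)) / d" for A B C E d :: real
          by (simp add: add_divide_distrib)
        ultimately have "?p r x * h (t - r) g x - h s f x * ?q r x
            = ((h r f x - h s f x) * h (t - r) g x + h s f x * (h (t - r) g x - h (t - s) g x)) / (r - s)"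
          by simp
        then show "?p r x * h (t - r) g x - h s f x * ?q r x = (h r f x * h (t - r) g x - h s f x * h (t - s) g x) / (r - s)"
          by (simp add: algebra_simps)
      qed
      also have "\<dots> = (F r - F s) / (r - s)"
        unfolding F_def using elim hs by (simp add: Lp2_integrable_mult)
      finally show ?case .
    qed
    ultimately have "((\<lambda>r. (F r - F s) / (r - s)) \<longlongrightarrow> 0) (at s)"
      by (rule Lim_transform_eventually)
    then show ?thesis by (simp add: has_field_derivative_iff)
  qed
  have const: "F s = F (t / 2)" if "s \<in> {0<..<t}" for s
    using t that by (intro DERIV_isconst3[of 0 t]) (auto intro: der)
  have near: "\<forall>\<^sub>F s in at_right 0. s \<in> {0<..<t}"
    using t by (intro eventually_at_right_real) auto
  have right: "at_right 0 \<le> at (0::real)" by (simp add: at_le)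
  have init: "((\<lambda>s. L2_norm m (\<lambda>x. h s k x - k x)) \<longlongrightarrow> 0) (at_right 0)" if "k \<in> Lp m 2" for k
    using h that by (simp add: is_heat_flow_def)
  have minus: "filterlim (\<lambda>s. t - s) (at t) (at_right 0)"
    using filterlim_mono[OF filterlim_minus_at[of t 0] order_refl right] by simp
  have inL: "\<forall>\<^sub>F s in at_right 0. h s k \<in> Lp m 2 \<and> h (t - s) k' \<in> Lp m 2" if "k \<in> Lp m 2" "k' \<in> Lp m 2" for k k'
    using near by eventually_elim (use hL that in auto)
  have l1: "((\<lambda>s. F s) \<longlongrightarrow> (\<integral>x. f x * h t g x \<partial>m)) (at_right 0)"
    unfolding F_def
    by (rule L2_inner_tendsto[OF inL[OF f g] f hL[OF t g] init[OF f]
          filterlim_compose[OF heat_flow_continuous[OF h g t] minus]])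
  have l2: "((\<lambda>s. F (t - s)) \<longlongrightarrow> (\<integral>x. h t f x * g x \<partial>m)) (at_right 0)"
  proof -
    have "((\<lambda>s. \<integral>x. h s g x * h (t - s) f x \<partial>m) \<longlongrightarrow> (\<integral>x. g x * h t f x \<partial>m)) (at_right 0)"
      by (rule L2_inner_tendsto[OF inL[OF g f] g hL[OF t f] init[OF g]
          filterlim_compose[OF heat_flow_continuous[OF h f t] minus]])
    then show ?thesis by (simp add: F_def mult.commute)
  qed
  have "\<forall>\<^sub>F s in at_right 0. F s = F (t / 2)"
    by (rule eventually_mono[OF near]) (rule const)
  moreover have "\<forall>\<^sub>F s in at_right 0. F (t - s) = F (t / 2)"
    by (rule eventually_mono[OF near], rule const) simp
  ultimately have "((\<lambda>s. F s) \<longlongrightarrow> F (t / 2)) (at_right 0)" "((\<lambda>s. F (t - s)) \<longlongrightarrow> F (t / 2)) (at_right 0)"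
    by (auto intro: tendsto_eventually)
  then have "(\<integral>x. f x * h t g x \<partial>m) = F (t / 2)" "(\<integral>x. h t f x * g x \<partial>m) = F (t / 2)"
    using tendsto_unique[OF trivial_limit_at_right_real l1] tendsto_unique[OF trivial_limit_at_right_real l2] by auto
  then show ?thesis by simp
qed

section \<open>Regularization by the heat kernel\<close>

lemma curv_coeff_pos:
  assumes "0 < t"
  shows "0 < curv_coeff K t"
proof -
  consider "K = 0" | "0 < K" | "K < 0" by linarith
  then show ?thesis
  proof cases
    case 2
    then have "1 < exp (2 * K * t)" using assms by simp
    then show ?thesis using 2 by (simp add: curv_coeff_def)
  next
    case 3
    then have "2 * K * t < 0" using assms by (simp add: mult_neg_pos)
    then have "exp (2 * K * t) < 1" by simp
    then show ?thesis using 3 by (simp add: curv_coeff_def divide_neg_neg)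
  qed (use assms in \<open>simp add: curv_coeff_def\<close>)
qed

definition kernel_measure :: "'a measure \<Rightarrow> (real \<Rightarrow> 'a \<Rightarrow> 'a \<Rightarrow> real) \<Rightarrow> real \<Rightarrow> 'a \<Rightarrow> 'a measure" where
  "kernel_measure m r t x = density m (\<lambda>y. ennreal (r t x y))"

text \<open>
  For \<open>f \<ge> 0\<close> these are bounded functions with bounded support, hence in every \<open>L\<^sup>p\<close> when bounded sets have
  finite measure, and they increase to \<open>f\<close> with \<open>n\<close>.
\<close>

definition truncation :: "'a::metric_space \<Rightarrow> ('a \<Rightarrow> real) \<Rightarrow> nat \<Rightarrow> 'a \<Rightarrow> real" where
  "truncation x0 f n x = (if x \<in> cball x0 (real n) then min (f x) (real n) else 0)"

lemma truncation_measurable: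
  "f \<in> borel_measurable borel \<Longrightarrow> truncation x0 f n \<in> borel_measurable borel"
  unfolding truncation_def by (intro measurable_If_set borel_measurable_min borel_measurable_const) auto

lemma truncation_bounds:
  assumes "\<And>z. 0 \<le> f z"
  shows "0 \<le> truncation x0 f n z" "truncation x0 f n z \<le> f z" "truncation x0 f n z \<le> real n"
  using assms by (auto simp: truncation_def)

lemma truncation_incseq:
  assumes "\<And>z. 0 \<le> f z"
  shows "incseq (\<lambda>n. truncation x0 f n z)"
proof (rule incseq_SucI)
  fix n
  show "truncation x0 f n z \<le> truncation x0 f (Suc n) z"
    using assms[of z] by (auto simp: truncation_def min_def)
qed

lemma truncation_tendsto: "(\<lambda>n. truncation x0 f n z) \<longlonglongrightarrow> f z"
proof -
  obtain N :: nat where N: "max \<bar>f z\<bar> (dist x0 z) < real N" using reals_Archimedean2 by blast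
  have "\<forall>\<^sub>F n in sequentially. truncation x0 f n z = f z"
    using eventually_ge_at_top[of N]
  proof eventually_elim
    case (elim n)
    then have "max \<bar>f z\<bar> (dist x0 z) < real n" using N by (meson less_le_trans of_nat_mono)
    then show ?case by (auto simp: truncation_def)
  qed
  then show ?thesis by (rule tendsto_eventually)
qed

lemma nn_integral_truncation_tendsto:
  assumes f: "f \<in> borel_measurable borel" "\<And>z. 0 \<le> f z" and M: "sets M = sets borel"
  shows "(\<lambda>n. \<integral>\<^sup>+z. ennreal (truncation x0 f n z) \<partial>M) \<longlonglongrightarrow> (\<integral>\<^sup>+z. ennreal (f z) \<partial>M)"
proof (rule nn_integral_LIMSEQ)
  show "incseq (\<lambda>n z. ennreal (truncation x0 f n z))"
    using truncation_incseq[of f x0] f(2) by (auto simp: incseq_def le_fun_def intro!: ennreal_leI)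
  show "(\<lambda>z. ennreal (truncation x0 f n z)) \<in> borel_measurable M" for n
    using truncation_measurable[OF f(1)] by (simp add: measurable_cong_sets[OF M refl])
  show "(\<lambda>n. ennreal (truncation x0 f n z)) \<longlonglongrightarrow> ennreal (f z)" for z
    by (intro tendsto_ennrealI truncation_tendsto)
qed

lemma bounded_support_integrable:
  fixes g :: "'a::polish_space \<Rightarrow> real"
  assumes m: "metric_measure_space m" and g: "g \<in> borel_measurable borel"
    and C: "\<And>x. \<bar>g x\<bar> \<le> C" and supp: "\<And>x. x \<notin> cball x0 R \<Longrightarrow> g x = 0" and p: "0 < p"
  shows "integrable m (\<lambda>x. \<bar>g x\<bar> powr p)" and "g \<in> Lp m p" and "g \<in> Linf m" and "integrable m g"
proof -
  have sets: "sets m = sets borel" using m by (simp add: metric_measure_space_def)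
  have gm: "g \<in> borel_measurable m" using g by (simp add: measurable_cong_sets[OF sets refl])
  have fin: "emeasure m (cball x0 R) < \<infinity>" using m by (simp add: metric_measure_space_def)
  have i: "integrable m (\<lambda>x. k * indicator (cball x0 R) x)" for k :: real
    using fin by (intro integrable_mult_right integrable_real_indicator) (auto simp: sets)
  show int: "integrable m (\<lambda>x. \<bar>g x\<bar> powr p)"
  proof (rule Bochner_Integration.integrable_bound[OF i[of "C powr p"]])
    show "AE x in m. norm (\<bar>g x\<bar> powr p) \<le> norm (C powr p * indicator (cball x0 R) x)"
    proof (intro AE_I2)
      fix x
      show "norm (\<bar>g x\<bar> powr p) \<le> norm (C powr p * indicator (cball x0 R) x)"
        using supp[of x] powr_mono2[OF less_imp_le[OF p] _ C[of x]] p by (cases "x \<in> cball x0 R") auto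
    qed
  qed (use gm in measurable)
  then show "g \<in> Lp m p" using gm by (simp add: Lp_def)
  show "g \<in> Linf m" using gm C by (auto simp: Linf_def)
  show "integrable m g"
  proof (rule Bochner_Integration.integrable_bound[OF i[of C] gm])
    show "AE x in m. norm (g x) \<le> norm (C * indicator (cball x0 R) x)"
    proof (intro AE_I2)
      fix x
      show "norm (g x) \<le> norm (C * indicator (cball x0 R) x)"
        using supp[of x] C[of x] by (cases "x \<in> cball x0 R") auto
    qed
  qed
qed

lemma heat_eq_kernel_integral:
  assumes k: "is_heat_kernel m h r" and t: "0 < t" and f: "f \<in> borel_measurable m"
  shows "heat m r t f x = (\<integral>y. f y \<partial>kernel_measure m r t x)"
    and "integrable (kernel_measure m r t x) f \<longleftrightarrow> integrable m (\<lambda>y. f y * r t x y)"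
proof -
  have r: "r t x \<in> borel_measurable m" "\<And>y. 0 \<le> r t x y"
    using k t unfolding is_heat_kernel_def by (auto intro: less_imp_le)
  show "heat m r t f x = (\<integral>y. f y \<partial>kernel_measure m r t x)"
    unfolding kernel_measure_def heat_def using r f
    by (subst integral_density) (auto simp: mult.commute)
  show "integrable (kernel_measure m r t x) f \<longleftrightarrow> integrable m (\<lambda>y. f y * r t x y)"
    unfolding kernel_measure_def using r f
    by (subst integrable_density) (auto simp: mult.commute)
qed

text \<open>
  Monotone convergence along the truncations extends the Harnack inequality from bounded integrable
  functions to all nonnegative functions with a finite right-hand side.
\<close>

lemma harnack_kernel_heat:
  fixes m :: "'a::polish_space measure"
  assumes m: "metric_measure_space m" and k: "is_heat_kernel m h r"
    and H: "dimension_free_Harnack m r K" and t: "0 < t"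
  shows "harnack_kernel (kernel_measure m r t) (curv_coeff K t)"
proof (rule harnack_kernel.intro)
  have sets: "sets m = sets borel" using m by (simp add: metric_measure_space_def)
  let ?\<mu> = "kernel_measure m r t" and ?c = "curv_coeff K t"
  have r: "r t x \<in> borel_measurable m" "(\<integral>\<^sup>+y. ennreal (r t x y) \<partial>m) = 1" for x
    using k t unfolding is_heat_kernel_def by auto
  show "prob_space (?\<mu> x)" for x
  proof (rule prob_spaceI)
    have "emeasure (?\<mu> x) (space m) = (\<integral>\<^sup>+y. ennreal (r t x y) \<partial>m)"
      unfolding kernel_measure_def using r(1)[of x]
      by (subst emeasure_density) (auto intro!: nn_integral_cong)
    then show "emeasure (?\<mu> x) (space (?\<mu> x)) = 1" by (simp add: r(2) kernel_measure_def)
  qed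
  show sets_\<mu>: "sets (?\<mu> x) = sets borel" for x by (simp add: kernel_measure_def sets)
  show "0 < ?c" by (rule curv_coeff_pos[OF t])
  fix p :: real and f :: "'a \<Rightarrow> real" and x y :: 'a
  assume p: "1 < p" and f: "f \<in> borel_measurable borel" "\<And>z. 0 \<le> f z"
    and i: "integrable (?\<mu> y) (\<lambda>z. f z powr p)"
  define J where "J = (\<integral>z. f z powr p \<partial>?\<mu> y) * exp (p * ?c * (dist x y)\<^sup>2 / (2 * (p - 1)))"
  obtain x0 :: 'a where True by blast
  let ?g = "truncation x0 f"
  have gm: "?g n \<in> borel_measurable borel" for n by (rule truncation_measurable[OF f(1)])
  have gb: "0 \<le> ?g n z" "?g n z \<le> f z" "?g n z \<le> real n" for n z
    using truncation_bounds[of f x0 n z] f(2) by auto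
  have step: "integrable (?\<mu> x) (?g n) \<and> (\<integral>z. ?g n z \<partial>?\<mu> x) \<le> J powr (1 / p)" for n
  proof
    have b: "\<bar>?g n z\<bar> \<le> real n" for z using gb[of n z] by simp
    have s: "z \<notin> cball x0 (real n) \<Longrightarrow> ?g n z = 0" for z by (simp add: truncation_def)
    interpret x: prob_space "?\<mu> x" by fact
    show "integrable (?\<mu> x) (?g n)"
      using gm b by (intro x.integrable_const_bound[where B = "real n"])
        (auto simp: measurable_cong_sets[OF sets_\<mu> refl])
    have gmm: "?g n \<in> borel_measurable m" "(\<lambda>z. \<bar>?g n z\<bar> powr p) \<in> borel_measurable m"
      using gm[of n] by (auto simp: measurable_cong_sets[OF sets refl])
    have "?g n \<in> Lp m 1" by (rule bounded_support_integrable(2)[OF m gm b s]) simp_all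
    moreover have "?g n \<in> Linf m" by (rule bounded_support_integrable(3)[OF m gm b s zero_less_one])
    ultimately have "\<bar>heat m r t (?g n) x\<bar> powr p
          \<le> heat m r t (\<lambda>z. \<bar>?g n z\<bar> powr p) y * exp (p * ?c * (dist x y)\<^sup>2 / (2 * (p - 1)))"
      using H p t unfolding dimension_free_Harnack_def by blast
    also have "\<dots> \<le> J"
      unfolding J_def heat_eq_kernel_integral(1)[OF k t gmm(2)]
    proof (rule mult_right_mono)
      interpret y: prob_space "?\<mu> y" by fact
      show "(\<integral>z. \<bar>?g n z\<bar> powr p \<partial>?\<mu> y) \<le> (\<integral>z. f z powr p \<partial>?\<mu> y)"
      proof (rule integral_mono')
        show "\<bar>?g n z\<bar> powr p \<le> f z powr p" for z using gb p by (intro powr_mono2) auto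
      qed (use i in auto)
    qed simp
    finally have "(\<bar>heat m r t (?g n) x\<bar> powr p) powr (1 / p) \<le> J powr (1 / p)"
      using p by (intro powr_mono2) auto
    then show "(\<integral>z. ?g n z \<partial>?\<mu> x) \<le> J powr (1 / p)"
      using p heat_eq_kernel_integral(1)[OF k t gmm(1), of x] by (simp add: powr_powr)
  qed
  have "(\<integral>\<^sup>+z. ennreal (f z) \<partial>?\<mu> x) \<le> ennreal (J powr (1 / p))"
  proof (rule LIMSEQ_le_const2[OF nn_integral_truncation_tendsto[OF f sets_\<mu>[of x], where ?x0.0 = x0]])
    have "(\<integral>\<^sup>+z. ennreal (?g n z) \<partial>?\<mu> x) \<le> ennreal (J powr (1 / p))" for n
      using step[of n] gb by (subst nn_integral_eq_integral) (auto intro: ennreal_leI)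
    then show "\<exists>N. \<forall>n\<ge>N. (\<integral>\<^sup>+z. ennreal (?g n z) \<partial>?\<mu> x) \<le> ennreal (J powr (1 / p))" by blast
  qed
  note le = this
  have fi: "integrable (?\<mu> x) f"
    using f le_less_trans[OF le] by (intro integrableI_nonneg) (auto simp: measurable_cong_sets[OF sets_\<mu> refl])
  have "ennreal (\<integral>z. f z \<partial>?\<mu> x) \<le> ennreal (J powr (1 / p))"
    using le fi f(2) by (subst (asm) nn_integral_eq_integral) auto
  then have "(\<integral>z. f z \<partial>?\<mu> x) \<le> J powr (1 / p)" by (simp add: ennreal_le_iff)
  then have "(\<integral>z. f z \<partial>?\<mu> x) powr p \<le> (J powr (1 / p)) powr p"
    using p f(2) by (intro powr_mono2) auto
  also have "\<dots> = J" using p f(2) by (simp add: powr_powr J_def)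
  finally show "integrable (?\<mu> x) f \<and> (\<integral>z. f z \<partial>?\<mu> x) powr p
      \<le> (\<integral>z. f z powr p \<partial>?\<mu> y) * exp (p * ?c * (dist x y)\<^sup>2 / (2 * (p - 1)))"
    using fi by (simp add: J_def)
qed

text \<open>
  By symmetry of the heat flow, the integral of the averages of \<open>f\<close> over a bounded set \<open>B\<close> is the integral
  of \<open>f\<close> times the averages of the indicator of \<open>B\<close>, which are at most \<open>1\<close>. Hence the averages are
  finite almost everywhere, and \<open>m\<close> is not zero because it carries probability densities.
\<close>

lemma heat_of_integrable_finite:
  fixes m :: "'a::polish_space measure" and f :: "'a \<Rightarrow> real"
  assumes m: "metric_measure_space m" and h: "is_heat_flow m h" and k: "is_heat_kernel m h r"
    and H: "dimension_free_Harnack m r K" and t: "0 < t"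
    and f: "f \<in> borel_measurable borel" "\<And>z. 0 \<le> f z" and fi: "integrable m f"
  shows "\<exists>y. integrable (kernel_measure m r t y) f"
proof -
  have sets: "sets m = sets borel" using m by (simp add: metric_measure_space_def)
  let ?\<mu> = "kernel_measure m r t"
  interpret harnack_kernel ?\<mu> "curv_coeff K t" by (rule harnack_kernel_heat[OF m k H t])
  obtain x0 :: 'a where True by blast
  let ?g = "truncation x0 f"
  have gm: "?g n \<in> borel_measurable borel" for n by (rule truncation_measurable[OF f(1)])
  have gb: "0 \<le> ?g n z" "?g n z \<le> f z" "?g n z \<le> real n" for n z
    using truncation_bounds[of f x0 n z] f(2) by auto
  have b: "\<bar>?g n z\<bar> \<le> real n" for n z using gb[of n z] by simp
  have s: "z \<notin> cball x0 (real n) \<Longrightarrow> ?g n z = 0" for n z by (simp add: truncation_def)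
  have gmm: "?g n \<in> borel_measurable m" for n using gm by (simp add: measurable_cong_sets[OF sets refl])
  have g\<mu>: "integrable (?\<mu> x) (?g n)" "integrable (?\<mu> x) (\<lambda>z. ?g n z powr 2)" for n x
  proof -
    interpret x: prob_space "?\<mu> x" by (rule prob_space_mu)
    show "integrable (?\<mu> x) (?g n)"
      using gm b by (intro x.integrable_const_bound[where B = "real n"]) (auto simp: measurable_mu)
    show "integrable (?\<mu> x) (\<lambda>z. ?g n z powr 2)"
      using gm[of n] gb by (intro x.integrable_const_bound[where B = "real n powr 2"])
        (auto simp: measurable_mu intro!: AE_I2 powr_mono2 simp del: powr_numeral)
  qed
  have avem: "ave (?g n) \<in> borel_measurable m" for n
  proof -
    have "continuous_on UNIV (ave (?g n))"
      by (rule ave_continuous[OF gm gb(1) _ g\<mu>(2)]) simp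
    then show ?thesis
      using borel_measurable_continuous_onI by (simp add: measurable_cong_sets[OF sets refl])
  qed
  have bound: "(\<integral>\<^sup>+x. (\<integral>\<^sup>+z. ennreal (?g n z) \<partial>?\<mu> x) * indicator (cball x0 R) x \<partial>m) \<le> (\<integral>\<^sup>+z. ennreal (f z) \<partial>m)" for n R
  proof -
    let ?B = "cball x0 R" and ?i = "indicator (cball x0 R) :: 'a \<Rightarrow> real"
    have ib: "?i \<in> borel_measurable borel" "\<And>x. \<bar>?i x\<bar> \<le> 1" "\<And>x. x \<notin> ?B \<Longrightarrow> ?i x = 0"
      by (intro borel_measurable_indicator borel_closed closed_cball) simp_all
    have iL: "?i \<in> Lp m 2" by (rule bounded_support_integrable(2)[OF m ib]) simp_all
    have gL: "?g n \<in> Lp m 2" by (rule bounded_support_integrable(2)[OF m gm b s]) simp_all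
    have gi: "integrable m (?g n)" by (rule bounded_support_integrable(4)[OF m gm b s, where p = 1]) simp_all
    have im: "?i \<in> borel_measurable m" using iL by (simp add: Lp_def)
    have hL: "h t (?g n) \<in> Lp m 2" "h t ?i \<in> Lp m 2" using h t gL iL by (auto simp: is_heat_flow_def)
    have "AE x in m. h t (?g n) x = heat m r t (?g n) x" "AE x in m. h t ?i x = heat m r t ?i x"
      using k t gL iL unfolding is_heat_kernel_def by blast+
    then have hg: "AE x in m. h t (?g n) x = ave (?g n) x" and hi: "AE x in m. h t ?i x = ave ?i x"
      by (simp_all only: heat_eq_kernel_integral(1)[OF k t gmm] heat_eq_kernel_integral(1)[OF k t im] ave_def)
    have ave_i: "ave ?i x \<le> 1" for x
    proof -
      interpret x: prob_space "?\<mu> x" by (rule prob_space_mu)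
      have "ave ?i x \<le> (\<integral>z. 1 \<partial>?\<mu> x)"
        unfolding ave_def by (rule integral_mono') auto
      then show ?thesis by (simp add: x.prob_space)
    qed
    have prod_i: "integrable m (\<lambda>x. h t (?g n) x * ?i x)" by (rule Lp2_integrable_mult[OF hL(1) iL])
    have "(\<integral>\<^sup>+x. (\<integral>\<^sup>+z. ennreal (?g n z) \<partial>?\<mu> x) * indicator ?B x \<partial>m) = (\<integral>\<^sup>+x. ennreal (h t (?g n) x * ?i x) \<partial>m)"
    proof (rule nn_integral_cong_AE)
      show "AE x in m. (\<integral>\<^sup>+z. ennreal (?g n z) \<partial>?\<mu> x) * indicator ?B x = ennreal (h t (?g n) x * ?i x)"
        using hg
      proof eventually_elim
        case (elim x)
        have "(\<integral>\<^sup>+z. ennreal (?g n z) \<partial>?\<mu> x) = ennreal (ave (?g n) x)"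
          unfolding ave_def using g\<mu>(1) gb by (intro nn_integral_eq_integral) auto
        then show ?case using elim by (cases "x \<in> ?B") auto
      qed
    qed
    also have "\<dots> = ennreal (\<integral>x. h t (?g n) x * ?i x \<partial>m)"
    proof (rule nn_integral_eq_integral[OF prod_i])
      show "AE x in m. 0 \<le> h t (?g n) x * ?i x"
        using hg by eventually_elim (use gb in \<open>simp add: ave_def\<close>)
    qed
    also have "(\<integral>x. h t (?g n) x * ?i x \<partial>m) = (\<integral>x. ?g n x * h t ?i x \<partial>m)"
      by (rule heat_flow_self_adjoint[OF h gL iL t])
    also have "\<dots> \<le> (\<integral>x. ?g n x \<partial>m)"
    proof (rule integral_mono_AE[OF Lp2_integrable_mult[OF gL hL(2)] gi])
      show "AE x in m. ?g n x * h t ?i x \<le> ?g n x"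
        using hi by eventually_elim (use gb ave_i in \<open>simp add: mult_left_le\<close>)
    qed
    also have "ennreal (\<integral>x. ?g n x \<partial>m) = (\<integral>\<^sup>+x. ennreal (?g n x) \<partial>m)"
      using gi gb by (intro nn_integral_eq_integral[symmetric]) auto
    also have "\<dots> \<le> (\<integral>\<^sup>+z. ennreal (f z) \<partial>m)"
      using gb by (intro nn_integral_mono ennreal_leI) auto
    finally show ?thesis by (simp add: ennreal_leI)
  qed
  have fin: "(\<integral>\<^sup>+z. ennreal (f z) \<partial>m) < \<infinity>"
    using fi f(2) by (simp add: integrable_iff_bounded)
  have "AE x in m. x \<in> cball x0 R \<longrightarrow> (\<integral>\<^sup>+z. ennreal (f z) \<partial>?\<mu> x) < \<infinity>" for R
  proof -
    let ?I = "\<lambda>n x. (\<integral>\<^sup>+z. ennreal (?g n z) \<partial>?\<mu> x) * indicator (cball x0 R) x"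
    have Ieq: "(\<integral>\<^sup>+z. ennreal (?g n z) \<partial>?\<mu> x) = ennreal (ave (?g n) x)" for n x
      unfolding ave_def using g\<mu>(1) gb by (intro nn_integral_eq_integral) auto
    have Bm: "cball x0 R \<in> sets m" by (simp add: sets)
    have Im: "?I n \<in> borel_measurable m" for n
      unfolding Ieq using avem[of n] Bm by measurable
    have lim: "(\<lambda>n. ?I n x) \<longlonglongrightarrow> (\<integral>\<^sup>+z. ennreal (f z) \<partial>?\<mu> x) * indicator (cball x0 R) x" for x
      using nn_integral_truncation_tendsto[OF f sets_mu[of x], where ?x0.0 = x0]
      by (cases "x \<in> cball x0 R") auto
    have limm: "(\<lambda>x. (\<integral>\<^sup>+z. ennreal (f z) \<partial>?\<mu> x) * indicator (cball x0 R) x) \<in> borel_measurable m"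
      by (rule borel_measurable_LIMSEQ_order[OF lim Im])
    have "(\<lambda>n. \<integral>\<^sup>+x. ?I n x \<partial>m) \<longlonglongrightarrow> (\<integral>\<^sup>+x. (\<integral>\<^sup>+z. ennreal (f z) \<partial>?\<mu> x) * indicator (cball x0 R) x \<partial>m)"
    proof (rule nn_integral_LIMSEQ[OF _ Im lim])
      show "incseq ?I"
        using truncation_incseq[of f x0] f(2)
        by (auto simp: incseq_def le_fun_def intro!: mult_right_mono nn_integral_mono ennreal_leI)
    qed
    then have "(\<integral>\<^sup>+x. (\<integral>\<^sup>+z. ennreal (f z) \<partial>?\<mu> x) * indicator (cball x0 R) x \<partial>m) \<le> (\<integral>\<^sup>+z. ennreal (f z) \<partial>m)"
      by (rule LIMSEQ_le_const2) (use bound in blast)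
    then have "(\<integral>\<^sup>+x. (\<integral>\<^sup>+z. ennreal (f z) \<partial>?\<mu> x) * indicator (cball x0 R) x \<partial>m) \<noteq> \<infinity>"
      using fin by (auto simp: top_unique)
    from nn_integral_PInf_AE[OF limm this] show ?thesis
      by eventually_elim (auto simp: less_top)
  qed
  then have "AE x in m. \<forall>n::nat. x \<in> cball x0 (real n) \<longrightarrow> (\<integral>\<^sup>+z. ennreal (f z) \<partial>?\<mu> x) < \<infinity>"
    unfolding AE_all_countable by blast
  then have ae: "AE x in m. (\<integral>\<^sup>+z. ennreal (f z) \<partial>?\<mu> x) < \<infinity>"
  proof eventually_elim
    case (elim x)
    obtain n :: nat where "dist x0 x < real n" using reals_Archimedean2 by blast
    then have "x \<in> cball x0 (real n)" by simp
    with elim show ?case by blast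
  qed
  have "\<exists>y. (\<integral>\<^sup>+z. ennreal (f z) \<partial>?\<mu> y) < \<infinity>"
  proof (rule ccontr)
    assume "\<nexists>y. (\<integral>\<^sup>+z. ennreal (f z) \<partial>?\<mu> y) < \<infinity>"
    then have "AE x in m. False" using ae by (auto elim: eventually_mono)
    then have "AE x in m. ennreal (r t x0 x) = 0" by (auto elim: eventually_mono)
    then have "(\<integral>\<^sup>+x. ennreal (r t x0 x) \<partial>m) = (\<integral>\<^sup>+x. 0 \<partial>m)" by (rule nn_integral_cong_AE)
    then show False using k t by (simp add: is_heat_kernel_def)
  qed
  then obtain y where "(\<integral>\<^sup>+z. ennreal (f z) \<partial>?\<mu> y) < \<infinity>" by blast
  then have "integrable (?\<mu> y) f" using f by (intro integrableI_nonneg) (auto simp: measurable_mu)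
  then show ?thesis by blast
qed

text \<open>
  When \<open>f log f\<close> is integrable against the kernel, the extended real definitions reduce to real averages.
  Since the kernel is absolutely continuous, any Borel version \<open>f'\<close> of \<open>f\<close> may be used to compute them.
\<close>

lemma heat_entropy_eq:
  fixes m :: "'a::polish_space measure"
  assumes k: "is_heat_kernel m h r" and t: "0 < t" and f: "f \<in> borel_measurable m"
    and ae: "AE x in m. f x = f' x" and f': "f' \<in> borel_measurable m"
    and i: "integrable (kernel_measure m r t x) (\<lambda>y. f' y * ln (f' y))"
  shows "heat m r t f = (\<lambda>x. \<integral>y. f' y \<partial>kernel_measure m r t x)"
    and "heat_entropy m r t f x = ereal ((\<integral>y. f' y \<partial>kernel_measure m r t x) *
      ((\<integral>y. f' y * ln (f' y) \<partial>kernel_measure m r t x)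
        - (\<integral>y. f' y \<partial>kernel_measure m r t x) * ln (\<integral>y. f' y \<partial>kernel_measure m r t x)))"
proof -
  let ?\<mu> = "kernel_measure m r t"
  have r: "r t x \<in> borel_measurable m" for x using k t by (simp add: is_heat_kernel_def)
  show heat: "heat m r t f = (\<lambda>x. \<integral>y. f' y \<partial>?\<mu> x)"
  proof
    fix x
    have "heat m r t f x = heat m r t f' x"
      unfolding heat_def using f f' r[of x] ae
      by (intro integral_cong_AE) (auto elim: eventually_mono)
    then show "heat m r t f x = (\<integral>y. f' y \<partial>?\<mu> x)" by (simp add: heat_eq_kernel_integral(1)[OF k t f'])
  qed
  let ?\<phi> = "\<lambda>y. f' y * ln (f' y)"
  have \<phi>m: "?\<phi> \<in> borel_measurable m" using f' by measurable
  have \<phi>i: "integrable m (\<lambda>y. ?\<phi> y * r t x y)" using i heat_eq_kernel_integral(2)[OF k t \<phi>m] by simp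
  have eq: "AE y in m. f y * ln (f y) * r t x y = ?\<phi> y * r t x y" using ae by eventually_elim simp
  have "heat_ext m r t (\<lambda>y. f y * ln (f y)) x
      = enn2ereal (\<integral>\<^sup>+y. ennreal (?\<phi> y * r t x y) \<partial>m) - enn2ereal (\<integral>\<^sup>+y. ennreal (- (?\<phi> y * r t x y)) \<partial>m)"
  proof -
    have "(\<integral>\<^sup>+y. ennreal (f y * ln (f y) * r t x y) \<partial>m) = (\<integral>\<^sup>+y. ennreal (?\<phi> y * r t x y) \<partial>m)"
      by (rule nn_integral_cong_AE, rule eventually_mono[OF eq]) (simp only:)
    moreover have "(\<integral>\<^sup>+y. ennreal (- (f y * ln (f y) * r t x y)) \<partial>m) = (\<integral>\<^sup>+y. ennreal (- (?\<phi> y * r t x y)) \<partial>m)"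
      by (rule nn_integral_cong_AE, rule eventually_mono[OF eq]) (simp only:)
    ultimately show ?thesis by (simp only: heat_ext_def)
  qed
  also have "\<dots> = ereal (\<integral>y. ?\<phi> y * r t x y \<partial>m)"
  proof -
    have fin: "(\<integral>\<^sup>+y. ennreal (?\<phi> y * r t x y) \<partial>m) \<noteq> \<infinity>" "(\<integral>\<^sup>+y. ennreal (- (?\<phi> y * r t x y)) \<partial>m) \<noteq> \<infinity>"
      using \<phi>i unfolding real_integrable_def by auto
    have conv: "enn2ereal a = ereal (enn2real a)" if "a \<noteq> \<infinity>" for a
      using that by (cases a) (auto simp: enn2ereal_ennreal)
    show ?thesis using real_lebesgue_integral_def[OF \<phi>i] conv[OF fin(1)] conv[OF fin(2)] by simp
  qed
  also have "(\<integral>y. ?\<phi> y * r t x y \<partial>m) = (\<integral>y. ?\<phi> y \<partial>?\<mu> x)"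
    using heat_eq_kernel_integral(1)[OF k t \<phi>m, of x] by (simp add: heat_def)
  finally have ext: "heat_ext m r t (\<lambda>y. f y * ln (f y)) x = ereal (\<integral>y. ?\<phi> y \<partial>?\<mu> x)" .
  show "heat_entropy m r t f x = ereal ((\<integral>y. f' y \<partial>?\<mu> x) *
      ((\<integral>y. ?\<phi> y \<partial>?\<mu> x) - (\<integral>y. f' y \<partial>?\<mu> x) * ln (\<integral>y. f' y \<partial>?\<mu> x)))"
    unfolding heat_entropy_def ext heat by simp
qed

lemma lip_le:
  assumes S: "0 \<le> S" and ev: "\<And>e. 0 < e \<Longrightarrow> \<forall>\<^sub>F y in at x. \<bar>u y - u x\<bar> \<le> (S + e) * dist y x"
  shows "(lip u x)\<^sup>2 \<le> ereal (S\<^sup>2)"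
proof (cases "x islimpt UNIV")
  case True
  then have nt: "at x \<noteq> bot" by (simp add: trivial_limit_within)
  have "lip u x \<le> ereal S + ereal e" if e: "0 < e" for e :: real
  proof -
    have "\<forall>\<^sub>F y in at x. y \<noteq> x" by (simp add: eventually_at_filter)
    with ev[OF e] have "\<forall>\<^sub>F y in at x. ereal (\<bar>u x - u y\<bar> / dist x y) \<le> ereal (S + e)"
    proof eventually_elim
      case (elim y)
      then have "0 < dist x y" by simp
      then show ?case using elim by (simp add: divide_le_eq dist_commute abs_minus_commute)
    qed
    then show ?thesis using True by (simp add: lip_def Limsup_bounded)
  qed
  then have le: "lip u x \<le> ereal S" by (rule ereal_le_epsilon2)
  have ge: "0 \<le> lip u x"
    using True nt by (auto simp: lip_def intro!: le_Limsup always_eventually)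
  obtain l where l: "lip u x = ereal l" using le ge by (cases "lip u x") auto
  then have "l\<^sup>2 \<le> S\<^sup>2" using le ge by (intro power_mono) auto
  then show ?thesis by (simp add: l)
qed (simp add: lip_def zero_ereal_def)

lemma heat_gradient_estimates:
  fixes m :: "'a::polish_space measure"
  assumes m: "metric_measure_space m" and k: "is_heat_kernel m h r"
    and H: "dimension_free_Harnack m r K" and t: "0 < t"
    and f: "f \<in> borel_measurable m" and ae: "AE x in m. f x = f' x"
    and f': "f' \<in> borel_measurable borel" "\<And>z. 0 \<le> f' z"
    and q: "1 < q" and i: "integrable (kernel_measure m r t y0) (\<lambda>z. f' z powr q)"
  shows "(lip (heat m r t f) x)\<^sup>2 \<le> ereal (2 * curv_coeff K t) * heat_entropy m r t f x"
    and "heat m r t f \<in> S2_loc m"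
    and "AE x in m. ereal ((min_weak_ug_loc m (heat m r t f) x)\<^sup>2)
              \<le> ereal (2 * curv_coeff K t) * heat_entropy m r t f x"
proof -
  have sets: "sets m = sets borel" using m by (simp add: metric_measure_space_def)
  let ?c = "curv_coeff K t"
  interpret harnack_kernel "kernel_measure m r t" ?c by (rule harnack_kernel_heat[OF m k H t])
  have f'm: "f' \<in> borel_measurable m" using f'(1) by (simp add: measurable_cong_sets[OF sets refl])
  note reg = ave_entropy_regularity[OF f' q i]
  note eq = heat_entropy_eq[OF k t f ae f'm reg(1)]
  have u: "heat m r t f = ave f'" by (simp add: eq(1) ave_def fun_eq_iff)
  have ent: "heat_entropy m r t f x = ereal (ave f' x * entropy f' x)" for x
    unfolding eq(2) by (simp add: ave_def entropy_def)
  define R where "R x = sqrt (2 * ?c * (ave f' x * entropy f' x))" for x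
  have nn: "0 \<le> 2 * ?c * (ave f' x * entropy f' x)" for x
    using c_pos reg(2)[of x] f'(2) by (simp add: ave_def)
  have R0: "0 \<le> R x" for x using nn by (simp add: R_def)
  have R2: "ereal ((R x)\<^sup>2) = ereal (2 * ?c) * heat_entropy m r t f x" for x
    using nn[of x] by (simp add: R_def ent)
  have loc: "\<forall>\<^sub>F y in at x. \<bar>heat m r t f y - heat m r t f x\<bar> \<le> (R x + e) * dist y x" if "0 < e" for x e
    unfolding u R_def by (rule ave_gradient_bound[OF f' q i that])
  show "(lip (heat m r t f) x)\<^sup>2 \<le> ereal (2 * ?c) * heat_entropy m r t f x"
    using lip_le[OF R0 loc, of x] by (simp only: R2)
  have Rm: "R \<in> borel_measurable borel" unfolding R_def using reg(3) by measurable
  have lip: "\<exists>L\<ge>0. \<forall>x\<in>B. \<forall>y\<in>B. \<bar>heat m r t f x - heat m r t f y\<bar> \<le> L * dist x y" if "bounded B" for B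
    unfolding u by (rule ave_lipschitz_on_bounded[OF f' q i that])
  show "heat m r t f \<in> S2_loc m"
    by (rule locally_lipschitz_gradient_bound(1)[OF m lip Rm R0 loc])
  have G: "AE x in m. 0 \<le> min_weak_ug_loc m (heat m r t f) x \<and> min_weak_ug_loc m (heat m r t f) x \<le> R x"
    by (rule locally_lipschitz_gradient_bound(2)[OF m lip Rm R0 loc])
  show "AE x in m. ereal ((min_weak_ug_loc m (heat m r t f) x)\<^sup>2) \<le> ereal (2 * ?c) * heat_entropy m r t f x"
    using G
  proof eventually_elim
    case (elim x)
    then have "(min_weak_ug_loc m (heat m r t f) x)\<^sup>2 \<le> (R x)\<^sup>2" by (intro power_mono) auto
    then show ?case by (simp only: R2[symmetric] ereal_less_eq)
  qed
qed

text \<open>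
  The squares of the positive and of the negative part, each increased by \<open>1\<close>, have averages bounded
  uniformly in space, so that the local Lipschitz estimate holds globally.
\<close>

lemma heat_bounded_lipschitz:
  fixes m :: "'a::polish_space measure"
  assumes m: "metric_measure_space m" and k: "is_heat_kernel m h r"
    and H: "dimension_free_Harnack m r K" and t: "0 < t" and f: "f \<in> Linf m"
  shows "\<exists>L. L-lipschitz_on UNIV (heat m r t f)"
proof -
  have sets: "sets m = sets borel" using m by (simp add: metric_measure_space_def)
  let ?c = "curv_coeff K t"
  interpret harnack_kernel "kernel_measure m r t" ?c by (rule harnack_kernel_heat[OF m k H t])
  have fm: "f \<in> borel_measurable m" using f by (simp add: Linf_def)
  then have fb: "f \<in> borel_measurable borel" by (simp add: measurable_cong_sets[OF sets refl])
  obtain C0 where "AE x in m. \<bar>f x\<bar> \<le> C0" using f by (auto simp: Linf_def)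
  then have C: "AE x in m. \<bar>f x\<bar> \<le> max C0 0" by (auto elim: eventually_mono)
  define C where "C = max C0 0"
  have C0: "0 \<le> C" by (simp add: C_def)
  define fp where "fp x = min (max (f x) 0) C" for x
  define fn where "fn x = min (max (- f x) 0) C" for x
  have meas: "fp \<in> borel_measurable borel" "fn \<in> borel_measurable borel"
    unfolding fp_def fn_def using fb by measurable
  have bnd: "0 \<le> fp x" "fp x \<le> C" "0 \<le> fn x" "fn x \<le> C" for x using C0 by (auto simp: fp_def fn_def)
  have lip: "\<bar>ave g x - ave g y\<bar> \<le> ((C + 1) powr 2) * exp ?c * (?c + 1 / 1) * dist x y"
    if g: "g \<in> borel_measurable borel" "\<And>x. 0 \<le> g x" "\<And>x. g x \<le> C" for g x y
  proof (rule ave_lipschitz[where S = UNIV, OF g(1,2)])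
    fix x
    interpret x: prob_space "kernel_measure m r t x" by (rule prob_space_mu)
    have le: "(g z + 1) powr (1 + 1) \<le> (C + 1) powr 2" for z
      using g(2)[of z] g(3)[of z] powr_mono2[of 2 "g z + 1" "C + 1"] by simp
    show int: "integrable (kernel_measure m r t x) (\<lambda>z. (g z + 1) powr (1 + 1))"
      using g(1) le by (intro x.integrable_const_bound[where B = "(C + 1) powr 2"])
        (auto simp: measurable_mu)
    have "ave (\<lambda>z. (g z + 1) powr (1 + 1)) x \<le> (\<integral>z. (C + 1) powr 2 \<partial>kernel_measure m r t x)"
      unfolding ave_def using int le by (intro integral_mono) auto
    then show "ave (\<lambda>z. (g z + 1) powr (1 + 1)) x \<le> (C + 1) powr 2" by (simp add: x.prob_space)
  qed auto
  have heat: "heat m r t f x = ave fp x - ave fn x" for x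
  proof -
    interpret x: prob_space "kernel_measure m r t x" by (rule prob_space_mu)
    have r: "r t x \<in> borel_measurable m" using k t by (simp add: is_heat_kernel_def)
    have i: "integrable (kernel_measure m r t x) fp" "integrable (kernel_measure m r t x) fn"
      using meas bnd by (auto intro!: x.integrable_const_bound[where B = C] simp: measurable_mu)
    have dm: "(\<lambda>y. fp y - fn y) \<in> borel_measurable m"
      using meas by (simp add: measurable_cong_sets[OF sets refl])
    have "AE y in m. f y * r t x y = (fp y - fn y) * r t x y"
      using C by eventually_elim (auto simp: fp_def fn_def C_def)
    then have "heat m r t f x = heat m r t (\<lambda>y. fp y - fn y) x"
      unfolding heat_def using fm dm r by (intro integral_cong_AE) auto
    also have "\<dots> = ave fp x - ave fn x"
      unfolding heat_eq_kernel_integral(1)[OF k t dm] ave_def using i by simp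
    finally show ?thesis .
  qed
  let ?L = "((C + 1) powr 2) * exp ?c * (?c + 1 / 1)"
  have "(2 * ?L)-lipschitz_on UNIV (heat m r t f)"
  proof (rule lipschitz_onI)
    fix x y
    show "dist (heat m r t f x) (heat m r t f y) \<le> 2 * ?L * dist x y"
      unfolding dist_real_def heat using lip[OF meas(1) bnd(1,2), of x y] lip[OF meas(2) bnd(3,4), of x y]
      by linarith
  qed (use c_pos in simp)
  then show ?thesis by blast
qed

theorem proposition3p2:
  fixes m :: "'a::polish_space measure"
    and h :: "real \<Rightarrow> ('a \<Rightarrow> real) \<Rightarrow> 'a \<Rightarrow> real"
    and r :: "real \<Rightarrow> 'a \<Rightarrow> 'a \<Rightarrow> real"
    and K :: real
  assumes "metric_measure_space m"
    and "infinitesimally_Hilbertian m"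
    and "is_heat_flow m h"
    and "is_heat_kernel m h r"
    and "dimension_free_Harnack m r K"
  shows "(\<forall>t>0. \<forall>f\<in>Linf m. \<exists>L. L-lipschitz_on UNIV (heat m r t f)) \<and>
    (\<forall>t>0. \<forall>f\<in>Linf m. (AE x in m. 0 \<le> f x) \<longrightarrow>
       (\<forall>x. (lip (heat m r t f) x)\<^sup>2
              \<le> ereal (2 * curv_coeff K t) * heat_entropy m r t f x)) \<and>
    (\<forall>p>1. \<forall>t>0. \<forall>f\<in>Lp m p. (AE x in m. 0 \<le> f x) \<longrightarrow>
       heat m r t f \<in> S2_loc m \<and>
       (AE x in m. ereal ((min_weak_ug_loc m (heat m r t f) x)\<^sup>2)
              \<le> ereal (2 * curv_coeff K t) * heat_entropy m r t f x))"
proof (intro conjI allI impI ballI)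
  note m = assms(1) and h = assms(3) and k = assms(4) and H = assms(5)
  have sets: "sets m = sets borel" using m by (simp add: metric_measure_space_def)
  fix t :: real assume t: "0 < t"
  show "\<exists>L. L-lipschitz_on UNIV (heat m r t f)" if "f \<in> Linf m" for f
    by (rule heat_bounded_lipschitz[OF m k H t that])
  show "(lip (heat m r t f) x)\<^sup>2 \<le> ereal (2 * curv_coeff K t) * heat_entropy m r t f x"
    if f: "f \<in> Linf m" "AE x in m. 0 \<le> f x" for f x
  proof -
    have fm: "f \<in> borel_measurable m" using f by (simp add: Linf_def)
    obtain C where C: "AE x in m. \<bar>f x\<bar> \<le> C" using f by (auto simp: Linf_def)
    define f' where "f' x = min (max (f x) 0) \<bar>C\<bar>" for x
    have f': "f' \<in> borel_measurable borel" "\<And>z. 0 \<le> f' z" "\<And>z. f' z \<le> \<bar>C\<bar>"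
      using fm by (auto simp: f'_def[abs_def] measurable_cong_sets[OF sets refl])
    have ae: "AE x in m. f x = f' x" using C f(2) by eventually_elim (auto simp: f'_def)
    interpret harnack_kernel "kernel_measure m r t" "curv_coeff K t" by (rule harnack_kernel_heat[OF m k H t])
    interpret x: prob_space "kernel_measure m r t x" by (rule prob_space_mu)
    have "integrable (kernel_measure m r t x) (\<lambda>z. f' z powr 2)"
      using f' by (intro x.integrable_const_bound[where B = "\<bar>C\<bar> powr 2"])
        (auto simp: measurable_mu intro!: AE_I2 powr_mono2 simp del: powr_numeral)
    from heat_gradient_estimates(1)[OF m k H t fm ae f'(1,2) _ this] show ?thesis by simp
  qed
  fix p :: real assume p: "1 < p"
  fix f assume f: "f \<in> Lp m p" "AE x in m. 0 \<le> f x"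
  have fm: "f \<in> borel_measurable m" using f by (simp add: Lp_def)
  define f' where "f' x = max (f x) 0" for x
  have f': "f' \<in> borel_measurable borel" "\<And>z. 0 \<le> f' z"
    using fm by (auto simp: f'_def[abs_def] measurable_cong_sets[OF sets refl])
  have ae: "AE x in m. f x = f' x" using f(2) by eventually_elim (auto simp: f'_def)
  have pw: "(\<lambda>z. f' z powr p) \<in> borel_measurable borel" using f'(1) by measurable
  have "integrable m (\<lambda>z. f' z powr p)"
  proof (rule Bochner_Integration.integrable_bound)
    show "integrable m (\<lambda>z. \<bar>f z\<bar> powr p)" using f by (simp add: Lp_def)
    show "(\<lambda>z. f' z powr p) \<in> borel_measurable m" using pw by (simp add: measurable_cong_sets[OF sets refl])
    show "AE z in m. norm (f' z powr p) \<le> norm (\<bar>f z\<bar> powr p)"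
      using p by (intro AE_I2) (auto simp: f'_def intro!: powr_mono2)
  qed
  then obtain y where "integrable (kernel_measure m r t y) (\<lambda>z. f' z powr p)"
    using heat_of_integrable_finite[OF m h k H t pw] by auto
  from heat_gradient_estimates(2,3)[OF m k H t fm ae f' p this]
  show "heat m r t f \<in> S2_loc m"
    "AE x in m. ereal ((min_weak_ug_loc m (heat m r t f) x)\<^sup>2) \<le> ereal (2 * curv_coeff K t) * heat_entropy m r t f x" .
qed

end
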